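(* For Lebesgue-almost every $z\in U$, $$\lim_{n\to\infty}\frac1n\log|q_n(z)|=\int_{\hat U}\log|w|\,d\hat\mu(z,w),$$ and the right-hand side is finite and positive.
   Context: Let $\zeta=\frac{1+\sqrt{-3}}2$, $\eta=\frac{3+\sqrt{-3}}2$, $\mathfrak o(\sqrt{-3})=\mathbb Z+\mathbb Z\zeta$, $\mathcal J=\eta\cdot\mathfrak o(\sqrt{-3})$. $U$ is the fundamental domain of $\mathbb C/\mathcal J$ consisting of the open regular hexagon with vertices $\zeta^k$ ($0\le k\le 5$), together with the three open sides $\{t\zeta+(1-t)(-\overline\zeta):0<t<1\}$, $\{t(-\zeta)+(1-t)(-1):0<t<1\}$, $\{t+(1-t)\overline\zeta:0<t<1\}$ and the two vertices $-\zeta,\overline\zeta$. For $z\in\mathbb C$, $[z]$ is the unique $a\in\mathcal J$ with $z\in a+U$. The map $T:U\to U$ is $T(z)=\frac1z-[\frac1z]$ for $z\ne0$, $T(0)=0$; $b_n(z)=[1/T^{n-1}(z)]$ when $T^{n-1}(z)\ne0$ (true for all $n$ for almost every $z$). The denominators are $q_{-1}(z)=0$, $q_0(z)=1$, $q_{n}(z)=b_{n}(z)q_{n-1}(z)+q_{n-2}(z)$ for $n\ge1$. Write $z=x+yi$, $r=\frac{\sqrt3}3$. Put $V_{1,1}=\{z\in U:|z-\frac13\overline\eta|<r,\ |z-\frac13\sqrt{-3}|<r\}$, $V_{2,1}=\{z\in U:|z-\frac23\eta|>r,\ |z-\frac13\sqrt{-3}|>r,\ x>0,\ y>0\}$, $V_{3,1}=\{z\in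 U:|z-\frac23\eta|>r,\ |z-\frac13\overline\eta|>r,\ y>0,\ y<\sqrt3x\}$, $V_{4,1}=\{z\in U:|z-\frac13\overline\eta|<r,\ |z-\frac23\eta|<r\}$, $V_{5,1}=\{z\in U:|z-\frac23\eta|<r,\ |z-\frac13\sqrt{-3}|<r\}$, $V_{6,1}=\{z\in U:|z-\frac13\overline\eta|>r,\ |z-\frac13\sqrt{-3}|>r,\ x>0,\ y>0\}$, and $V_{k,\ell}=\zeta^{\ell-1}V_{k,1}$ for $1\le k,\ell\le6$. Put $V^*_{0,1,1}=\{|z|>1,\ |z-\frac{\sqrt{-3}}2|>\frac12,\ |z-\frac\eta2|>\frac12,\ |z-\frac{\overline\eta}2|>\frac12\}$, $V^*_{0,2,1}=\{|z|>1,\ |z-\frac\eta2|>\frac12,\ |z-\frac{\overline\eta}2|>\frac12\}$, $V^*_{0,3,1}=\{|z|>1,\ |z-\frac{\sqrt{-3}}2|>\frac12,\ |z-\frac\eta2|>\frac12\}$, $V^*_{0,4,1}=\{|z|>1,\ |z-\eta|>1,\ |z-\frac{\overline\eta}2|>\frac12\}$, $V^*_{0,5,1}=\{|z|>1,\ |z-\eta|>1,\ |z-\frac{\sqrt{-3}}2|>\frac12\}$, $V^*_{0,6,1}=\{|z|>1,\ |z-\eta|>1\}$ (all subsets of $\mathbb C$), and $V^*_{0,k,\ell}=\zeta^{\ell-1}V^*_{0,k,1}$. $\hat U=\bigcup_{1\le k,\ell\le6}V_{k,\ell}\times V^*_{0,k,\ell}$, and $\hat\mu$ is the probability measure on $\hat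 U$ with $d\hat\mu=C_0\,|z-w|^{-4}\,d(\lambda\times\lambda)(z,w)$, where $\lambda$ is Lebesgue measure on $\mathbb C$ and $C_0$ is the normalizing constant. *)

theory Defs
  imports "HOL-Analysis.Analysis"
begin

definition sqrt_m3 :: complex where
  "sqrt_m3 = \<i> * complex_of_real (sqrt 3)"

definition zeta :: complex where
  "zeta = (1 + sqrt_m3) / 2"

definition eta :: complex where
  "eta = (3 + sqrt_m3) / 2"

definition eisenstein_ints :: "complex set" where
  "eisenstein_ints = {of_int a + of_int b * zeta | a b :: int. True}"

definition ideal_J :: "complex set" where
  "ideal_J = {eta * x | x. x \<in> eisenstein_ints}"

definition U :: "complex set" where
  "U = interior (convex hull {zeta ^ k | k. k \<le> 5})
     \<union> {of_real t * zeta + of_real (1 - t) * (- cnj zeta) | t. 0 < t \<and> t < 1}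
     \<union> {of_real t * (- zeta) + of_real (1 - t) * (- 1) | t. 0 < t \<and> t < 1}
     \<union> {of_real t + of_real (1 - t) * cnj zeta | t. 0 < t \<and> t < 1}
     \<union> {- zeta, cnj zeta}"

definition nearest_J :: "complex \<Rightarrow> complex" where
  "nearest_J z = (THE a. a \<in> ideal_J \<and> (\<exists>u\<in>U. z = a + u))"

definition T_map :: "complex \<Rightarrow> complex" where
  "T_map z = (if z = 0 then 0 else 1 / z - nearest_J (1 / z))"

(* Meaningful for n >= 1 and (T_map ^^ (n - 1)) z \<noteq> 0; the orbit of almost every z avoids 0. *)
definition b_digit :: "nat \<Rightarrow> complex \<Rightarrow> complex" where
  "b_digit n z = nearest_J (1 / (T_map ^^ (n - 1)) z)"

(* The recursion starts at index -1, so the index is shifted by one: q_shift m z is q_{m-1}(z). *)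
fun q_shift :: "nat \<Rightarrow> complex \<Rightarrow> complex" where
  "q_shift 0 z = 0"
| "q_shift (Suc 0) z = 1"
| "q_shift (Suc (Suc n)) z = b_digit (Suc n) z * q_shift (Suc n) z + q_shift n z"

definition q_denom :: "nat \<Rightarrow> complex \<Rightarrow> complex" where
  "q_denom n z = q_shift (Suc n) z"

definition rad :: real where
  "rad = sqrt 3 / 3"

(* For k = 1, ..., 6; the last branch is the case k = 6. *)
definition V1 :: "nat \<Rightarrow> complex set" where
  "V1 k =
    (if k = 1 then {z \<in> U. cmod (z - cnj eta / 3) < rad \<and> cmod (z - sqrt_m3 / 3) < rad}
     else if k = 2 then {z \<in> U. cmod (z - 2 / 3 * eta) > rad \<and> cmod (z - sqrt_m3 / 3) > rad
                                \<and> Re z > 0 \<and> Im z > 0}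
     else if k = 3 then {z \<in> U. cmod (z - 2 / 3 * eta) > rad \<and> cmod (z - cnj eta / 3) > rad
                                \<and> Im z > 0 \<and> Im z < sqrt 3 * Re z}
     else if k = 4 then {z \<in> U. cmod (z - cnj eta / 3) < rad \<and> cmod (z - 2 / 3 * eta) < rad}
     else if k = 5 then {z \<in> U. cmod (z - 2 / 3 * eta) < rad \<and> cmod (z - sqrt_m3 / 3) < rad}
     else {z \<in> U. cmod (z - cnj eta / 3) > rad \<and> cmod (z - sqrt_m3 / 3) > rad
                  \<and> Re z > 0 \<and> Im z > 0})"

definition V :: "nat \<Rightarrow> nat \<Rightarrow> complex set" where
  "V k l = (\<lambda>z. zeta ^ (l - 1) * z) ` V1 k"

definition V1_dual :: "nat \<Rightarrow> complex set" where
  "V1_dual k =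
    (if k = 1 then {w. cmod w > 1 \<and> cmod (w - sqrt_m3 / 2) > 1 / 2
                       \<and> cmod (w - eta / 2) > 1 / 2 \<and> cmod (w - cnj eta / 2) > 1 / 2}
     else if k = 2 then {w. cmod w > 1 \<and> cmod (w - eta / 2) > 1 / 2
                            \<and> cmod (w - cnj eta / 2) > 1 / 2}
     else if k = 3 then {w. cmod w > 1 \<and> cmod (w - sqrt_m3 / 2) > 1 / 2
                            \<and> cmod (w - eta / 2) > 1 / 2}
     else if k = 4 then {w. cmod w > 1 \<and> cmod (w - eta) > 1 \<and> cmod (w - cnj eta / 2) > 1 / 2}
     else if k = 5 then {w. cmod w > 1 \<and> cmod (w - eta) > 1 \<and> cmod (w - sqrt_m3 / 2) > 1 / 2}
     else {w. cmod w > 1 \<and> cmod (w - eta) > 1})"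

definition V_dual :: "nat \<Rightarrow> nat \<Rightarrow> complex set" where
  "V_dual k l = (\<lambda>w. zeta ^ (l - 1) * w) ` V1_dual k"

definition U_hat :: "(complex \<times> complex) set" where
  "U_hat = (\<Union>k\<in>{1..6}. \<Union>l\<in>{1..6}. V k l \<times> V_dual k l)"

(* The first coordinate has modulus at most 1 and the second exceeds 1 on U_hat, so z \<noteq> w. *)
definition kernel_hat :: "complex \<times> complex \<Rightarrow> ennreal" where
  "kernel_hat = (\<lambda>(z, w). ennreal (1 / cmod (z - w) ^ 4))"

definition C0 :: ennreal where
  "C0 = 1 / (\<integral>\<^sup>+ p \<in> U_hat. kernel_hat p \<partial>(lborel \<Otimes>\<^sub>M lborel))"

(* If the total mass were 0 or infinite, mu_hat would be a null measure and every integral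
   against it would be 0. *)
definition mu_hat :: "(complex \<times> complex) measure" where
  "mu_hat = density (restrict_space (lborel \<Otimes>\<^sub>M lborel) U_hat) (\<lambda>p. C0 * kernel_hat p)"

end

theory Submission
  imports Defs
begin

text \<open>Let \<open>b = [1 / z]\<close>. The map \<open>(z, w) \<mapsto> (1 / z - b, 1 / w - b)\<close> preserves \<open>|z - w| ^ -4 dz dw\<close>,
  maps \<open>U_hat\<close> into itself and is injective there, up to null sets; since \<open>U_hat\<close> has finite mass, it is
  an almost everywhere invertible measure preserving map. Along an orbit \<open>(z_k, w_k)\<close> the denominators
  satisfy \<open>q_n = (-1) ^ n (w_0 ... w_n - z_0 ... z_n) / (w_0 - z_0)\<close>, so \<open>ln |q_n|\<close> is the Birkhoff sum
  of \<open>ln |w|\<close> up to a bounded error, and its average depends on \<open>z\<close> only. Ergodicity is replaced by Hopf's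
  argument: the maximal ergodic theorem identifies the forward limit with the backward limit, and on the
  product of the hexagon with a small disc the backward orbit of \<open>w\<close> does not depend on \<open>z\<close>, by a Markov
  property. Hence the limit is constant. The mass is finite because near a vertex of the hexagon one of
  \<open>z\<close>, \<open>w\<close> is confined to a cusp between tangent circles.\<close>

section \<open>Ergodic averages of an invertible map\<close>

text \<open>The maximal inequality, applied to \<open>f\<close> for one map and to
  \<open>- f\<close> for its inverse, compares the forward limsup directly with the backward liminf,
  so convergence and the equality of the two limits come out of one estimate. The limits are
  extended reals until constancy is known; only then is finiteness read off. The obstacle to Hopf's
  argument is that \<open>U_hat\<close> is not a product: whether a backward branch is admissible at
  \<open>(z, w)\<close> depends on \<open>z\<close>. That dependence passes through finitely many
  sign conditions, and a large digit sends the whole hexagon into a single sign class. A disc of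
  \<open>w\<close> on which that digit is the forced backward digit therefore carries full slices
  along which the backward averages agree. A single slice is enough, because the growth rate of the
  denominators is a function of \<open>z\<close> alone.\<close>

definition measure_preserving_self :: "'a measure \<Rightarrow> ('a \<Rightarrow> 'a) \<Rightarrow> bool" where
  "measure_preserving_self M T \<longleftrightarrow> T \<in> measurable M M \<and> distr M M T = M"

definition birkhoff_sum :: "('a \<Rightarrow> 'a) \<Rightarrow> ('a \<Rightarrow> real) \<Rightarrow> nat \<Rightarrow> 'a \<Rightarrow> real" where
  "birkhoff_sum T f n x = (\<Sum>k<n. f ((T ^^ k) x))"

lemma birkhoff_sum_0 [simp]: "birkhoff_sum T f 0 x = 0"
  by (simp add: birkhoff_sum_def)

lemma birkhoff_sum_Suc: "birkhoff_sum T f (Suc n) x = f x + birkhoff_sum T f n (T x)"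
  unfolding birkhoff_sum_def by (subst sum.lessThan_Suc_shift) (simp add: funpow_swap1)

lemma mps_funpow_measurable:
  assumes "measure_preserving_self M T" shows "(T ^^ k) \<in> measurable M M"
proof (induction k)
  case (Suc k)
  then show ?case using assms by (auto simp: measure_preserving_self_def intro: measurable_comp)
qed (simp add: id_def)

lemma measurable_birkhoff_sum:
  assumes "measure_preserving_self M T" "f \<in> borel_measurable M"
  shows "birkhoff_sum T f n \<in> borel_measurable M"
  unfolding birkhoff_sum_def
  by (intro borel_measurable_sum measurable_compose[OF mps_funpow_measurable[OF assms(1)] assms(2)])

lemma mps_AE:
  assumes "measure_preserving_self M T" "AE x in M. P x"
  shows "AE x in M. P (T x)"
proof -
  have T: "T \<in> measurable M M" and d: "distr M M T = M"
    using assms by (auto simp: measure_preserving_self_def)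
  show ?thesis by (rule AE_distrD[OF T]) (simp only: d assms(2))
qed

lemma mps_AE_orbit:
  assumes "measure_preserving_self M T" "AE x in M. P x"
  shows "AE x in M. \<forall>k. P ((T ^^ k) x)"
proof -
  have "AE x in M. P ((T ^^ k) x)" for k
  proof (induction k)
    case (Suc k)
    from mps_AE[OF assms(1) Suc] show ?case by (simp add: funpow_swap1)
  qed (use assms in simp)
  then show ?thesis by (simp add: AE_all_countable)
qed

lemma mps_integral:
  assumes "measure_preserving_self M T" "integrable M (f :: 'a \<Rightarrow> real)"
  shows "integrable M (\<lambda>x. f (T x))" "(\<integral>x. f (T x) \<partial>M) = (\<integral>x. f x \<partial>M)"
proof -
  have T: "T \<in> measurable M M" "distr M M T = M" using assms by (auto simp: measure_preserving_self_def)
  have f: "f \<in> borel_measurable M" using assms by auto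
  show "integrable M (\<lambda>x. f (T x))"
    using integrable_distr_eq[OF T(1) f] T assms by simp
  show "(\<integral>x. f (T x) \<partial>M) = (\<integral>x. f x \<partial>M)"
    using integral_distr[OF T(1) f] T by simp
qed

text \<open>Garsia's argument: where the running maximum of the Birkhoff sums is positive, it increases by
  at most \<open>f\<close> against its own shift along \<open>T\<close>.\<close>
lemma maximal_ergodic:
  assumes T: "measure_preserving_self M T" and f: "integrable M f"
  shows "0 \<le> (\<integral>x. indicator {x. \<exists>n. birkhoff_sum T f n x > 0} x * f x \<partial>M)"
proof -
  define mx where "mx n x = Max ((\<lambda>k. birkhoff_sum T f k x) ` {..n})" for n x
  have meas: "birkhoff_sum T f k \<in> borel_measurable M" for k
    using measurable_birkhoff_sum[OF T] f by auto
  have mx0: "mx 0 x = 0" and mxS: "mx (Suc n) x = max (birkhoff_sum T f (Suc n) x) (mx n x)" for n x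
    by (simp_all add: mx_def atMost_Suc)
  have int_b: "integrable M (birkhoff_sum T f k)" for k
  proof (induction k)
    case (Suc k)
    have "integrable M (\<lambda>x. f x + birkhoff_sum T f k (T x))"
      using f mps_integral(1)[OF T Suc] by simp
    then show ?case by (simp add: birkhoff_sum_Suc[abs_def])
  qed (simp add: birkhoff_sum_def)
  have int_mx: "integrable M (mx n)" for n
  proof (induction n)
    case 0 show ?case by (simp add: mx0[abs_def])
  next
    case (Suc n)
    have "integrable M (\<lambda>x. max (birkhoff_sum T f (Suc n) x) (mx n x))"
      using Suc int_b by (intro integrable_max)
    then show ?case by (simp add: mxS[abs_def])
  qed
  have nonneg: "mx n x \<ge> 0" for n x
    by (induction n) (auto simp: mx0 mxS)
  have le: "k \<le> n \<Longrightarrow> birkhoff_sum T f k x \<le> mx n x" for k n x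
    unfolding mx_def by (rule Max_ge) auto
  have key: "mx n x - mx n (T x) \<le> indicator {x. mx n x > 0} x * f x" for n x
  proof (cases "mx n x > 0")
    case True
    have "mx n x \<in> (\<lambda>k. birkhoff_sum T f k x) ` {..n}"
      unfolding mx_def by (rule Max_in) auto
    then obtain k where k: "k \<le> n" "mx n x = birkhoff_sum T f k x" by auto
    with True obtain j where j: "k = Suc j" by (cases k) auto
    have "mx n x = f x + birkhoff_sum T f j (T x)" using k j by (simp add: birkhoff_sum_Suc)
    also have "\<dots> \<le> f x + mx n (T x)" using le[of j n "T x"] k j by simp
    finally show ?thesis using True by simp
  next
    case False
    then show ?thesis using nonneg[of n "T x"] by (auto simp: indicator_def)
  qed
  have int_ind: "integrable M (\<lambda>x. indicator {x. mx n x > 0} x * f x)" for n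
  proof -
    have "integrable M (\<lambda>x. indicator {x \<in> space M. mx n x > 0} x * f x)"
      using int_mx[of n] f integrable_mult_indicator[of "{x \<in> space M. mx n x > 0}" M f] by simp
    then show ?thesis
      by (rule Bochner_Integration.integrable_cong[THEN iffD1, rotated -1]) (auto simp: indicator_def)
  qed
  have "0 \<le> (\<integral>x. indicator {x. mx n x > 0} x * f x \<partial>M)" for n
  proof -
    have "0 = (\<integral>x. mx n x - mx n (T x) \<partial>M)"
      using int_mx mps_integral[OF T int_mx] by simp
    also have "\<dots> \<le> (\<integral>x. indicator {x. mx n x > 0} x * f x \<partial>M)"
      using int_mx mps_integral(1)[OF T int_mx] int_ind key by (intro integral_mono) auto
    finally show ?thesis .
  qed
  moreover have "(\<lambda>n. \<integral>x. indicator {x. mx n x > 0} x * f x \<partial>M)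
     \<longlonglongrightarrow> (\<integral>x. indicator {x. \<exists>n. birkhoff_sum T f n x > 0} x * f x \<partial>M)"
  proof (rule integral_dominated_convergence[where w = "\<lambda>x. \<bar>f x\<bar>"])
    have eq: "(\<exists>n. birkhoff_sum T f n x > 0) \<longleftrightarrow> (\<exists>n. mx n x > 0)" for x
    proof
      assume "\<exists>n. birkhoff_sum T f n x > 0"
      then show "\<exists>n. mx n x > 0" using le order_refl by (metis less_le_trans)
    next
      assume "\<exists>n. mx n x > 0"
      then obtain n where "mx n x > 0" ..
      moreover have "mx n x \<in> (\<lambda>k. birkhoff_sum T f k x) ` {..n}"
        unfolding mx_def by (rule Max_in) auto
      ultimately show "\<exists>n. birkhoff_sum T f n x > 0" by auto
    qed
    have "(\<lambda>x. indicator {x \<in> space M. \<exists>n. birkhoff_sum T f n x > 0} x * f x) \<in> borel_measurable M"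
      using meas f by measurable
    then show "(\<lambda>x. indicator {x. \<exists>n. birkhoff_sum T f n x > 0} x * f x) \<in> borel_measurable M"
      by (rule measurable_cong[THEN iffD1, rotated -1]) (auto simp: indicator_def)
    have mono: "n \<le> m \<Longrightarrow> mx n x \<le> mx m x" for n m x
      unfolding mx_def by (intro Max_mono) auto
    have "(\<lambda>n. indicator {x. mx n x > 0} x * f x) \<longlonglongrightarrow>
      indicator {x. \<exists>n. birkhoff_sum T f n x > 0} x * f x" for x
    proof (cases "\<exists>n. mx n x > 0")
      case True
      then obtain n0 where "mx n0 x > 0" ..
      then have "mx n x > 0" if "n \<ge> n0" for n using mono[OF that, of x] by simp
      then have "eventually (\<lambda>n. indicator {x. mx n x > 0} x * f x =
          indicator {x. \<exists>n. birkhoff_sum T f n x > 0} x * f x) sequentially"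
        unfolding eq by (intro eventually_sequentiallyI[of n0]) (auto simp: indicator_def)
      then show ?thesis by (rule tendsto_eventually)
    next
      case False
      then show ?thesis unfolding eq by (auto simp: indicator_def)
    qed
    then show "AE x in M. (\<lambda>n. indicator {x. mx n x > 0} x * f x) \<longlonglongrightarrow>
      indicator {x. \<exists>n. birkhoff_sum T f n x > 0} x * f x" by simp
  qed (use f int_ind in \<open>auto simp: indicator_def\<close>)
  ultimately show ?thesis by (intro LIMSEQ_le_const) auto
qed

text \<open>Apply the maximal inequality to \<open>g\<close>, which is \<open>f - \<alpha>\<close>
  on \<open>E\<close> and 0 elsewhere. Almost every orbit starting in \<open>E\<close> stays there,
  so the sums of \<open>g\<close> are those of \<open>f\<close> minus \<open>\<alpha> * n\<close>
  and become positive; off \<open>E\<close> the integrand vanishes anyway.\<close>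

lemma maximal_ergodic_on:
  assumes fin: "finite_measure M" and T: "measure_preserving_self M T" and f: "integrable M f"
    and E: "E \<in> sets M" and inv: "AE x in M. T x \<in> E \<longleftrightarrow> x \<in> E"
    and sup: "AE x in M. x \<in> E \<longrightarrow> (\<exists>n. birkhoff_sum T f n x > \<alpha> * real n)"
  shows "\<alpha> * measure M E \<le> (\<integral>x. indicator E x * f x \<partial>M)"
proof -
  interpret finite_measure M by fact
  define g where "g x = indicator E x * (f x - \<alpha>)" for x
  have int_g: "integrable M g"
    unfolding g_def using f E integrable_mult_indicator[of E M "\<lambda>x. f x - \<alpha>"] by simp
  have "0 \<le> (\<integral>x. indicator {x. \<exists>n. birkhoff_sum T g n x > 0} x * g x \<partial>M)"
    by (rule maximal_ergodic[OF T int_g])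
  also have "\<dots> = (\<integral>x. g x \<partial>M)"
  proof (rule integral_cong_AE)
    have meas: "birkhoff_sum T g k \<in> borel_measurable M" for k
      using measurable_birkhoff_sum[OF T] int_g by auto
    have "(\<lambda>x. indicator {x \<in> space M. \<exists>n. birkhoff_sum T g n x > 0} x * g x) \<in> borel_measurable M"
      using meas int_g by measurable
    then show "(\<lambda>x. indicator {x. \<exists>n. birkhoff_sum T g n x > 0} x * g x) \<in> borel_measurable M"
      by (rule measurable_cong[THEN iffD1, rotated -1]) (auto simp: indicator_def)
    show "AE x in M. indicator {x. \<exists>n. birkhoff_sum T g n x > 0} x * g x = g x"
      using mps_AE_orbit[OF T inv] sup
    proof eventually_elim
      case (elim x)
      show ?case
      proof (cases "x \<in> E")
        case True
        have orb: "(T ^^ k) x \<in> E" for k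
          using elim(1) True by (induction k) auto
        from elim(2) True obtain n where n: "birkhoff_sum T f n x > \<alpha> * real n" by blast
        have "birkhoff_sum T g n x = birkhoff_sum T f n x - \<alpha> * real n"
          using orb by (simp add: birkhoff_sum_def g_def sum_subtractf mult.commute)
        with n have "birkhoff_sum T g n x > 0" by simp
        then show ?thesis by (auto simp: indicator_def)
      qed (simp add: g_def)
    qed
  qed (use int_g in auto)
  also have "\<dots> = (\<integral>x. indicator E x * f x - \<alpha> * indicator E x \<partial>M)"
    by (simp add: g_def algebra_simps)
  also have "\<dots> = (\<integral>x. indicator E x * f x \<partial>M) - \<alpha> * measure M E"
    using E f integrable_mult_indicator[of E M f]
    by (subst Bochner_Integration.integral_diff) (auto simp: emeasure_eq_measure)
  finally show ?thesis by simp
qed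

section \<open>Forward against backward deviations\<close>

lemma birkhoff_sum_uminus: "birkhoff_sum T (\<lambda>x. - f x) n x = - birkhoff_sum T f n x"
  by (simp add: birkhoff_sum_def sum_negf)

text \<open>Passing from \<open>x\<close> to \<open>T x\<close> shifts the index by one and the
  deviation by the constant \<open>f x - \<alpha>\<close>; unboundedness notices neither. The
  invariance holds at every point, with no exceptional null set.\<close>

lemma birkhoff_unbounded_inv:
  "(\<forall>K::real. \<exists>n. birkhoff_sum T f n (T x) - \<alpha> * real n > K)
    \<longleftrightarrow> (\<forall>K::real. \<exists>n. birkhoff_sum T f n x - \<alpha> * real n > K)"  (is "?L \<longleftrightarrow> ?R")
proof
  assume L: ?L
  show ?R
  proof
    fix K
    obtain n where "birkhoff_sum T f n (T x) - \<alpha> * real n > K + \<alpha> - f x" using L by blast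
    then have "birkhoff_sum T f (Suc n) x - \<alpha> * real (Suc n) > K"
      by (simp add: birkhoff_sum_Suc algebra_simps)
    then show "\<exists>n. birkhoff_sum T f n x - \<alpha> * real n > K" ..
  qed
next
  assume R: ?R
  show ?L
  proof
    fix K
    \<comment> \<open>The \<open>max 0\<close> excludes \<open>n = 0\<close>, where the deviation is
      0, so that a first term can be split off.\<close>
    obtain n where n: "birkhoff_sum T f n x - \<alpha> * real n > max 0 (K + f x - \<alpha>)" using R by blast
    then obtain m where "n = Suc m" by (cases n) auto
    with n have "birkhoff_sum T f m (T x) - \<alpha> * real m > K"
      by (simp add: birkhoff_sum_Suc algebra_simps)
    then show "\<exists>n. birkhoff_sum T f n (T x) - \<alpha> * real n > K" ..
  qed
qed

text \<open>Countably many thresholds suffice, which makes the unboundedness sets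
  measurable.\<close>

lemma real_ex_nat_gt: "(\<forall>K::real. \<exists>n. g n > K) \<longleftrightarrow> (\<forall>k::nat. \<exists>n. g n > real k)"
  by (meson less_trans reals_Archimedean2)

text \<open>On the set \<open>E\<close> where both deviations are unbounded, the maximal inequality
  for \<open>T\<close> and \<open>f\<close> bounds the integral of \<open>f\<close> over
  \<open>E\<close> below by \<open>\<alpha> * measure M E\<close>, and that for \<open>S\<close> and
  \<open>- f\<close> bounds it above by \<open>\<beta> * measure M E\<close>. Each condition is
  exactly invariant under its own map; invariance under the other map uses that \<open>S\<close> and
  \<open>T\<close> are inverse almost everywhere.\<close>

lemma forward_backward_null:
  assumes fin: "finite_measure M" and T: "measure_preserving_self M T"
    and S: "measure_preserving_self M S" and ST: "AE x in M. S (T x) = x" and TS: "AE x in M. T (S x) = x"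
    and f: "integrable M f" and "\<beta> < \<alpha>"
  shows "AE x in M. \<not> ((\<forall>K::real. \<exists>n. birkhoff_sum T f n x - \<alpha> * real n > K) \<and>
                       (\<forall>K::real. \<exists>n. \<beta> * real n - birkhoff_sum S f n x > K))"
proof -
  interpret finite_measure M by fact
  define A where "A x \<longleftrightarrow> (\<forall>K::real. \<exists>n. birkhoff_sum T f n x - \<alpha> * real n > K)" for x
  define B where "B x \<longleftrightarrow> (\<forall>K::real. \<exists>n. \<beta> * real n - birkhoff_sum S f n x > K)" for x
  have Beq: "B x \<longleftrightarrow> (\<forall>K::real. \<exists>n. birkhoff_sum S (\<lambda>x. - f x) n x - (- \<beta>) * real n > K)" for x
    by (simp add: B_def birkhoff_sum_uminus algebra_simps)
  have AT: "A (T x) = A x" for x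
    unfolding A_def by (rule birkhoff_unbounded_inv)
  have BS: "B (S x) = B x" for x
    unfolding Beq by (rule birkhoff_unbounded_inv)
  define E where "E = {x \<in> space M. A x \<and> B x}"
  have [measurable]: "birkhoff_sum T f k \<in> borel_measurable M" "birkhoff_sum S f k \<in> borel_measurable M" for k
    using measurable_birkhoff_sum[OF T] measurable_birkhoff_sum[OF S] f by auto
  have "E = {x \<in> space M. (\<forall>k::nat. \<exists>n. birkhoff_sum T f n x - \<alpha> * real n > real k) \<and>
     (\<forall>k::nat. \<exists>n. \<beta> * real n - birkhoff_sum S f n x > real k)}"
    unfolding E_def A_def B_def real_ex_nat_gt ..
  also have "\<dots> \<in> sets M" by measurable
  finally have E: "E \<in> sets M" .
  have Tsp: "x \<in> space M \<Longrightarrow> T x \<in> space M" and Ssp: "x \<in> space M \<Longrightarrow> S x \<in> space M" for x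
    using T S by (auto simp: measure_preserving_self_def measurable_space)
  have invT: "AE x in M. T x \<in> E \<longleftrightarrow> x \<in> E"
    using ST AE_space
  proof eventually_elim
    case (elim x)
    then show ?case using Tsp AT BS[of "T x"] by (simp add: E_def)
  qed
  have invS: "AE x in M. S x \<in> E \<longleftrightarrow> x \<in> E"
    using TS AE_space
  proof eventually_elim
    case (elim x)
    then show ?case using Ssp BS AT[of "S x"] by (simp add: E_def)
  qed
  have "\<alpha> * measure M E \<le> (\<integral>x. indicator E x * f x \<partial>M)"
  proof (rule maximal_ergodic_on[OF fin T f E invT])
    have "\<exists>n. birkhoff_sum T f n x > \<alpha> * real n" if "A x" for x
      using that[unfolded A_def, rule_format, of 0] by auto
    then show "AE x in M. x \<in> E \<longrightarrow> (\<exists>n. birkhoff_sum T f n x > \<alpha> * real n)"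
      by (auto simp: E_def)
  qed
  moreover have "(- \<beta>) * measure M E \<le> (\<integral>x. indicator E x * (- f x) \<partial>M)"
  proof (rule maximal_ergodic_on[OF fin S _ E invS])
    have "\<exists>n. birkhoff_sum S (\<lambda>x. - f x) n x > (- \<beta>) * real n" if "B x" for x
    proof -
      obtain n where "birkhoff_sum S (\<lambda>x. - f x) n x - (- \<beta>) * real n > 0"
        using \<open>B x\<close> unfolding Beq by blast
      then show ?thesis by (intro exI[of _ n]) simp
    qed
    then show "AE x in M. x \<in> E \<longrightarrow> (\<exists>n. birkhoff_sum S (\<lambda>x. - f x) n x > (- \<beta>) * real n)"
      by (auto simp: E_def)
  qed (use f in simp)
  ultimately have "(\<alpha> - \<beta>) * measure M E \<le> 0"
    by (simp add: algebra_simps)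
  with \<open>\<beta> < \<alpha>\<close> have "measure M E = 0"
    by (smt (verit) measure_nonneg mult_pos_pos)
  then have "E \<in> null_sets M" using E by (simp add: emeasure_eq_measure null_setsI)
  then have "AE x in M. x \<notin> E" by (rule AE_not_in)
  with AE_space show ?thesis
    by eventually_elim (auto simp: E_def A_def B_def)
qed

section \<open>From unbounded deviations to limits\<close>

lemma limsup_gt_unbounded:
  assumes "ereal \<alpha> < limsup (\<lambda>n. ereal (s n / real n))" "\<beta> < \<alpha>"
  shows "\<exists>n. s n - \<beta> * real n > K"
proof (rule ccontr)
  assume "\<not> ?thesis"
  then have le: "s n - \<beta> * real n \<le> K" for n by (auto simp: not_less)
  \<comment> \<open>Past this \<open>N\<close> the margin \<open>(\<alpha> - \<beta>) * n\<close>
    exceeds \<open>K\<close>, so a deviation from \<open>\<beta> * n\<close> bounded by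
    \<open>K\<close> would keep the averages below \<open>\<alpha>\<close>.\<close>
  obtain N :: nat where N: "real N > max 0 (K / (\<alpha> - \<beta>))" using reals_Archimedean2 by blast
  have "ereal (s n / real n) \<le> ereal \<alpha>" if "n \<ge> N" for n
  proof -
    have n: "real n > 0" "K / (\<alpha> - \<beta>) < real n" using that N by auto
    then have "K < (\<alpha> - \<beta>) * real n" using assms(2) by (simp add: field_simps)
    with le[of n] have "s n \<le> \<alpha> * real n" by (simp add: algebra_simps)
    then show ?thesis using n by (simp add: field_simps)
  qed
  then have "limsup (\<lambda>n. ereal (s n / real n)) \<le> ereal \<alpha>"
    by (intro Limsup_bounded eventually_sequentiallyI[of N]) auto
  with assms(1) show False by simp
qed

lemma liminf_lt_unbounded:
  assumes "liminf (\<lambda>n. ereal (s n / real n)) < ereal \<alpha>" "\<alpha> < \<beta>"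
  shows "\<exists>n. \<beta> * real n - s n > K"
proof -
  have "ereal (- \<alpha>) < limsup (\<lambda>n. ereal ((- s n) / real n))"
    using assms(1) ereal_Limsup_uminus[of sequentially "\<lambda>n. ereal (s n / real n)"]
      ereal_minus_less_minus[of "ereal \<alpha>"] by simp
  from limsup_gt_unbounded[OF this, of "- \<beta>"] assms(2) show ?thesis by auto
qed

lemma limsup_forward_le_liminf_backward:
  assumes fin: "finite_measure M" and T: "measure_preserving_self M T"
    and S: "measure_preserving_self M S"
    and ST: "AE x in M. S (T x) = x" and TS: "AE x in M. T (S x) = x"
    and f: "integrable M f"
  shows "AE x in M. limsup (\<lambda>n. ereal (birkhoff_sum T f n x / real n))
       \<le> liminf (\<lambda>n. ereal (birkhoff_sum S f n x / real n))"
proof -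
  have "AE x in M. \<forall>\<alpha>\<in>\<rat>. \<forall>\<beta>\<in>\<rat>. \<beta> < \<alpha> \<longrightarrow>
      \<not> ((\<forall>K::real. \<exists>n. birkhoff_sum T f n x - \<alpha> * real n > K) \<and>
         (\<forall>K::real. \<exists>n. \<beta> * real n - birkhoff_sum S f n x > K))"
    using forward_backward_null[OF fin T S ST TS f]
    by (intro AE_ball_countable'[OF _ countable_rat] AE_impI)
  then show ?thesis
  proof eventually_elim
    case (elim x)
    show ?case
    proof (rule ccontr)
      assume "\<not> ?case"
      then have lt: "liminf (\<lambda>n. ereal (birkhoff_sum S f n x / real n)) <
          limsup (\<lambda>n. ereal (birkhoff_sum T f n x / real n))" (is "?l < ?u") by simp
      \<comment> \<open>Four numbers inside the gap: the conversion to unbounded deviations loses a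
        strict inequality on either side, and the null sets are controlled for rational pairs
        only.\<close>
      obtain a where a: "?l < ereal a" "ereal a < ?u"
        using ereal_dense2[OF lt] by blast
      obtain d where d: "ereal a < ereal d" "ereal d < ?u"
        using ereal_dense2[OF a(2)] by blast
      obtain \<beta> where b: "\<beta> \<in> \<rat>" "a < \<beta>" "\<beta> < d" using d(1) Rats_dense_in_real[of a d] by auto
      obtain \<alpha> where al: "\<alpha> \<in> \<rat>" "\<beta> < \<alpha>" "\<alpha> < d" using b(3) Rats_dense_in_real[of \<beta> d] by auto
      have "\<exists>n. birkhoff_sum T f n x - \<alpha> * real n > K" for K
        by (rule limsup_gt_unbounded[OF d(2) al(3)])
      moreover have "\<exists>n. \<beta> * real n - birkhoff_sum S f n x > K" for K
        by (rule liminf_lt_unbounded[OF a(1) b(2)])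
      ultimately show False using elim al b by blast
    qed
  qed
qed

text \<open>Exchanging \<open>T\<close> and \<open>S\<close> closes the chain forward limsup,
  backward liminf, backward limsup, forward liminf. \<open>L\<close> is an extended real;
  \<open>birkhoff_constant_limit\<close> later shows a constant limit to be finite.\<close>

theorem birkhoff_two_sided:
  assumes fin: "finite_measure M" and T: "measure_preserving_self M T"
    and S: "measure_preserving_self M S"
    and ST: "AE x in M. S (T x) = x" and TS: "AE x in M. T (S x) = x"
    and f: "integrable M f"
  shows "AE x in M. \<exists>L::ereal. (\<lambda>n. ereal (birkhoff_sum T f n x / real n)) \<longlonglongrightarrow> L \<and>
     (\<lambda>n. ereal (birkhoff_sum S f n x / real n)) \<longlonglongrightarrow> L"
  using limsup_forward_le_liminf_backward[OF fin T S ST TS f]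
    limsup_forward_le_liminf_backward[OF fin S T TS ST f]
proof eventually_elim
  case (elim x)
  let ?t = "\<lambda>n. ereal (birkhoff_sum T f n x / real n)"
  let ?s = "\<lambda>n. ereal (birkhoff_sum S f n x / real n)"
  have "liminf ?t \<le> limsup ?t" "liminf ?s \<le> limsup ?s" by (simp_all add: Liminf_le_Limsup)
  with elim have "liminf ?t = limsup ?t" "liminf ?s = limsup ?s" "limsup ?s = limsup ?t"
    by order+
  then show ?case
    by (intro exI[of _ "limsup ?t"] conjI Liminf_eq_Limsup) simp_all
qed

lemma ereal_le_of_all_less:
  assumes "\<And>\<alpha>. ereal \<alpha> < c \<Longrightarrow> ereal \<alpha> \<le> d"
  shows "c \<le> d"
proof (rule ccontr)
  assume "\<not> c \<le> d"
  then have "d < c" by simp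
  then obtain a where "d < ereal a" "ereal a < c" using ereal_dense2 by blast
  with assms[of a] show False by simp
qed

text \<open>With \<open>E\<close> the whole space, every \<open>\<alpha>\<close> below the limit is
  at most the mean of \<open>f\<close>; applying this to \<open>- f\<close> as well pins the limit
  down and excludes infinite values.\<close>

theorem birkhoff_constant_limit:
  assumes fin: "finite_measure M" and T: "measure_preserving_self M T"
    and f: "integrable M f" and pos: "measure M (space M) > 0"
    and lim: "AE x in M. (\<lambda>n. ereal (birkhoff_sum T f n x / real n)) \<longlonglongrightarrow> c"
  shows "c = ereal ((\<integral>x. f x \<partial>M) / measure M (space M))"
proof -
  have Tsp: "x \<in> space M \<Longrightarrow> T x \<in> space M" for x
    using T by (auto simp: measure_preserving_self_def measurable_space)
  have inv: "AE x in M. T x \<in> space M \<longleftrightarrow> x \<in> space M"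
    using AE_space by eventually_elim (use Tsp in auto)
  have *: "ereal \<alpha> \<le> ereal ((\<integral>x. g x \<partial>M) / measure M (space M))"
    if g: "integrable M g" and lim: "AE x in M. (\<lambda>n. ereal (birkhoff_sum T g n x / real n)) \<longlonglongrightarrow> d"
      and \<alpha>: "ereal \<alpha> < d" for \<alpha> g d
  proof -
    have "\<alpha> * measure M (space M) \<le> (\<integral>x. indicator (space M) x * g x \<partial>M)"
    proof (rule maximal_ergodic_on[OF fin T g _ inv])
      show "AE x in M. x \<in> space M \<longrightarrow> (\<exists>n. birkhoff_sum T g n x > \<alpha> * real n)"
        using lim
      proof eventually_elim
        case (elim x)
        from order_tendstoD(1)[OF elim \<alpha>]
        have "eventually (\<lambda>n. ereal \<alpha> < ereal (birkhoff_sum T g n x / real n) \<and> n > 0) sequentially"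
          using eventually_gt_at_top[of 0] by eventually_elim auto
        then obtain n where "\<alpha> < birkhoff_sum T g n x / real n" "n > 0"
          by (auto simp: eventually_sequentially)
        then have "birkhoff_sum T g n x > \<alpha> * real n" by (simp add: field_simps)
        then show ?case by blast
      qed
    qed simp
    also have "\<dots> = (\<integral>x. g x \<partial>M)" by (rule Bochner_Integration.integral_cong) auto
    finally show ?thesis using pos by (simp add: field_simps)
  qed
  have up: "c \<le> ereal ((\<integral>x. f x \<partial>M) / measure M (space M))"
    by (rule ereal_le_of_all_less[OF *[OF f lim]])
  have lim': "AE x in M. (\<lambda>n. ereal (birkhoff_sum T (\<lambda>x. - f x) n x / real n)) \<longlonglongrightarrow> - c"
    using lim
  proof eventually_elim
    case (elim x)
    from tendsto_uminus_ereal[OF elim] show ?case by (simp add: birkhoff_sum_uminus)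
  qed
  have "- c \<le> ereal ((\<integral>x. - f x \<partial>M) / measure M (space M))"
    by (rule ereal_le_of_all_less, rule *[OF _ lim']) (use f in auto)
  then have "- c \<le> - ereal ((\<integral>x. f x \<partial>M) / measure M (space M))" by simp
  with up show ?thesis by (simp only: ereal_minus_le_minus order_antisym)
qed

section \<open>Inversion and Lebesgue measure on the plane\<close>

text \<open>The change of variables theorem used below speaks of \<open>real^'n\<close> and
  determinants of matrices, so the plane is identified with \<open>real^2\<close>.\<close>

definition vec2_to_complex :: "real^2 \<Rightarrow> complex" where
  "vec2_to_complex v = Complex (v $ 1) (v $ 2)"

definition complex_to_vec2 :: "complex \<Rightarrow> real^2" where
  "complex_to_vec2 z = (\<chi> i. if i = 1 then Re z else Im z)"

lemma vec2_complex_inverse [simp]: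
  "vec2_to_complex (complex_to_vec2 z) = z" "complex_to_vec2 (vec2_to_complex v) = v"
  by (auto simp: vec2_to_complex_def complex_to_vec2_def vec_eq_iff forall_2)

lemma bounded_linear_vec2_to_complex: "bounded_linear vec2_to_complex"
proof -
  have "linear vec2_to_complex"
    by (rule linearI) (auto simp: vec2_to_complex_def complex_eq_iff)
  then show ?thesis by (rule linear_conv_bounded_linear[THEN iffD1])
qed

lemma bounded_linear_complex_to_vec2: "bounded_linear complex_to_vec2"
proof -
  have "linear complex_to_vec2"
    by (rule linearI) (auto simp: complex_to_vec2_def vec_eq_iff)
  then show ?thesis by (rule linear_conv_bounded_linear[THEN iffD1])
qed

lemma borel_measurable_vec2_complex [measurable]:
  "vec2_to_complex \<in> borel_measurable borel" "complex_to_vec2 \<in> borel_measurable borel"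
  using bounded_linear_vec2_to_complex bounded_linear_complex_to_vec2
  by (auto intro!: borel_measurable_continuous_onI linear_continuous_on)

lemma Basis_vec2: "(Basis :: (real^2) set) = {axis 1 1, axis 2 1}"
  by (auto simp: Basis_vec_def exhaust_2 UNIV_2)

lemma lborel_complex_eq_distr: "distr lborel borel vec2_to_complex = lborel"
proof (rule lborel_eqI[symmetric])
  fix l u :: complex
  assume le: "\<And>b. b \<in> Basis \<Longrightarrow> l \<bullet> b \<le> u \<bullet> b"
  have pre: "vec2_to_complex -` box l u = box (complex_to_vec2 l) (complex_to_vec2 u)"
    by (auto simp: box_def Basis_complex_def Basis_vec2 inner_complex_def vec2_to_complex_def
        complex_to_vec2_def inner_axis)
  have ne: "axis 1 1 \<noteq> (axis 2 1 :: real^2)" by (simp add: axis_eq_axis)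
  have "emeasure (distr lborel borel vec2_to_complex) (box l u)
      = emeasure lborel (box (complex_to_vec2 l) (complex_to_vec2 u))"
    by (subst emeasure_distr) (auto simp: pre)
  also have "\<dots> = ennreal (\<Prod>b\<in>Basis. (u - l) \<bullet> b)"
    using le[of 1] le[of \<i>] ne
    by (subst emeasure_lborel_box)
      (auto simp: Basis_complex_def Basis_vec2 inner_axis complex_to_vec2_def inner_complex_def)
  finally show "emeasure (distr lborel borel vec2_to_complex) (box l u) = (\<Prod>b\<in>Basis. (u - l) \<bullet> b)" .
qed simp

lemma det_matrix_complex_mult:
  "\<bar>det (matrix (\<lambda>h. complex_to_vec2 (c * vec2_to_complex h)))\<bar> = (cmod c)\<^sup>2"
  by (simp add: det_2 matrix_def complex_to_vec2_def vec2_to_complex_def axis_def cmod_def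
      power2_eq_square)

text \<open>The derivative of inversion is multiplication by \<open>- 1 / z^2\<close>, with Jacobian
  \<open>1 / cmod z ^ 4\<close>. Inside an annulus both the set and the Jacobian are bounded, so the
  integral is finite.\<close>

lemma emeasure_inverse_image_annulus:
  fixes A :: "complex set"
  assumes A: "A \<in> sets borel" and sub: "A \<subseteq> {z. 1 / real (Suc k) \<le> cmod z \<and> cmod z \<le> real (Suc k)}"
  shows "emeasure lborel (inverse ` A) = (\<integral>\<^sup>+z. indicator A z * ennreal (1 / cmod z ^ 4) \<partial>lborel)"
proof -
  define S where "S = vec2_to_complex -` A"
  define f where "f v = complex_to_vec2 (inverse (vec2_to_complex v))" for v
  define f' where "f' v h = complex_to_vec2 (- (inverse ((vec2_to_complex v)\<^sup>2)) * vec2_to_complex h)" for v h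
  have S: "S \<in> sets borel"
    unfolding S_def using measurable_sets[OF borel_measurable_vec2_complex(1) A] by simp
  have nz: "vec2_to_complex v \<noteq> 0" if "v \<in> S" for v
    using that sub by (auto simp: S_def)
  have der: "(f has_derivative f' v) (at v within S)" if "v \<in> S" for v
  proof -
    have 1: "(vec2_to_complex has_derivative vec2_to_complex) (at v within S)"
      by (rule bounded_linear.has_derivative[OF bounded_linear_vec2_to_complex has_derivative_ident])
    have 2: "((\<lambda>v. inverse (vec2_to_complex v)) has_derivative
        (\<lambda>h. - (inverse (vec2_to_complex v) * vec2_to_complex h * inverse (vec2_to_complex v)))) (at v within S)"
      by (rule Deriv.has_derivative_inverse[OF nz[OF that] 1])
    have "(f has_derivative (\<lambda>h. complex_to_vec2 (- (inverse (vec2_to_complex v) * vec2_to_complex h * inverse (vec2_to_complex v))))) (at v within S)"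
      unfolding f_def[abs_def] by (rule bounded_linear.has_derivative[OF bounded_linear_complex_to_vec2 2])
    then show ?thesis
      by (simp add: f'_def[abs_def] power2_eq_square mult_ac)
  qed
  have inj: "inj_on f S"
    unfolding f_def inj_on_def by (metis inverse_inverse_eq vec2_complex_inverse)
  have det: "\<bar>det (matrix (f' v))\<bar> = 1 / cmod (vec2_to_complex v) ^ 4" for v
    unfolding f'_def[abs_def]
    by (subst det_matrix_complex_mult) (simp add: norm_inverse norm_power divide_inverse power_inverse flip: power_mult)
  have vec_norm: "cmod (vec2_to_complex v) = norm v" for v
    by (simp add: vec2_to_complex_def cmod_def norm_vec_def L2_set_def sum_2)
  have bS: "bounded S"
    by (rule boundedI[of _ "real (Suc k)"]) (use sub in \<open>auto simp: S_def vec_norm[symmetric]\<close>)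
  have fin: "emeasure lborel S < \<infinity>"
    using emeasure_bounded_finite[OF bS] by simp
  define d where "d v = 1 / cmod (vec2_to_complex v) ^ 4" for v
  have d_meas: "d \<in> borel_measurable borel" unfolding d_def by measurable
  have d_bd: "d v \<le> real (Suc k) ^ 4" if "v \<in> S" for v
  proof -
    have *: "1 / real (Suc k) \<le> cmod (vec2_to_complex v)" using that sub by (auto simp: S_def)
    then have "(1 / real (Suc k)) ^ 4 \<le> cmod (vec2_to_complex v) ^ 4" by (intro power_mono) auto
    moreover have "cmod (vec2_to_complex v) ^ 4 > 0" using nz[OF that] by simp
    ultimately show ?thesis by (simp add: d_def field_simps)
  qed
  have d_int: "set_integrable lborel S d"
    unfolding set_integrable_def
  proof (rule Bochner_Integration.integrable_bound[where f="\<lambda>v. indicator S v * real (Suc k) ^ 4"])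
    show "integrable lborel (\<lambda>v. indicator S v * real (Suc k) ^ 4)"
      using S fin by (intro integrable_mult_left integrable_real_indicator) auto
    show "(\<lambda>v. indicator S v *\<^sub>R d v) \<in> borel_measurable lborel"
      using S d_meas by (intro borel_measurable_scaleR borel_measurable_indicator) auto
    show "AE v in lborel. norm (indicator S v *\<^sub>R d v) \<le> norm (indicator S v * real (Suc k) ^ 4)"
      using d_bd by (auto simp: indicator_def d_def)
  qed
  have d_int': "d integrable_on S" by (rule set_borel_integral_eq_integral(1)[OF d_int])
  have hi: "(d has_integral integral S d) S" using d_int' by (rule integrable_integral)
  have "f ` S \<in> lmeasurable \<and> measure lebesgue (f ` S) = integral S d"
    using has_measure_differentiable_image[OF _ der inj, of "integral S d"] S hi
    unfolding det d_def[symmetric] by simp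
  then have "emeasure lebesgue (f ` S) = ennreal (integral S d)"
    using emeasure_eq_measure2[of "f ` S" lebesgue] by simp
  moreover have "f ` S = vec2_to_complex -` (inverse ` A)"
  proof
    show "f ` S \<subseteq> vec2_to_complex -` (inverse ` A)" by (auto simp: f_def S_def)
    show "vec2_to_complex -` (inverse ` A) \<subseteq> f ` S"
    proof
      fix v assume "v \<in> vec2_to_complex -` (inverse ` A)"
      then obtain a where a: "a \<in> A" "vec2_to_complex v = inverse a" by auto
      then have "v = f (complex_to_vec2 a)"
        unfolding f_def by (metis vec2_complex_inverse)
      moreover have "complex_to_vec2 a \<in> S" using a by (simp add: S_def)
      ultimately show "v \<in> f ` S" by blast
    qed
  qed
  moreover have inv_A: "inverse ` A \<in> sets borel"
  proof -
    have "inverse ` A = inverse -` A"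
      by (auto simp: image_iff) (metis inverse_inverse_eq)
    moreover have "(inverse :: complex \<Rightarrow> complex) \<in> borel_measurable borel" by measurable
    ultimately show ?thesis using A measurable_sets[of inverse borel borel A] by simp
  qed
  ultimately have "emeasure (distr lborel borel vec2_to_complex) (inverse ` A) = ennreal (integral S d)"
    using measurable_sets[OF borel_measurable_vec2_complex(1) inv_A]
    by (simp add: emeasure_distr)
  moreover have "(\<integral>\<^sup>+v. ennreal (d v) * indicator S v \<partial>lborel) = ennreal (integral S d)"
    by (rule nn_integral_has_integral_lebesgue'[OF _ hi]) (simp add: d_def)
  moreover have "(\<integral>\<^sup>+z. indicator A z * ennreal (1 / cmod z ^ 4) \<partial>distr lborel borel vec2_to_complex)
      = (\<integral>\<^sup>+v. indicator A (vec2_to_complex v) * ennreal (1 / cmod (vec2_to_complex v) ^ 4) \<partial>lborel)"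
    using A by (intro nn_integral_distr) auto
  moreover have "\<dots> = (\<integral>\<^sup>+v. ennreal (d v) * indicator S v \<partial>lborel)"
    by (auto intro!: nn_integral_cong simp: d_def S_def indicator_def)
  ultimately show ?thesis by (simp add: lborel_complex_eq_distr)
qed

theorem distr_inverse_density:
  "distr (density lborel (\<lambda>z. ennreal (1 / cmod z ^ 4))) borel inverse = (lborel :: complex measure)"
proof (rule measure_eqI)
  let ?N = "distr (density lborel (\<lambda>z. ennreal (1 / cmod z ^ 4))) borel inverse"
  fix A :: "complex set" assume "A \<in> sets ?N"
  then have A: "A \<in> sets borel" by simp
  define R where "R k = {z. 1 / real (Suc k) \<le> cmod z \<and> cmod z \<le> real (Suc k)}" for k
  have R: "R k \<in> sets borel" for k unfolding R_def by measurable
  have inv_meas: "(inverse :: complex \<Rightarrow> complex) \<in> borel_measurable borel" by measurable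
  \<comment> \<open>Inversion maps each annulus onto itself, so a part of \<open>A\<close> and its
    preimage lie in the same \<open>R k\<close>; the annuli exhaust the plane without 0.\<close>
  have RR: "inverse -` R k = R k" for k
  proof -
    have "inverse z \<in> R k \<longleftrightarrow> z \<in> R k" for z
    proof (cases "z = 0")
      case False
      then show ?thesis unfolding R_def mem_Collect_eq norm_inverse
        by (auto simp: divide_simps mult.commute)
    qed simp
    then show ?thesis by auto
  qed
  have pre: "inverse -` B \<in> sets borel" if "B \<in> sets borel" for B :: "complex set"
    using measurable_sets[OF inv_meas that] by simp
  have eN: "emeasure ?N B = (\<integral>\<^sup>+z. indicator (inverse -` B) z * ennreal (1 / cmod z ^ 4) \<partial>lborel)"
    if "B \<in> sets borel" for B
    using that pre[OF that] by (simp add: emeasure_distr emeasure_density mult.commute)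
  have "emeasure ?N (A \<inter> R k) = emeasure lborel (A \<inter> R k)" for k
  proof -
    have "inverse -` (A \<inter> R k) \<subseteq> R k" using RR[of k] by auto
    then have "emeasure lborel (inverse ` (inverse -` (A \<inter> R k))) = emeasure ?N (A \<inter> R k)"
      using emeasure_inverse_image_annulus[of "inverse -` (A \<inter> R k)" k] pre[of "A \<inter> R k"] A R[of k] eN[of "A \<inter> R k"]
      by (auto simp: R_def)
    moreover have "surj (inverse :: complex \<Rightarrow> complex)" by (metis inverse_inverse_eq surjI)
    then have "inverse ` (inverse -` (A \<inter> R k)) = A \<inter> R k" by (rule surj_image_vimage_eq)
    ultimately show ?thesis by simp
  qed
  moreover have inc: "incseq (\<lambda>k. A \<inter> R k)"
  proof -
    have "1 / real (Suc n) \<le> 1 / real (Suc m)" if "m \<le> n" for m n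
      using that by (intro divide_left_mono) auto
    then have "R m \<subseteq> R n" if "m \<le> n" for m n
      using that unfolding R_def by (smt (verit, best) Collect_mono of_nat_mono Suc_le_mono)
    then show ?thesis unfolding incseq_def by blast
  qed
  have UN: "(\<Union>k. A \<inter> R k) = A - {0}"
  proof -
    have "\<exists>k. z \<in> R k" if "z \<noteq> 0" for z
    proof -
      obtain k :: nat where k: "real k > max (cmod z) (1 / cmod z)" using reals_Archimedean2 by blast
      have "1 / real (Suc k) \<le> cmod z"
        using k that by (simp add: field_simps max_less_iff_conj) (smt (verit) zero_less_norm_iff mult_pos_pos)
      moreover have "cmod z \<le> real (Suc k)" using k by simp
      ultimately show ?thesis by (auto simp: R_def)
    qed
    moreover have "0 \<notin> R k" for k by (simp add: R_def)
    ultimately show ?thesis by auto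
  qed
  ultimately have eq: "emeasure ?N (A - {0}) = emeasure lborel (A - {0})"
    using inc UN SUP_emeasure_incseq[of "\<lambda>k. A \<inter> R k" ?N] SUP_emeasure_incseq[of "\<lambda>k. A \<inter> R k" lborel] A R
    by (simp add: image_subset_iff)
  \<comment> \<open>Division by zero yields 0: the preimage of \<open>{0}\<close> is
    \<open>{0}\<close>, and the density is 0 there.\<close>
  have "{0} \<in> null_sets ?N"
  proof (rule null_setsI)
    have "emeasure ?N {0} = integral\<^sup>N lborel (\<lambda>z::complex. 0)"
      unfolding eN[OF borel_closed[OF closed_singleton]]
      by (intro nn_integral_cong) (auto simp: indicator_def)
    then show "emeasure ?N {0} = 0" by simp
  qed simp
  then have "emeasure ?N (A - {0}) = emeasure ?N A" using A by (intro emeasure_Diff_null_set) auto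
  moreover have "emeasure lborel (A - {0}) = emeasure lborel A" using A by (intro emeasure_Diff_null_set) auto
  ultimately show "emeasure ?N A = emeasure lborel A" using eq by simp
qed simp

corollary nn_integral_inverse_complex:
  fixes f :: "complex \<Rightarrow> ennreal"
  assumes [measurable]: "f \<in> borel_measurable borel"
  shows "(\<integral>\<^sup>+z. f (1 / z) * ennreal (1 / cmod z ^ 4) \<partial>lborel) = (\<integral>\<^sup>+z. f z \<partial>lborel)"
proof -
  have "(\<integral>\<^sup>+z. f z \<partial>lborel) = (\<integral>\<^sup>+z. f z \<partial>distr (density lborel (\<lambda>z. ennreal (1 / cmod z ^ 4))) borel inverse)"
    by (simp only: distr_inverse_density)
  also have "\<dots> = (\<integral>\<^sup>+z. f (1 / z) * ennreal (1 / cmod z ^ 4) \<partial>lborel)"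
    by (subst nn_integral_distr, simp, simp, subst nn_integral_density)
      (auto simp: divide_inverse mult.commute)
  finally show ?thesis ..
qed

section \<open>The hexagonal lattice\<close>

text \<open>\<open>J_vec a c\<close> is \<open>eta * (a + c * zeta)\<close> in Cartesian coordinates.\<close>

definition J_vec :: "int \<Rightarrow> int \<Rightarrow> complex" where
  "J_vec a c = Complex (3 * of_int a / 2) (sqrt 3 * of_int (a + 2 * c) / 2)"

text \<open>The six shortest nonzero points of \<open>ideal_J\<close>, counterclockwise from
  \<open>eta\<close> in steps of 60 degrees. Their perpendicular bisectors carry the edges of the
  hexagon.\<close>

definition min_vecs :: "complex set" where
  "min_vecs = {J_vec 1 0, J_vec 0 1, J_vec (- 1) 1, J_vec (- 1) 0, J_vec 0 (- 1), J_vec 1 (- 1)}"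

text \<open>The scaling of \<open>edge_fn\<close> puts the edge of the hexagon between \<open>0\<close> and \<open>e\<close> on the line
  \<open>edge_fn z e = 1\<close>. The discs of radius \<open>rad\<close> around \<open>e / 3\<close> and \<open>2 e / 3\<close> become
  \<open>sqn z < edge_fn z e\<close> and \<open>sqn z + 1 < 2 * edge_fn z e\<close>, which turns the plane geometry into
  inequalities that are linear in \<open>sqn\<close> and \<open>edge_fn\<close>.\<close>

definition edge_fn :: "complex \<Rightarrow> complex \<Rightarrow> real" where
  "edge_fn z e = 2 / 3 * (Re z * Re e + Im z * Im e)"

definition sqn :: "complex \<Rightarrow> real" where
  "sqn z = (Re z)\<^sup>2 + (Im z)\<^sup>2"

definition hexagon :: "complex set" where
  "hexagon = {z. \<forall>e\<in>min_vecs. edge_fn z e < 1}"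

definition cl_hexagon :: "complex set" where
  "cl_hexagon = {z. \<forall>e\<in>min_vecs. edge_fn z e \<le> 1}"

lemma sqn_eq: "sqn z = (cmod z)\<^sup>2"
  by (simp add: sqn_def cmod_power2)

lemma sqn_nonneg [simp]: "0 \<le> sqn z"
  by (simp add: sqn_def)

lemma sqn_pos: "z \<noteq> 0 \<Longrightarrow> 0 < sqn z"
  by (simp add: sqn_eq)

lemma edge_fn_add: "edge_fn (z + w) e = edge_fn z e + edge_fn w e"
  by (simp add: edge_fn_def algebra_simps)

lemma edge_fn_diff: "edge_fn (z - w) e = edge_fn z e - edge_fn w e"
  by (simp add: edge_fn_def algebra_simps)

lemma edge_fn_uminus [simp]: "edge_fn (- z) e = - edge_fn z e"
  by (simp add: edge_fn_def algebra_simps)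

lemma edge_fn_uminus_right [simp]: "edge_fn z (- e) = - edge_fn z e"
  by (simp add: edge_fn_def algebra_simps)

lemma edge_fn_add_right: "edge_fn z (d + e) = edge_fn z d + edge_fn z e"
  by (simp add: edge_fn_def algebra_simps)

lemma edge_fn_zero [simp]: "edge_fn 0 e = 0"
  by (simp add: edge_fn_def)

lemma edge_fn_scaleR [simp]: "edge_fn (of_real t * z) e = t * edge_fn z e"
  by (simp add: edge_fn_def algebra_simps)

lemma sqn_inverse: "sqn (1 / z) = 1 / sqn z"
  by (simp add: sqn_eq norm_divide power_divide)

lemma edge_fn_inverse: "edge_fn (1 / z) e = edge_fn z (cnj e) / sqn z"
  by (simp add: edge_fn_def sqn_def Re_divide Im_divide add_divide_distrib diff_divide_distrib algebra_simps)

lemma sqn_add: "sqn (z + w) = sqn z + 3 * edge_fn z w + sqn w"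
  by (simp add: sqn_def edge_fn_def power2_eq_square algebra_simps)

lemma J_vec_add: "J_vec a c + J_vec a' c' = J_vec (a + a') (c + c')"
  by (simp add: J_vec_def complex_eq_iff algebra_simps add_divide_distrib)

lemma J_vec_uminus: "- J_vec a c = J_vec (- a) (- c)"
  by (simp add: J_vec_def complex_eq_iff algebra_simps add_divide_distrib)

lemma J_vec_cnj: "cnj (J_vec a c) = J_vec a (- a - c)"
  by (simp add: J_vec_def complex_eq_iff algebra_simps add_divide_distrib)

lemma J_vec_diff: "J_vec a c - J_vec a' c' = J_vec (a - a') (c - c')"
  by (simp add: J_vec_def complex_eq_iff algebra_simps add_divide_distrib diff_divide_distrib)

lemma J_vec_inj [simp]: "J_vec a c = J_vec a' c' \<longleftrightarrow> a = a' \<and> c = c'"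
proof
  assume "J_vec a c = J_vec a' c'"
  then have "(of_int a :: real) = of_int a'" "(of_int (a + 2 * c) :: real) = of_int (a' + 2 * c')"
    unfolding J_vec_def by simp_all
  then show "a = a' \<and> c = c'" by (simp only: of_int_eq_iff) simp
qed simp

lemma J_vec_zero [simp]: "J_vec 0 0 = 0"
  by (simp add: J_vec_def complex_eq_iff)

lemma J_vec_eq_0 [simp]: "J_vec a c = 0 \<longleftrightarrow> a = 0 \<and> c = 0"
  using J_vec_inj[of a c 0 0] by simp

lemma edge_fn_J_vec_right:
  "edge_fn z (J_vec a c) = of_int a * edge_fn z (J_vec 1 0) + of_int c * edge_fn z (J_vec 0 1)"
  by (simp add: edge_fn_def J_vec_def field_simps)

lemma edge_fn_J_vecs: "edge_fn (J_vec a c) (J_vec a' c') = of_int (2 * a * a' + a * c' + a' * c + 2 * c * c')"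
  by (simp add: edge_fn_def J_vec_def field_simps)

lemma sqn_J_vec: "sqn (J_vec a c) = of_int (3 * (a\<^sup>2 + a * c + c\<^sup>2))"
  by (simp add: sqn_def J_vec_def power2_eq_square field_simps)

lemma sqn_edge_fn: "sqn z = (edge_fn z (J_vec 1 0))\<^sup>2 - edge_fn z (J_vec 1 0) * edge_fn z (J_vec 0 1)
    + (edge_fn z (J_vec 0 1))\<^sup>2"
proof -
  \<comment> \<open>Rescaling the imaginary part by \<open>sqrt 3\<close> turns the edge functions
    and \<open>sqn\<close> into polynomials with rational coefficients.\<close>
  define Y where "Y = Im z / sqrt 3"
  have Y: "Im z = sqrt 3 * Y" by (simp add: Y_def)
  show ?thesis by (simp add: edge_fn_def J_vec_def sqn_def Y power2_eq_square algebra_simps)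
qed

lemma min_vecs_uminus [simp]: "- e \<in> min_vecs \<longleftrightarrow> e \<in> min_vecs"
proof -
  have "e \<in> min_vecs \<Longrightarrow> - e \<in> min_vecs" for e by (auto simp: min_vecs_def J_vec_uminus)
  from this[of e] this[of "- e"] show ?thesis by auto
qed

lemma min_vecs_cnj [simp]: "cnj e \<in> min_vecs \<longleftrightarrow> e \<in> min_vecs"
proof -
  have "e \<in> min_vecs \<Longrightarrow> cnj e \<in> min_vecs" for e by (auto simp: min_vecs_def J_vec_cnj)
  from this[of e] this[of "cnj e"] show ?thesis by auto
qed

lemma finite_min_vecs [simp]: "finite min_vecs"
  by (simp add: min_vecs_def)

lemma edge_fn_self: "e \<in> min_vecs \<Longrightarrow> edge_fn e e = 2"
  by (auto simp: min_vecs_def edge_fn_J_vecs)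

lemma sqn_min_vec: "e \<in> min_vecs \<Longrightarrow> sqn e = 3"
  by (auto simp: min_vecs_def sqn_J_vec)

lemma sqn_add_min_vec: "e \<in> min_vecs \<Longrightarrow> sqn (z + e) = sqn z + 3 * edge_fn z e + 3"
  by (simp add: sqn_add sqn_min_vec)

lemma sqn_diff_min_vec: "e \<in> min_vecs \<Longrightarrow> sqn (z - e) = sqn z - 3 * edge_fn z e + 3"
  using sqn_add_min_vec[of "- e" z] by simp

lemma cmod_min_vec: "e \<in> min_vecs \<Longrightarrow> cmod e = sqrt 3"
  using sqn_min_vec[of e] by (simp add: sqn_eq real_sqrt_unique)

text \<open>Two minimal vectors enclose a multiple of 60 degrees; the alternatives are the angles 0,
  180, 60 and 120.\<close>

lemma edge_fn_min_vecs:
  assumes "d \<in> min_vecs" "e \<in> min_vecs"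
  shows "d = e \<or> d = - e \<or> (edge_fn d e = 1 \<and> e - d \<in> min_vecs) \<or> (edge_fn d e = - 1 \<and> e + d \<in> min_vecs)"
  using assms by (auto simp: min_vecs_def edge_fn_J_vecs J_vec_add J_vec_diff J_vec_uminus)

text \<open>Two minimal vectors with a minimal sum enclose 120 degrees. Their edge functions serve
  as coordinates, in which the squared modulus is the hexagonal form; plane estimates become
  polynomial inequalities in two variables.\<close>

lemma sqn_split:
  assumes "d \<in> min_vecs" "e \<in> min_vecs" "d + e \<in> min_vecs"
  shows "sqn z = (edge_fn z d)\<^sup>2 + edge_fn z d * edge_fn z e + (edge_fn z e)\<^sup>2"
proof -
  define P where "P = edge_fn z (J_vec 1 0)"
  define Q where "Q = edge_fn z (J_vec 0 1)"
  have PQ: "edge_fn z (J_vec a c) = of_int a * P + of_int c * Q" for a c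
    unfolding P_def Q_def by (rule edge_fn_J_vec_right)
  have N: "sqn z = P\<^sup>2 - P * Q + Q\<^sup>2" unfolding P_def Q_def by (rule sqn_edge_fn)
  from assms show ?thesis
    by (auto simp: min_vecs_def J_vec_add PQ N power2_eq_square algebra_simps)
qed

lemma min_vec_decompose:
  assumes "e \<in> min_vecs"
  obtains d d' where "d \<in> min_vecs" "d' \<in> min_vecs" "e = d + d'" "edge_fn e d = 1" "edge_fn e d' = 1"
proof -
  from assms obtain a c where e: "e = J_vec a c" and "(a, c) \<in> {(1, 0), (0, 1), (- 1, 1), (- 1, 0), (0, - 1), (1, - 1)}"
    unfolding min_vecs_def by auto
  \<comment> \<open>The witnesses are \<open>zeta * e\<close> and \<open>cnj zeta * e\<close>, which
    add up to \<open>e\<close> because \<open>zeta + cnj zeta = 1\<close>.\<close>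
  then have "J_vec (- c) (a + c) \<in> min_vecs" "J_vec (a + c) (- a) \<in> min_vecs"
    "edge_fn e (J_vec (- c) (a + c)) = 1" "edge_fn e (J_vec (a + c) (- a)) = 1"
    unfolding min_vecs_def e by (auto simp: edge_fn_J_vecs)
  moreover have "e = J_vec (- c) (a + c) + J_vec (a + c) (- a)" by (simp add: e J_vec_add)
  ultimately show ?thesis using that by blast
qed

lemma ideal_J_iff: "z \<in> ideal_J \<longleftrightarrow> (\<exists>a c. z = J_vec a c)"
proof -
  have "eta * (of_int a + of_int b * zeta) = J_vec a b" for a b :: int
    by (simp add: J_vec_def complex_eq_iff eta_def zeta_def sqrt_m3_def algebra_simps add_divide_distrib)
  then show ?thesis
    unfolding ideal_J_def eisenstein_ints_def mem_Collect_eq by metis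
qed

lemma min_vecs_subset_J: "e \<in> min_vecs \<Longrightarrow> e \<in> ideal_J"
  unfolding min_vecs_def ideal_J_iff by auto

lemma ideal_J_add: "x \<in> ideal_J \<Longrightarrow> y \<in> ideal_J \<Longrightarrow> x + y \<in> ideal_J"
  unfolding ideal_J_iff by (metis J_vec_add)

lemma ideal_J_uminus: "x \<in> ideal_J \<Longrightarrow> - x \<in> ideal_J"
  unfolding ideal_J_iff by (metis J_vec_uminus)

lemma ideal_J_diff: "x \<in> ideal_J \<Longrightarrow> y \<in> ideal_J \<Longrightarrow> x - y \<in> ideal_J"
  unfolding ideal_J_iff by (metis J_vec_diff)

lemma countable_ideal_J: "countable ideal_J"
proof -
  have "ideal_J = range (\<lambda>(a, b). J_vec a b)"
    by (auto simp: ideal_J_iff image_iff)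
  then show ?thesis by (metis countableI_type countable_image)
qed

lemma edge_fn_J_int:
  assumes "b \<in> ideal_J" "e \<in> min_vecs"
  obtains n :: int where "edge_fn b e = of_int n"
  using assms min_vecs_subset_J unfolding ideal_J_iff by (metis edge_fn_J_vecs)

text \<open>The points with integral edge functions are all Eisenstein integers
  \<open>q + p * zeta\<close>. The ideal has index 3 among them and is cut out by this congruence,
  which is what eliminates the vertices of the tiling.\<close>

lemma edge_fn_J_mod3:
  assumes "b \<in> ideal_J" "d \<in> min_vecs" "e \<in> min_vecs" "d + e \<in> min_vecs"
  obtains i j :: int where "edge_fn b d = of_int i" "edge_fn b e = of_int j" "3 dvd i - j"
proof -
  obtain a c where b: "b = J_vec a c"
    using assms(1) unfolding ideal_J_iff by blast
  obtain a1 c1 a2 c2 where de: "d = J_vec a1 c1" "e = J_vec a2 c2"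
    using assms(2,3) unfolding min_vecs_def by blast
  have dvd: "3 dvd 2 * (a1 - a2) + (c1 - c2)" "3 dvd (a1 - a2) + 2 * (c1 - c2)"
    using assms(2-4) unfolding de min_vecs_def by (auto simp: J_vec_add)
  have "(2 * a * a1 + a * c1 + a1 * c + 2 * c * c1) - (2 * a * a2 + a * c2 + a2 * c + 2 * c * c2)
      = a * (2 * (a1 - a2) + (c1 - c2)) + c * ((a1 - a2) + 2 * (c1 - c2))"
    by (simp add: algebra_simps)
  also have "3 dvd \<dots>" by (rule dvd_add[OF dvd_mult[OF dvd(1)] dvd_mult[OF dvd(2)]])
  finally show ?thesis
    by (intro that[of "2 * a * a1 + a * c1 + a1 * c + 2 * c * c1" "2 * a * a2 + a * c2 + a2 * c + 2 * c * c2"])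
      (simp_all only: b de edge_fn_J_vecs)
qed

text \<open>The form \<open>a^2 + a * c + c^2\<close> represents 0 and 1 but not 2, so after
  \<open>sqrt 3\<close> the next possible modulus is 3.\<close>

lemma ideal_J_cases:
  assumes "b \<in> ideal_J"
  shows "b = 0 \<or> b \<in> min_vecs \<or> 3 \<le> cmod b"
proof -
  obtain a c where b: "b = J_vec a c"
    using assms(1) unfolding ideal_J_iff by blast
  show ?thesis
  proof (cases "a\<^sup>2 + a * c + c\<^sup>2 \<ge> 3")
    case True
    then have "9 \<le> 3 * (a\<^sup>2 + a * c + c\<^sup>2)" by simp
    then have "(9::real) \<le> of_int (3 * (a\<^sup>2 + a * c + c\<^sup>2))" by linarith
    then have "3\<^sup>2 \<le> (cmod b)\<^sup>2"
      by (simp only: sqn_J_vec[symmetric] b sqn_eq) simp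
    then show ?thesis by (meson norm_ge_zero power2_le_imp_le)
  next
    case False
    \<comment> \<open>Completing the square: each left side is four times the form, which is at most
      2 here.\<close>
    have "(2 * a + c)\<^sup>2 + 3 * c\<^sup>2 \<le> 8" "(2 * c + a)\<^sup>2 + 3 * a\<^sup>2 \<le> 8"
      using False by (simp_all add: power2_eq_square algebra_simps)
    then have "3 * c\<^sup>2 \<le> 8" "3 * a\<^sup>2 \<le> 8"
      using zero_le_power2[of "2 * a + c"] zero_le_power2[of "2 * c + a"] by linarith+
    then have c2: "\<bar>c\<bar>\<^sup>2 < 2\<^sup>2" and a2: "\<bar>a\<bar>\<^sup>2 < 2\<^sup>2" by simp_all
    have "\<bar>c\<bar> < 2" "\<bar>a\<bar> < 2"
      using power2_less_imp_less[OF c2] power2_less_imp_less[OF a2] by simp_all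
    then have "a \<in> {-1, 0, 1}" "c \<in> {-1, 0, 1}" by auto
    with False show ?thesis unfolding b min_vecs_def by auto
  qed
qed

text \<open>Of \<open>p\<close>, \<open>q\<close> and \<open>- (p + q)\<close>, which add up to 0,
  two have the same weak sign, and the form is the square of the third minus their product.\<close>

lemma quad_form_le:
  fixes p q :: real
  assumes "\<bar>p\<bar> \<le> t" "\<bar>q\<bar> \<le> t" "\<bar>p + q\<bar> \<le> t"
  shows "p\<^sup>2 + p * q + q\<^sup>2 \<le> t\<^sup>2"
proof -
  have sq: "\<bar>x\<bar> \<le> t \<Longrightarrow> x\<^sup>2 \<le> t\<^sup>2" for x
    using power_mono[of "\<bar>x\<bar>" t 2] by simp
  consider "p * q \<ge> 0" | "p * (p + q) \<le> 0" | "q * (p + q) \<le> 0"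
  proof -
    have "p * q \<ge> 0 \<or> p * (p + q) \<le> 0 \<or> q * (p + q) \<le> 0"
      by (auto simp: zero_le_mult_iff mult_le_0_iff)
    then show ?thesis using that by blast
  qed
  then show ?thesis
  proof cases
    case 1
    then have "p\<^sup>2 + p * q + q\<^sup>2 \<le> (p + q)\<^sup>2" by (simp add: power2_eq_square algebra_simps)
    then show ?thesis using sq[OF assms(3)] by simp
  next
    case 2
    then have "p\<^sup>2 + p * q + q\<^sup>2 \<le> q\<^sup>2" by (simp add: power2_eq_square algebra_simps)
    then show ?thesis using sq[OF assms(2)] by simp
  next
    case 3
    then have "p\<^sup>2 + p * q + q\<^sup>2 \<le> p\<^sup>2" by (simp add: power2_eq_square algebra_simps)
    then show ?thesis using sq[OF assms(1)] by simp
  qed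
qed

lemma hexagon_uminus: "z \<in> hexagon \<Longrightarrow> - z \<in> hexagon"
  unfolding hexagon_def by (auto dest: bspec[of min_vecs _ "- e" for e])

lemma cl_hexagon_abs: "z \<in> cl_hexagon \<Longrightarrow> e \<in> min_vecs \<Longrightarrow> \<bar>edge_fn z e\<bar> \<le> 1"
  unfolding cl_hexagon_def by (auto simp: abs_le_iff dest: bspec[of _ _ "- e"])

lemma hexagon_abs: "z \<in> hexagon \<Longrightarrow> e \<in> min_vecs \<Longrightarrow> \<bar>edge_fn z e\<bar> < 1"
  unfolding hexagon_def by (auto simp: abs_less_iff dest: bspec[of _ _ "- e"])

lemma some_min_vecs: "J_vec 1 0 \<in> min_vecs" "J_vec (- 1) 1 \<in> min_vecs" "J_vec 0 1 \<in> min_vecs"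
  "J_vec 1 0 + J_vec (- 1) 1 = J_vec 0 1"
  by (auto simp: min_vecs_def J_vec_add)

lemma sqn_le_of_edge_fn:
  assumes "\<And>e. e \<in> min_vecs \<Longrightarrow> \<bar>edge_fn z e\<bar> \<le> t"
  shows "sqn z \<le> t\<^sup>2"
  using sqn_split[of "J_vec 1 0" "J_vec (- 1) 1" z] some_min_vecs
    quad_form_le[of "edge_fn z (J_vec 1 0)" t "edge_fn z (J_vec (- 1) 1)"] assms
  by (metis edge_fn_add_right)

lemma hexagon_cmod_less: assumes "z \<in> hexagon" shows "cmod z < 1"
proof -
  define t where "t = Max ((\<lambda>e. \<bar>edge_fn z e\<bar>) ` min_vecs)"
  have ne: "min_vecs \<noteq> {}" by (simp add: min_vecs_def)
  have "\<bar>edge_fn z e\<bar> \<le> t" if "e \<in> min_vecs" for e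
    unfolding t_def using that by (intro Max_ge) auto
  then have "sqn z \<le> t\<^sup>2" by (rule sqn_le_of_edge_fn)
  moreover have "t \<in> (\<lambda>e. \<bar>edge_fn z e\<bar>) ` min_vecs"
    unfolding t_def using ne by (intro Max_in) auto
  then have "0 \<le> t" "t < 1" using hexagon_abs[OF assms] by auto
  then have "t\<^sup>2 < 1" by (simp add: abs_square_less_1)
  ultimately have "(cmod z)\<^sup>2 < 1\<^sup>2" by (simp add: sqn_eq)
  then show ?thesis by (rule power2_less_imp_less) simp
qed

text \<open>Of two integers that are congruent modulo 3 and not both zero, one, or else their sum,
  has modulus at least 2. An edge function ranges over an interval of length 2 on the hexagon, so
  this separates translates.\<close>

lemma J_nonzero_edge_fn_ge2:
  assumes "b \<in> ideal_J" "b \<noteq> 0"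
  obtains e where "e \<in> min_vecs" "edge_fn b e \<ge> 2"
proof -
  obtain i j :: int where ij: "edge_fn b (J_vec 1 0) = of_int i" "edge_fn b (J_vec (- 1) 1) = of_int j" "3 dvd i - j"
    using edge_fn_J_mod3[OF assms(1), of "J_vec 1 0" "J_vec (- 1) 1"] some_min_vecs by metis
  have s: "edge_fn b (J_vec 0 1) = of_int (i + j)"
    using ij some_min_vecs(4) edge_fn_add_right[of b "J_vec 1 0" "J_vec (- 1) 1"] by simp
  have "\<not> (i = 0 \<and> j = 0)"
  proof
    assume "i = 0 \<and> j = 0"
    then have "sqn b = 0" using sqn_split[of "J_vec 1 0" "J_vec (- 1) 1" b] some_min_vecs ij by simp
    with assms(2) sqn_pos[of b] show False by simp
  qed
  with ij(3) have "i \<ge> 2 \<or> j \<ge> 2 \<or> i + j \<ge> 2 \<or> i \<le> -2 \<or> j \<le> -2 \<or> i + j \<le> -2"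
    by presburger
  then have "edge_fn b (J_vec 1 0) \<ge> 2 \<or> edge_fn b (J_vec (- 1) 1) \<ge> 2 \<or> edge_fn b (J_vec 0 1) \<ge> 2
    \<or> edge_fn b (- J_vec 1 0) \<ge> 2 \<or> edge_fn b (- J_vec (- 1) 1) \<ge> 2 \<or> edge_fn b (- J_vec 0 1) \<ge> 2"
    unfolding edge_fn_uminus_right s ij by linarith
  then show ?thesis using that some_min_vecs min_vecs_uminus by metis
qed

lemma hexagon_translate_disjoint:
  assumes "z \<in> hexagon" "z - b \<in> cl_hexagon" "b \<in> ideal_J"
  shows "b = 0"
proof (rule ccontr)
  assume "b \<noteq> 0"
  then obtain e where e: "e \<in> min_vecs" "edge_fn b e \<ge> 2" using J_nonzero_edge_fn_ge2 assms(3) by blast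
  have "\<bar>edge_fn (z - b) e\<bar> \<le> 1" using assms(2) e cl_hexagon_abs by blast
  moreover have "\<bar>edge_fn z e\<bar> < 1" using assms(1) e hexagon_abs by blast
  ultimately show False using e by (simp add: edge_fn_diff)
qed

lemma J_vec_norm_lower: "\<bar>of_int a\<bar> \<le> cmod (J_vec a c)" "\<bar>of_int c\<bar> \<le> cmod (J_vec a c)"
proof -
  have "a\<^sup>2 \<le> 3 * (a\<^sup>2 + a * c + c\<^sup>2)" "c\<^sup>2 \<le> 3 * (a\<^sup>2 + a * c + c\<^sup>2)"
    using zero_le_power2[of "a + c"] zero_le_power2[of a] zero_le_power2[of c]
    unfolding power2_eq_square distrib_left distrib_right mult.commute[of c a] by linarith+
  then have "(of_int (a\<^sup>2) :: real) \<le> sqn (J_vec a c)" "(of_int (c\<^sup>2) :: real) \<le> sqn (J_vec a c)"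
    unfolding sqn_J_vec by (simp_all only: of_int_le_iff)
  then show "\<bar>of_int a\<bar> \<le> cmod (J_vec a c)" "\<bar>of_int c\<bar> \<le> cmod (J_vec a c)"
    unfolding sqn_eq of_int_power by (simp_all only: abs_le_square_iff[symmetric] abs_norm_cancel)
qed

text \<open>A lattice point nearest to \<open>z\<close> works: \<open>cl_hexagon\<close> is the
  Voronoi cell of 0, since \<open>edge_fn y e \<le> 1\<close> says that \<open>y\<close> is no
  farther from 0 than from \<open>e\<close>.\<close>

lemma cl_hexagon_covers:
  obtains b where "b \<in> ideal_J" "z - b \<in> cl_hexagon"
proof -
  \<comment> \<open>A lattice point with an index beyond \<open>K\<close> is longer than
    \<open>2 * cmod z\<close>, hence no closer to \<open>z\<close> than 0 is; a finite search
    suffices.\<close>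
  define K where "K = \<lceil>2 * cmod z\<rceil>"
  define S where "S = (\<lambda>(a, c). J_vec a c) ` ({- K..K} \<times> {- K..K})"
  have "0 \<le> 2 * cmod z" by simp
  then have K0: "0 \<le> K" unfolding K_def by linarith
  have "finite S" "S \<noteq> {}" using K0 by (auto simp: S_def)
  then obtain b where b: "b \<in> S" and min: "\<And>x. x \<in> S \<Longrightarrow> cmod (z - b) \<le> cmod (z - x)"
    using arg_min_if_finite(1)[of S "\<lambda>x. cmod (z - x)"] arg_min_least[of S _ "\<lambda>x. cmod (z - x)"] by blast
  have "0 \<in> S" unfolding S_def using K0 by (auto simp: image_iff intro!: bexI[of _ "(0, 0)"])
  have min': "cmod (z - b) \<le> cmod (z - x)" if xJ: "x \<in> ideal_J" for x
  proof (cases "x \<in> S")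
    case False
    obtain a c where x: "x = J_vec a c" using xJ unfolding ideal_J_iff by blast
    with False have "\<bar>a\<bar> > K \<or> \<bar>c\<bar> > K" by (auto simp: S_def image_iff)
    then have "of_int \<bar>a\<bar> > 2 * cmod z \<or> of_int \<bar>c\<bar> > 2 * cmod z" unfolding K_def by linarith
    then have "2 * cmod z < cmod x" using J_vec_norm_lower(1)[of a c] J_vec_norm_lower(2)[of c a] unfolding x by auto
    then have "cmod z \<le> cmod (z - x)" using norm_triangle_ineq2[of x z] by (simp add: norm_minus_commute)
    then show ?thesis using min[OF \<open>0 \<in> S\<close>] by simp
  qed (rule min)
  have bJ: "b \<in> ideal_J" using b by (auto simp: S_def ideal_J_iff)
  have "edge_fn (z - b) e \<le> 1" if e: "e \<in> min_vecs" for e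
  proof -
    have "cmod (z - b) \<le> cmod ((z - b) - e)"
      using min'[OF ideal_J_add[OF bJ min_vecs_subset_J[OF e]]] by (simp add: diff_diff_add)
    then have "sqn (z - b) \<le> sqn ((z - b) - e)" unfolding sqn_eq by (intro power_mono) auto
    then show ?thesis using e by (simp add: sqn_diff_min_vec)
  qed
  then show ?thesis using that[OF bJ] by (auto simp: cl_hexagon_def)
qed

text \<open>The difference is a sum of squares. Geometrically, the disc around
  \<open>2 e / 3\<close> lies in the half plane \<open>p \<ge> 0\<close> and touches its boundary at
  the vertex \<open>p = 0\<close>, \<open>q = 1\<close>.\<close>

lemma outer_disc_lower:
  fixes p q :: real
  shows "2 * (p + q) - (p\<^sup>2 + p * q + q\<^sup>2 + 1) \<le> p"
proof -
  have "p\<^sup>2 + p * q + q\<^sup>2 + 1 - 2 * (p + q) = (p + (q - 1) / 2)\<^sup>2 + 3 / 4 * (q - 1)\<^sup>2 - p"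
    by (simp add: power2_eq_square field_simps)
  then show ?thesis
    using zero_le_power2[of "p + (q - 1) / 2"] zero_le_power2[of "q - 1"] by linarith
qed

text \<open>The closed disc around \<open>2 e / 3\<close> through the vertices shared by the hexagons at \<open>0\<close> and \<open>e\<close>
  meets no other open hexagon of the tiling.\<close>
lemma outer_disc_hexagon:
  assumes "e \<in> min_vecs" "b \<in> ideal_J" "y - b \<in> hexagon" "b \<noteq> 0" "b \<noteq> e"
  shows "2 * edge_fn y e < sqn y + 1"
proof (rule ccontr)
  assume "\<not> ?thesis"
  then have star: "sqn y + 1 \<le> 2 * edge_fn y e" by simp
  obtain d d' where d: "d \<in> min_vecs" "d' \<in> min_vecs" "e = d + d'" "edge_fn e d = 1" "edge_fn e d' = 1"
    using min_vec_decompose[OF assms(1)] by metis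
  have dd: "d + d' \<in> min_vecs" using d assms(1) by simp
  obtain i j :: int where ij: "edge_fn b d = of_int i" "edge_fn b d' = of_int j" "3 dvd i - j"
    using edge_fn_J_mod3[OF assms(2) d(1,2) dd] by blast
  define p q where "p = edge_fn y d" and "q = edge_fn y d'"
  have star': "p\<^sup>2 + p * q + q\<^sup>2 + 1 \<le> 2 * (p + q)"
    using star sqn_split[OF d(1,2) dd, of y] by (simp add: p_def q_def d(3) edge_fn_add_right)
  have "0 \<le> p" "0 \<le> q" using outer_disc_lower[of p q] outer_disc_lower[of q p] star' by (simp_all add: algebra_simps)
  \<comment> \<open>On the disc, \<open>p + q\<close> ranges between 2/3 and 2, the roots of
    \<open>3 * s^2 - 8 * s + 4\<close>.\<close>
  have s: "p + q \<le> 2"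
  proof -
    define A where "A = p\<^sup>2 + p * q + q\<^sup>2 + 1 - 2 * (p + q)"
    have "3 * ((p + q - 2) * (p + q - 2 / 3)) = 4 * A - (p - q)\<^sup>2"
      by (simp add: A_def power2_eq_square field_simps)
    moreover have "A \<le> 0" using star' by (simp add: A_def)
    ultimately have "3 * ((p + q - 2) * (p + q - 2 / 3)) \<le> 0" using zero_le_power2[of "p - q"] by linarith
    moreover have "0 < (p + q - 2) * (p + q - 2 / 3)" if "p + q > 2" using that by (intro mult_pos_pos) auto
    ultimately show ?thesis by linarith
  qed
  have ab: "\<bar>p - of_int i\<bar> < 1" "\<bar>q - of_int j\<bar> < 1" "\<bar>p + q - of_int (i + j)\<bar> < 1"
    using hexagon_abs[OF assms(3) d(1)] hexagon_abs[OF assms(3) d(2)] hexagon_abs[OF assms(3) dd]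
    by (simp_all add: edge_fn_diff edge_fn_add_right ij p_def q_def algebra_simps)
  have "0 \<le> i" "0 \<le> j" "i + j \<le> 2" using ab \<open>0 \<le> p\<close> \<open>0 \<le> q\<close> s by linarith+
  \<comment> \<open>The congruence leaves only the two pairs that belong to \<open>b = 0\<close> and
    \<open>b = e\<close>.\<close>
  then have "(i = 0 \<and> j = 0) \<or> (i = 1 \<and> j = 1)" using ij(3) by presburger
  then have "sqn b = 0 \<or> sqn (b - e) = 0"
    using sqn_split[OF d(1,2) dd, of b] sqn_split[OF d(1,2) dd, of "b - e"] ij d(4,5)
    by (auto simp: edge_fn_diff)
  then show False using assms(4,5) sqn_pos[of b] sqn_pos[of "b - e"] by auto
qed

text \<open>The point reflection \<open>y \<mapsto> e - y\<close> exchanges the discs around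
  \<open>e / 3\<close> and \<open>2 e / 3\<close> as well as the hexagons at 0 and
  \<open>e\<close>.\<close>

lemma inner_disc_hexagon:
  assumes "e \<in> min_vecs" "b \<in> ideal_J" "y - b \<in> hexagon" "b \<noteq> 0" "b \<noteq> e"
  shows "edge_fn y e < sqn y"
proof -
  have "(e - y) - (e - b) \<in> hexagon"
    using hexagon_uminus[OF assms(3)] by simp
  then have "2 * edge_fn (e - y) e < sqn (e - y) + 1"
    using assms by (intro outer_disc_hexagon[of e "e - b"]) (auto intro: ideal_J_diff min_vecs_subset_J)
  then show ?thesis using assms(1) sqn_diff_min_vec[OF assms(1), of y]
    by (simp add: edge_fn_diff edge_fn_self sqn_eq norm_minus_commute)
qed

section \<open>The natural extension domain\<close>

text \<open>A description of \<open>U_hat\<close> up to null sets without the partition into 36 pieces: each disc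
  condition on \<open>z\<close> forbids one disc for \<open>w\<close>.\<close>

definition nat_ext :: "(complex \<times> complex) set" where
  "nat_ext = {(z, w). z \<in> hexagon \<and> 1 < sqn w \<and> (\<forall>e\<in>min_vecs. sqn z \<noteq> edge_fn z e \<and>
     (sqn z < edge_fn z e \<longrightarrow> 3 * edge_fn w e < 2 * sqn w + 1) \<and>
     (sqn z + 1 < 2 * edge_fn z e \<longrightarrow> 3 * edge_fn w e < sqn w + 2))}"

section \<open>Forward invariance and injectivity of the branches\<close>

lemma min_vecs_nonempty: "min_vecs \<noteq> {}"
  by (simp add: min_vecs_def)

text \<open>At 0 both sides of \<open>sqn z \<noteq> edge_fn z e\<close> vanish, so that clause also
  removes the origin.\<close>

lemma nat_ext_nonzero: "(z, w) \<in> nat_ext \<Longrightarrow> z \<noteq> 0" "(z, w) \<in> nat_ext \<Longrightarrow> w \<noteq> 0"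
  using min_vecs_nonempty by (auto simp: nat_ext_def sqn_def)

text \<open>Up to conjugating \<open>e\<close>, inversion exchanges the edge line with the circle
  around \<open>e / 3\<close> and keeps the circle around \<open>2 e / 3\<close>; for
  \<open>w\<close> it exchanges the circles around \<open>e / 2\<close> and \<open>e\<close>. Each
  clause is a defining inequality divided by \<open>sqn\<close>.\<close>

lemma nat_ext_inverse:
  assumes "(z, w) \<in> nat_ext" and e: "e \<in> min_vecs"
  shows "edge_fn (1 / z) e < sqn (1 / z)"
    and "sqn (1 / w) < 1"
    and "1 < edge_fn (1 / z) e \<Longrightarrow> 3 * edge_fn (1 / w) e < 2 + sqn (1 / w)"
    and "1 + sqn (1 / z) < 2 * edge_fn (1 / z) e \<Longrightarrow> 3 * edge_fn (1 / w) e < 1 + 2 * sqn (1 / w)"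
    and "edge_fn (1 / z) e \<noteq> 1"
proof -
  have z: "0 < sqn z" "z \<noteq> 0" and w: "0 < sqn w" using nat_ext_nonzero[OF assms(1)] sqn_pos by auto
  have ce: "cnj e \<in> min_vecs" using e by simp
  have *: "edge_fn z (cnj e) < 1" "1 < sqn w" "sqn z \<noteq> edge_fn z (cnj e)"
     "sqn z < edge_fn z (cnj e) \<longrightarrow> 3 * edge_fn w (cnj e) < 2 * sqn w + 1"
     "sqn z + 1 < 2 * edge_fn z (cnj e) \<longrightarrow> 3 * edge_fn w (cnj e) < sqn w + 2"
    using assms(1) ce by (auto simp: nat_ext_def hexagon_def)
  have conv: "edge_fn (1 / x) e - sqn (1 / x) = (edge_fn x (cnj e) - 1) / sqn x"
    "1 - edge_fn (1 / x) e = (sqn x - edge_fn x (cnj e)) / sqn x"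
    "1 - sqn (1 / x) = (sqn x - 1) / sqn x"
    "2 + sqn (1 / x) - 3 * edge_fn (1 / x) e = (2 * sqn x + 1 - 3 * edge_fn x (cnj e)) / sqn x"
    "1 + sqn (1 / x) - 2 * edge_fn (1 / x) e = (sqn x + 1 - 2 * edge_fn x (cnj e)) / sqn x"
    "1 + 2 * sqn (1 / x) - 3 * edge_fn (1 / x) e = (sqn x + 2 - 3 * edge_fn x (cnj e)) / sqn x"
    if "0 < sqn x" for x
    using that by (simp_all add: sqn_inverse edge_fn_inverse add_divide_distrib diff_divide_distrib)
  have neg: "0 < a / sqn z \<longleftrightarrow> 0 < a" "a / sqn z < 0 \<longleftrightarrow> a < 0" "0 < a / sqn w \<longleftrightarrow> 0 < a" "a / sqn z = 0 \<longleftrightarrow> a = 0" for a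
    using z w by (simp_all add: zero_less_divide_iff divide_less_0_iff)
  have "(edge_fn z (cnj e) - 1) / sqn z < 0" "0 < (sqn w - 1) / sqn w" "(sqn z - edge_fn z (cnj e)) / sqn z \<noteq> 0"
    unfolding neg using *(1-3) by simp_all
  then show "edge_fn (1 / z) e < sqn (1 / z)" "sqn (1 / w) < 1" "edge_fn (1 / z) e \<noteq> 1"
    unfolding conv(1,2)[OF z(1), symmetric] conv(3)[OF w, symmetric] by simp_all
  show "3 * edge_fn (1 / w) e < 2 + sqn (1 / w)" if "1 < edge_fn (1 / z) e"
  proof -
    have "(sqn z - edge_fn z (cnj e)) / sqn z < 0" unfolding conv(2)[OF z(1), symmetric] using that by simp
    then have "0 < (2 * sqn w + 1 - 3 * edge_fn w (cnj e)) / sqn w" unfolding neg using *(4) by simp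
    then show ?thesis unfolding conv(4)[OF w, symmetric] by simp
  qed
  show "3 * edge_fn (1 / w) e < 1 + 2 * sqn (1 / w)" if "1 + sqn (1 / z) < 2 * edge_fn (1 / z) e"
  proof -
    have "(sqn z + 1 - 2 * edge_fn z (cnj e)) / sqn z < 0" unfolding conv(5)[OF z(1), symmetric] using that by simp
    then have "0 < (sqn w + 2 - 3 * edge_fn w (cnj e)) / sqn w" unfolding neg using *(5) by simp
    then show ?thesis unfolding conv(6)[OF w, symmetric] by simp
  qed
qed

lemma inverse_notin_hexagon:
  assumes "z \<in> hexagon" "z \<noteq> 0" "1 / z - b \<in> hexagon" shows "b \<noteq> 0"
proof
  assume "b = 0"
  then have "cmod (1 / z) < 1" using hexagon_cmod_less[OF assms(3)] by simp
  moreover have "cmod z < 1" using hexagon_cmod_less[OF assms(1)] .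
  ultimately show False using assms(2) by (simp add: norm_divide field_simps)
qed

lemma sqn_diff_gt:
  assumes "sqn x < 1" "cmod c \<ge> 1 + t" "t \<ge> 0"
  shows "t\<^sup>2 < sqn (x - c)"
proof -
  have "cmod x < 1" using assms(1) power2_less_imp_less[of "cmod x" 1] by (simp add: sqn_eq)
  then have "t < cmod (x - c)" using assms(2) norm_triangle_ineq2[of c x] by (simp add: norm_minus_commute)
  then show ?thesis unfolding sqn_eq using assms(3) by (intro power_strict_mono) auto
qed

text \<open>\<open>1 / w\<close> lies in the unit disc, so a forbidden disc for
  \<open>1 / w - b\<close> matters only if its centre, moved by \<open>b\<close>, is close to 0. Few
  digits remain, and for each of them the position of \<open>1 / z - b\<close> relative to the walls
  supplies the matching clause of \<open>nat_ext_inverse\<close>.\<close>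

lemma nat_ext_into:
  assumes W: "(z, w) \<in> nat_ext" and b: "b \<in> ideal_J" and h: "1 / z - b \<in> hexagon"
    and gen: "\<forall>e\<in>min_vecs. sqn (1 / z - b) \<noteq> edge_fn (1 / z - b) e"
  shows "(1 / z - b, 1 / w - b) \<in> nat_ext"
proof -
  define Z Om where "Z = 1 / z" and "Om = 1 / w"
  define z1 w1 where "z1 = Z - b" and "w1 = Om - b"
  note inv = nat_ext_inverse[OF W, folded Z_def Om_def]
  have zh: "z \<in> hexagon" using W by (auto simp: nat_ext_def)
  have z1h: "z1 \<in> hexagon" using h by (simp add: z1_def Z_def)
  have Om1: "sqn Om < 1" using inv(2) some_min_vecs(1) by blast
  have b0: "b \<noteq> 0" using inverse_notin_hexagon[OF zh nat_ext_nonzero(1)[OF W] h] .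
  have Zz1: "Z = z1 + b" by (simp add: z1_def)
  have s3: "sqrt 3 < (2::real)" by (simp add: real_less_lsqrt)
  have A: "1 < sqn w1"
    using ideal_J_cases[OF b] b0
  proof (elim disjE)
    assume bE: "b \<in> min_vecs"
    have "edge_fn Z b = edge_fn z1 b + 2" by (simp add: Zz1 edge_fn_add edge_fn_self[OF bE])
    then have "1 < edge_fn Z b" using hexagon_abs[OF z1h bE] by simp
    from inv(3)[OF bE this] show ?thesis by (simp add: w1_def sqn_diff_min_vec[OF bE])
  next
    assume "3 \<le> cmod b"
    then show ?thesis using sqn_diff_gt[of Om 1 b] Om1 by (simp add: w1_def)
  qed simp
  have B: "3 * edge_fn w1 e < 2 * sqn w1 + 1" if e: "e \<in> min_vecs" and lt: "sqn z1 < edge_fn z1 e" for e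
  proof -
    \<comment> \<open>\<open>b + e / 2\<close> is the moved centre; at distance 3/2 or more, a disc
      of radius 1/2 misses the open unit disc.\<close>
    have far: ?thesis if "3 / 2 \<le> cmod (b + e / 2)"
    proof -
      have "(1 / 2)\<^sup>2 < sqn (Om - (b + e / 2))" using that by (intro sqn_diff_gt Om1) auto
      also have "Om - (b + e / 2) = w1 + (- (1 / 2)) * e" by (simp add: w1_def algebra_simps)
      also have "sqn \<dots> = sqn w1 - 3 / 2 * edge_fn w1 e + sqn e / 4"
        by (simp add: sqn_def edge_fn_def power2_eq_square field_simps)
      finally show ?thesis using sqn_min_vec[OF e] by (simp add: power2_eq_square)
    qed
    have sq: "sqn (b + e / 2) = sqn b + 3 / 2 * edge_fn b e + 3 / 4"
      using sqn_min_vec[OF e] by (simp add: sqn_def edge_fn_def power2_eq_square field_simps)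
    show ?thesis
      using ideal_J_cases[OF b] b0
    proof (elim disjE)
      assume bE: "b \<in> min_vecs"
      show ?thesis
      proof (cases "b = - e")
        case True
        have "sqn z1 = sqn Z + 3 * edge_fn Z e + 3" "edge_fn z1 e = edge_fn Z e + 2"
          by (simp_all add: z1_def True sqn_add_min_vec[OF e] edge_fn_add edge_fn_self[OF e])
        with lt have "1 + sqn Z < 2 * edge_fn Z b" by (simp add: True)
        from inv(4)[OF bE this] have "- 3 * edge_fn Om e < 1 + 2 * sqn Om" by (simp add: True)
        moreover have "sqn w1 = sqn Om + 3 * edge_fn Om e + 3" "edge_fn w1 e = edge_fn Om e + 2"
          by (simp_all add: w1_def True sqn_add_min_vec[OF e] edge_fn_add edge_fn_self[OF e])
        ultimately show ?thesis by simp
      next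
        case False
        \<comment> \<open>Only \<open>b = - e\<close> comes nearer: otherwise the squared distance
          is at least \<open>3 - 3 / 2 + 3 / 4 = (3 / 2)^2\<close>.\<close>
        then have "edge_fn b e \<ge> - 1" using edge_fn_min_vecs[OF bE e] edge_fn_self[OF e] by auto
        then have "(3 / 2)\<^sup>2 \<le> (cmod (b + e / 2))\<^sup>2"
          unfolding sqn_eq[symmetric] sq by (simp add: sqn_min_vec[OF bE] power2_eq_square)
        then show ?thesis by (intro far power2_le_imp_le[of "3/2"]) auto
      qed
    next
      assume "3 \<le> cmod b"
      moreover have "cmod (e / 2) \<le> 1" using cmod_min_vec[OF e] s3 by (simp add: norm_divide)
      moreover have "cmod b \<le> cmod (b + e / 2) + cmod (e / 2)"
        by (metis add_diff_cancel_right' norm_triangle_ineq4)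
      ultimately show ?thesis by (intro far) auto
    qed simp
  qed
  have C: "3 * edge_fn w1 e < sqn w1 + 2" if e: "e \<in> min_vecs" and lt: "sqn z1 + 1 < 2 * edge_fn z1 e" for e
  proof -
    \<comment> \<open>For \<open>1 / w\<close> the forbidden unit disc around \<open>e\<close>
      becomes the one around the lattice point \<open>b + e\<close>, so the cases are those of
      \<open>d\<close>.\<close>
    define d where "d = b + e"
    have dJ: "d \<in> ideal_J" unfolding d_def by (intro ideal_J_add b min_vecs_subset_J e)
    have goal: ?thesis if "1 < sqn (Om - d)"
    proof -
      have "Om - d = w1 - e" by (simp add: d_def w1_def)
      with that show ?thesis using sqn_diff_min_vec[OF e, of w1] by simp
    qed
    show ?thesis using ideal_J_cases[OF dJ]
    proof (elim disjE)
      \<comment> \<open>This case is contradictory: the hypothesis on \<open>z1\<close> would put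
        \<open>z\<close> outside the hexagon.\<close>
      assume "d = 0"
      then have be: "b = - e" by (simp add: d_def eq_neg_iff_add_eq_0)
      have "sqn z1 = sqn Z + 3 * edge_fn Z e + 3" "edge_fn z1 e = edge_fn Z e + 2"
        by (simp_all add: z1_def be sqn_add_min_vec[OF e] edge_fn_add edge_fn_self[OF e])
      with lt have "sqn Z < edge_fn Z (- e)" by simp
      moreover have "edge_fn Z (- e) < sqn Z" using inv(1)[of "- e"] e by simp
      ultimately show ?thesis by simp
    next
      assume dE: "d \<in> min_vecs"
      have "1 < edge_fn Z d"
      proof -
        have Zd: "edge_fn Z d = edge_fn z1 d + 2 - edge_fn e d"
        proof -
          have "Z = z1 + d - e" by (simp add: Zz1 d_def)
          then show ?thesis by (simp add: edge_fn_add edge_fn_diff edge_fn_self[OF dE])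
        qed
        have abs: "\<bar>edge_fn z1 d\<bar> < 1" using hexagon_abs[OF z1h dE] .
        have "e \<noteq> d" using b0 by (auto simp: d_def)
        then consider "e = - d" | "edge_fn e d = 1" "d - e \<in> min_vecs" | "edge_fn e d = - 1"
          using edge_fn_min_vecs[OF e dE] by blast
        then show ?thesis
        proof cases
          case 1
          then show ?thesis using Zd abs edge_fn_self[OF dE] by simp
        next
          case 3
          then show ?thesis using Zd abs by simp
        next
          \<comment> \<open>At 60 degrees the bound on \<open>edge_fn z1 d\<close> from the hexagon
            is too weak; positivity comes from the half plane that contains the outer disc.\<close>
          case 2
          have ed: "e - d \<in> min_vecs" using 2(2) min_vecs_uminus[of "d - e"] by simp
          define p q where "p = edge_fn z1 d" and "q = edge_fn z1 (e - d)"
          have "d + (e - d) \<in> min_vecs" using e by simp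
          then have "sqn z1 = p\<^sup>2 + p * q + q\<^sup>2" using sqn_split[OF dE ed] by (simp add: p_def q_def)
          moreover have "edge_fn z1 e = p + q" using edge_fn_add_right[of z1 d "e - d"] by (simp add: p_def q_def)
          ultimately have "p\<^sup>2 + p * q + q\<^sup>2 + 1 < 2 * (p + q)" using lt by simp
          then have "p > 0" using outer_disc_lower[of p q] by linarith
          then show ?thesis using Zd 2 by (simp add: p_def)
        qed
      qed
      from inv(3)[OF dE this] show ?thesis by (intro goal) (simp add: sqn_diff_min_vec[OF dE])
    next
      assume "3 \<le> cmod d"
      then show ?thesis using sqn_diff_gt[of Om 1 d] Om1 by (intro goal) simp
    qed
  qed
  show ?thesis
    using z1h A B C gen unfolding nat_ext_def z1_def w1_def Z_def Om_def by auto
qed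

text \<open>Both inverses of the dual coordinates lie in the unit disc, so distinct digits differ by
  a minimal vector \<open>d\<close>. If \<open>edge_fn (1 / z) (- d)\<close> or
  \<open>edge_fn (1 / z') d\<close> exceeded 1, the dual coordinates would contradict each other;
  the two values add up to 2, so both equal 1, a wall that \<open>nat_ext\<close> avoids.\<close>

lemma nat_ext_inj:
  assumes W: "(z, w) \<in> nat_ext" "(z', w') \<in> nat_ext" and J: "b \<in> ideal_J" "b' \<in> ideal_J"
    and eq: "1 / z - b = 1 / z' - b'" "1 / w - b = 1 / w' - b'"
  shows "b = b'"
proof (rule ccontr)
  assume "b \<noteq> b'"
  define d where "d = b' - b"
  have dJ: "d \<in> ideal_J" and d0: "d \<noteq> 0" using J \<open>b \<noteq> b'\<close> by (auto simp: d_def ideal_J_diff)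
  have Z: "1 / z' = 1 / z + d" and Om: "1 / w' = 1 / w + d"
    using eq by (simp_all add: d_def algebra_simps)
  note inv = nat_ext_inverse[OF W(1)] and inv' = nat_ext_inverse[OF W(2)]
  have lt: "sqn (1 / w) < 1" "sqn (1 / w') < 1" using inv(2) inv'(2) some_min_vecs(1) by blast+
  have "d \<in> min_vecs"
    using ideal_J_cases[OF dJ] d0
  proof (elim disjE)
    assume "3 \<le> cmod d"
    then have "1\<^sup>2 < sqn (1 / w' - d)" using lt by (intro sqn_diff_gt) auto
    with lt(1) Om show ?thesis by simp
  qed auto
  then have dE: "d \<in> min_vecs" "- d \<in> min_vecs" by auto
  have "\<not> 1 < edge_fn (1 / z) (- d)"
  proof
    assume "1 < edge_fn (1 / z) (- d)"
    from inv(3)[OF dE(2) this] lt(2) show False by (simp add: Om sqn_add_min_vec[OF dE(1)])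
  qed
  moreover have "\<not> 1 < edge_fn (1 / z') d"
  proof
    assume "1 < edge_fn (1 / z') d"
    from inv'(3)[OF dE(1) this] have "1 < sqn (1 / w' - d)" by (simp add: sqn_diff_min_vec[OF dE(1)])
    with lt(1) Om show False by simp
  qed
  moreover have "edge_fn (1 / z') d = edge_fn (1 / z) d + 2"
    by (simp add: Z edge_fn_add edge_fn_self[OF dE(1)])
  ultimately have "edge_fn (1 / z) (- d) = 1" by simp
  with inv(5)[OF dE(2)] show False by simp
qed

text \<open>The types are the cells cut out by the circles and lines through the vertices; they form a Markov
  partition for the branches \<open>z \<mapsto> 1 / (z + b)\<close>.\<close>

definition same_type :: "complex \<Rightarrow> complex \<Rightarrow> bool" where
  "same_type z z' \<longleftrightarrow> z \<in> hexagon \<and> z' \<in> hexagon \<and> (\<forall>e\<in>min_vecs.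
     sgn (sqn z - edge_fn z e) = sgn (sqn z' - edge_fn z' e) \<and>
     sgn (sqn z + 1 - 2 * edge_fn z e) = sgn (sqn z' + 1 - 2 * edge_fn z' e) \<and>
     sgn (edge_fn z e) = sgn (edge_fn z' e))"

section \<open>The Markov property of the types\<close>

lemma sgn_eq_D: "sgn (x::real) = sgn y \<Longrightarrow> (0 < x \<longleftrightarrow> 0 < y) \<and> (x < 0 \<longleftrightarrow> y < 0) \<and> (x = 0 \<longleftrightarrow> y = 0)"
  by (auto simp: sgn_if split: if_splits)

lemma same_type_nat_ext:
  assumes "same_type z z'" "(z, w) \<in> nat_ext"
  shows "(z', w) \<in> nat_ext"
proof -
  have "sqn z < edge_fn z e \<longleftrightarrow> sqn z' < edge_fn z' e" "sqn z = edge_fn z e \<longleftrightarrow> sqn z' = edge_fn z' e"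
    "sqn z + 1 < 2 * edge_fn z e \<longleftrightarrow> sqn z' + 1 < 2 * edge_fn z' e" if "e \<in> min_vecs" for e
    using assms(1) that sgn_eq_D[of "sqn z - edge_fn z e" "sqn z' - edge_fn z' e"]
      sgn_eq_D[of "sqn z + 1 - 2 * edge_fn z e" "sqn z' + 1 - 2 * edge_fn z' e"]
    by (auto simp: same_type_def)
  then show ?thesis using assms by (auto simp: nat_ext_def same_type_def)
qed

lemma translate_nonzero: "z \<in> hexagon \<Longrightarrow> b \<in> ideal_J \<Longrightarrow> b \<noteq> 0 \<Longrightarrow> z + b \<noteq> 0"
proof
  assume z: "z \<in> hexagon" and b: "b \<in> ideal_J" "b \<noteq> 0" and "z + b = 0"
  then have "z - (- b) \<in> cl_hexagon" by (simp add: cl_hexagon_def)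
  from hexagon_translate_disjoint[OF z this ideal_J_uminus[OF b(1)]] b(2) show False by simp
qed

text \<open>Under inversion the circle around \<open>e / 3\<close> comes from an edge line, while
  outer circles and lines through 0 come from walls of the same kind.\<close>

lemma sgn_inverse_conditions:
  assumes "y \<noteq> 0"
  shows "sgn (sqn (1 / y) - edge_fn (1 / y) e) = sgn (1 - edge_fn y (cnj e))"
    "sgn (sqn (1 / y) + 1 - 2 * edge_fn (1 / y) e) = sgn (sqn y + 1 - 2 * edge_fn y (cnj e))"
    "sgn (edge_fn (1 / y) e) = sgn (edge_fn y (cnj e))"
proof -
  have s: "sqn y > 0" using sqn_pos assms by blast
  have "sqn (1 / y) - edge_fn (1 / y) e = (1 - edge_fn y (cnj e)) / sqn y"
    "sqn (1 / y) + 1 - 2 * edge_fn (1 / y) e = (sqn y + 1 - 2 * edge_fn y (cnj e)) / sqn y"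
    "edge_fn (1 / y) e = edge_fn y (cnj e) / sqn y"
    using s by (simp_all add: sqn_inverse edge_fn_inverse field_simps)
  then show "sgn (sqn (1 / y) - edge_fn (1 / y) e) = sgn (1 - edge_fn y (cnj e))"
    "sgn (sqn (1 / y) + 1 - 2 * edge_fn (1 / y) e) = sgn (sqn y + 1 - 2 * edge_fn y (cnj e))"
    "sgn (edge_fn (1 / y) e) = sgn (edge_fn y (cnj e))"
    using s by (simp_all add: sgn_divide)
qed

lemma hexagon_inverse_iff: "y \<noteq> 0 \<Longrightarrow> 1 / y \<in> hexagon \<longleftrightarrow> (\<forall>e\<in>min_vecs. edge_fn y e < sqn y)"
proof -
  assume y: "y \<noteq> 0"
  have "1 / y \<in> hexagon \<longleftrightarrow> (\<forall>e\<in>min_vecs. edge_fn y (cnj e) < sqn y)"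
    unfolding hexagon_def using sqn_pos[OF y] by (simp add: edge_fn_inverse)
  also have "\<dots> \<longleftrightarrow> (\<forall>e\<in>min_vecs. edge_fn y e < sqn y)"
    by (metis complex_cnj_cnj min_vecs_cnj)
  finally show ?thesis .
qed

text \<open>The walls for \<open>1 / (z + b)\<close> pull back to walls for \<open>z\<close> or miss
  the hexagon. For lines, \<open>edge_fn b e\<close> is an integer and moves the interval from -1 to
  1 off the wall except for one value, where the sign is determined by that of
  \<open>edge_fn z e\<close>. For circles, the disc lemmas leave only \<open>e = b\<close>, where
  translation by \<open>b\<close> turns an inner circle into an outer one for \<open>- b\<close> and
  conversely.\<close>

lemma same_type_inverse_translate:
  assumes J: "b \<in> ideal_J" "b \<noteq> 0" and ty: "same_type z z'" and h: "1 / (z + b) \<in> hexagon"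
  shows "same_type (1 / (z + b)) (1 / (z' + b))"
proof -
  have zh: "z \<in> hexagon" "z' \<in> hexagon" using ty by (auto simp: same_type_def)
  note nz = translate_nonzero[OF zh(1) J] translate_nonzero[OF zh(2) J]
  have sg: "sgn (sqn z - edge_fn z e) = sgn (sqn z' - edge_fn z' e)"
     "sgn (sqn z + 1 - 2 * edge_fn z e) = sgn (sqn z' + 1 - 2 * edge_fn z' e)"
     "sgn (edge_fn z e) = sgn (edge_fn z' e)" if "e \<in> min_vecs" for e
    using ty that by (auto simp: same_type_def)
  have at_b: "sqn (x + b) - edge_fn (x + b) b = sqn x + 1 - 2 * edge_fn x (- b)"
    "sqn (x + b) + 1 - 2 * edge_fn (x + b) b = sqn x - edge_fn x (- b)" if "b \<in> min_vecs" for x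
    using that by (simp_all add: sqn_add_min_vec edge_fn_add edge_fn_self)
  have h': "1 / (z' + b) \<in> hexagon"
    unfolding hexagon_inverse_iff[OF nz(2)]
  proof
    fix e assume e: "e \<in> min_vecs"
    show "edge_fn (z' + b) e < sqn (z' + b)"
    proof (cases "e = b")
      case True
      then have bE: "b \<in> min_vecs" "- b \<in> min_vecs" using e by auto
      have "edge_fn (z + b) b < sqn (z + b)" using h bE unfolding hexagon_inverse_iff[OF nz(1)] by blast
      then have "0 < sqn z + 1 - 2 * edge_fn z (- b)" using at_b(1)[OF bE(1), of z] by linarith
      then have "0 < sqn z' + 1 - 2 * edge_fn z' (- b)" using sgn_eq_D[OF sg(2)[OF bE(2)]] by blast
      then show ?thesis using at_b(1)[OF bE(1), of z'] True by simp
    next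
      case False
      then show ?thesis using inner_disc_hexagon[OF e J(1), of "z' + b"] zh J by auto
    qed
  qed
  have "sgn (1 - edge_fn (z + b) e) = sgn (1 - edge_fn (z' + b) e) \<and>
     sgn (sqn (z + b) + 1 - 2 * edge_fn (z + b) e) = sgn (sqn (z' + b) + 1 - 2 * edge_fn (z' + b) e) \<and>
     sgn (edge_fn (z + b) e) = sgn (edge_fn (z' + b) e)" if e: "e \<in> min_vecs" for e
  proof -
    obtain n :: int where n: "edge_fn b e = of_int n" using edge_fn_J_int[OF J(1) e] by blast
    have ab: "\<bar>edge_fn z e\<bar> < 1" "\<bar>edge_fn z' e\<bar> < 1" using zh e hexagon_abs by auto
    note s3 = sgn_eq_D[OF sg(3)[OF e]]
    have 1: "sgn (1 - edge_fn (z + b) e) = sgn (1 - edge_fn (z' + b) e)"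
    proof (cases "n = 1")
      case False
      then have "n \<le> 0 \<or> n \<ge> 2" by auto
      then have "(real_of_int n \<le> 0) \<or> (real_of_int n \<ge> 2)" by auto
      then show ?thesis using ab by (auto simp: edge_fn_add n sgn_if)
    qed (use s3 in \<open>auto simp: edge_fn_add n sgn_if\<close>)
    have 3: "sgn (edge_fn (z + b) e) = sgn (edge_fn (z' + b) e)"
    proof (cases "n = 0")
      case False
      then have "n \<le> -1 \<or> n \<ge> 1" by auto
      then have "(real_of_int n \<le> -1) \<or> (real_of_int n \<ge> 1)" by auto
      then show ?thesis using ab by (auto simp: edge_fn_add n sgn_if)
    qed (use s3 in \<open>auto simp: edge_fn_add n sgn_if\<close>)
    have 2: "sgn (sqn (z + b) + 1 - 2 * edge_fn (z + b) e) = sgn (sqn (z' + b) + 1 - 2 * edge_fn (z' + b) e)"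
    proof (cases "e = b")
      case True
      then have bE: "b \<in> min_vecs" "- b \<in> min_vecs" using e by auto
      show ?thesis unfolding True at_b(2)[OF bE(1)] by (rule sg(1)[OF bE(2)])
    next
      case False
      then have "2 * edge_fn (z + b) e < sqn (z + b) + 1" "2 * edge_fn (z' + b) e < sqn (z' + b) + 1"
        using outer_disc_hexagon[OF e J(1)] zh J by auto
      then show ?thesis by simp
    qed
    show ?thesis using 1 2 3 by blast
  qed
  then show ?thesis using h h' unfolding same_type_def by (simp add: sgn_inverse_conditions[OF nz(1)] sgn_inverse_conditions[OF nz(2)])
qed

text \<open>Such a translate of the hexagon meets no wall at all, so all its points are inverted
  into one type.\<close>

lemma same_type_far_translate:
  assumes J: "b \<in> ideal_J" and far: "\<And>e. e \<in> min_vecs \<Longrightarrow> 2 < \<bar>edge_fn b e\<bar>" and zh: "z \<in> hexagon" "z' \<in> hexagon"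
  shows "same_type (1 / (z + b)) (1 / (z' + b))"
proof -
  have b0: "b \<noteq> 0" using far[OF some_min_vecs(1)] by auto
  have bE: "b \<noteq> e" if "e \<in> min_vecs" for e
    using far[OF that] edge_fn_self[OF that] by auto
  note nz = translate_nonzero[OF zh(1) J b0] translate_nonzero[OF zh(2) J b0]
  have "1 / (z + b) \<in> hexagon" "1 / (z' + b) \<in> hexagon"
    unfolding hexagon_inverse_iff[OF nz(1)] hexagon_inverse_iff[OF nz(2)]
    using inner_disc_hexagon[OF _ J _ b0 bE] zh by auto
  moreover have "sgn (1 - edge_fn (z + b) e) = sgn (1 - edge_fn (z' + b) e) \<and>
     sgn (sqn (z + b) + 1 - 2 * edge_fn (z + b) e) = sgn (sqn (z' + b) + 1 - 2 * edge_fn (z' + b) e) \<and>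
     sgn (edge_fn (z + b) e) = sgn (edge_fn (z' + b) e)" if e: "e \<in> min_vecs" for e
  proof -
    have ab: "\<bar>edge_fn z e\<bar> < 1" "\<bar>edge_fn z' e\<bar> < 1" using zh e hexagon_abs by auto
    have "2 * edge_fn (z + b) e < sqn (z + b) + 1" "2 * edge_fn (z' + b) e < sqn (z' + b) + 1"
      using outer_disc_hexagon[OF e J _ b0 bE[OF e]] zh by auto
    then show ?thesis using ab far[OF e] by (auto simp: edge_fn_add sgn_if abs_if split: if_splits)
  qed
  ultimately show ?thesis unfolding same_type_def by (simp add: sgn_inverse_conditions[OF nz(1)] sgn_inverse_conditions[OF nz(2)])
qed

section \<open>Comparison with the 36 product pieces\<close>

lemma eta_J_vec: "eta = J_vec 1 0" and sqrt_m3_J_vec: "sqrt_m3 = J_vec 0 1"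
  by (simp_all add: eta_def sqrt_m3_def J_vec_def complex_eq_iff)

section \<open>Rotational symmetry\<close>

lemma zeta_eq: "zeta = Complex (1 / 2) (sqrt 3 / 2)"
  by (simp add: zeta_def sqrt_m3_def complex_eq_iff)

lemma cmod_zeta [simp]: "cmod zeta = 1"
  by (simp add: zeta_eq cmod_def power_divide)

lemma zeta_nonzero [simp]: "zeta \<noteq> 0"
  using cmod_zeta by force

lemma zeta_mult_J_vec: "zeta * J_vec a c = J_vec (- c) (a + c)"
  by (simp add: zeta_eq J_vec_def complex_eq_iff field_simps)

lemma zeta_mult_min_vecs: "e \<in> min_vecs \<Longrightarrow> zeta * e \<in> min_vecs"
  by (auto simp: min_vecs_def zeta_mult_J_vec)

lemma zeta_power_min_vecs: "e \<in> min_vecs \<Longrightarrow> zeta ^ n * e \<in> min_vecs"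
  by (induction n) (auto simp: zeta_mult_min_vecs mult.assoc)

lemma edge_fn_rotate: assumes "cmod c = 1" shows "edge_fn (c * z) (c * e) = edge_fn z e"
proof -
  have "Re (c * z) * Re (c * e) + Im (c * z) * Im (c * e)
      = ((Re c)\<^sup>2 + (Im c)\<^sup>2) * (Re z * Re e + Im z * Im e)"
    by (simp add: power2_eq_square algebra_simps)
  also have "(Re c)\<^sup>2 + (Im c)\<^sup>2 = 1" using assms by (simp add: cmod_power2[symmetric])
  finally show ?thesis by (simp add: edge_fn_def)
qed

lemma sqn_rotate: "cmod c = 1 \<Longrightarrow> sqn (c * z) = sqn z"
  by (simp add: sqn_eq norm_mult)

lemma cmod_zeta_power [simp]: "cmod (zeta ^ n) = 1"
  by (simp add: norm_power)

lemma zeta_power_surj: assumes "e \<in> min_vecs" obtains d where "d \<in> min_vecs" "e = zeta ^ n * d"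
proof -
  have "inj_on (\<lambda>e. zeta ^ n * e) min_vecs" by (auto simp: inj_on_def)
  then have "(\<lambda>e. zeta ^ n * e) ` min_vecs = min_vecs"
    using zeta_power_min_vecs by (intro endo_inj_surj) auto
  with assms that show ?thesis by (metis imageE)
qed

lemma hexagon_rotate: "zeta ^ n * z \<in> hexagon \<longleftrightarrow> z \<in> hexagon"
proof -
  have "(\<forall>e\<in>min_vecs. edge_fn (zeta ^ n * z) e < 1) \<longleftrightarrow> (\<forall>d\<in>min_vecs. edge_fn (zeta ^ n * z) (zeta ^ n * d) < 1)"
    using zeta_power_min_vecs zeta_power_surj by metis
  then show ?thesis by (simp add: hexagon_def edge_fn_rotate)
qed

lemma nat_ext_rotate: "(z, w) \<in> nat_ext \<Longrightarrow> (zeta ^ n * z, zeta ^ n * w) \<in> nat_ext"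
proof -
  assume W: "(z, w) \<in> nat_ext"
  show ?thesis
    unfolding nat_ext_def mem_Collect_eq prod.case
  proof (intro conjI ballI)
    show "zeta ^ n * z \<in> hexagon" "1 < sqn (zeta ^ n * w)"
      using W by (auto simp: nat_ext_def hexagon_rotate sqn_rotate)
    fix e assume "e \<in> min_vecs"
    then obtain d where d: "d \<in> min_vecs" "e = zeta ^ n * d" by (rule zeta_power_surj)
    show "sqn (zeta ^ n * z) \<noteq> edge_fn (zeta ^ n * z) e"
      "sqn (zeta ^ n * z) < edge_fn (zeta ^ n * z) e \<longrightarrow> 3 * edge_fn (zeta ^ n * w) e < 2 * sqn (zeta ^ n * w) + 1"
      "sqn (zeta ^ n * z) + 1 < 2 * edge_fn (zeta ^ n * z) e \<longrightarrow> 3 * edge_fn (zeta ^ n * w) e < sqn (zeta ^ n * w) + 2"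
      using W d(1) unfolding d(2) by (auto simp: nat_ext_def sqn_rotate edge_fn_rotate)
  qed
qed

text \<open>The excluded curves are the circles that bound the pieces, the lines that bound the
  sectors and the edge lines of the hexagon; a generic point lies inside one cell.\<close>

definition generic :: "complex \<Rightarrow> bool" where
  "generic z \<longleftrightarrow> (\<forall>e\<in>min_vecs. sqn z \<noteq> edge_fn z e \<and> sqn z + 1 \<noteq> 2 * edge_fn z e \<and> edge_fn z e \<noteq> 0 \<and> edge_fn z e \<noteq> 1)"

lemma generic_rotate: "generic (zeta ^ n * z) \<Longrightarrow> generic z"
  unfolding generic_def
proof
  fix e assume g: "\<forall>e\<in>min_vecs. sqn (zeta ^ n * z) \<noteq> edge_fn (zeta ^ n * z) e \<and> sqn (zeta ^ n * z) + 1 \<noteq> 2 * edge_fn (zeta ^ n * z) e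
    \<and> edge_fn (zeta ^ n * z) e \<noteq> 0 \<and> edge_fn (zeta ^ n * z) e \<noteq> 1" and e: "e \<in> min_vecs"
  from g[rule_format, OF zeta_power_min_vecs[OF e], of n]
  show "sqn z \<noteq> edge_fn z e \<and> sqn z + 1 \<noteq> 2 * edge_fn z e \<and> edge_fn z e \<noteq> 0 \<and> edge_fn z e \<noteq> 1"
    by (simp add: edge_fn_rotate sqn_rotate)
qed

lemma cmod_less_iff_sqn: "0 \<le> r \<Longrightarrow> cmod x < r \<longleftrightarrow> sqn x < r\<^sup>2" "0 \<le> r \<Longrightarrow> cmod x > r \<longleftrightarrow> sqn x > r\<^sup>2"
  unfolding sqn_eq by (auto intro: power_strict_mono dest: power2_less_imp_less)

text \<open>\<open>cmod e / 3 = rad\<close>, so the circle passes through 0 and the constant terms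
  cancel.\<close>

lemma inner_circle:
  assumes "e \<in> min_vecs"
  shows "cmod (z - e / 3) < rad \<longleftrightarrow> sqn z < edge_fn z e" "cmod (z - e / 3) > rad \<longleftrightarrow> sqn z > edge_fn z e"
proof -
  have "sqn (z - e / 3) = sqn z - edge_fn z e + sqn e / 9"
    by (simp add: sqn_def edge_fn_def power2_eq_square field_simps)
  then show "cmod (z - e / 3) < rad \<longleftrightarrow> sqn z < edge_fn z e" "cmod (z - e / 3) > rad \<longleftrightarrow> sqn z > edge_fn z e"
    using cmod_less_iff_sqn[of rad "z - e / 3"] sqn_min_vec[OF assms] by (simp_all add: rad_def power_divide)
qed

lemma outer_circle:
  assumes "e \<in> min_vecs"
  shows "cmod (z - 2 / 3 * e) < rad \<longleftrightarrow> sqn z + 1 < 2 * edge_fn z e" "cmod (z - 2 / 3 * e) > rad \<longleftrightarrow> sqn z + 1 > 2 * edge_fn z e"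
proof -
  have "sqn (z - 2 / 3 * e) = sqn z - 2 * edge_fn z e + 4 * sqn e / 9"
    by (simp add: sqn_def edge_fn_def power2_eq_square field_simps)
  then show "cmod (z - 2 / 3 * e) < rad \<longleftrightarrow> sqn z + 1 < 2 * edge_fn z e" "cmod (z - 2 / 3 * e) > rad \<longleftrightarrow> sqn z + 1 > 2 * edge_fn z e"
    using cmod_less_iff_sqn[of rad "z - 2 / 3 * e"] sqn_min_vec[OF assms] by (auto simp: rad_def power_divide)
qed

lemma dual_circles:
  assumes "e \<in> min_vecs"
  shows "cmod (w - e / 2) > 1 / 2 \<longleftrightarrow> 3 * edge_fn w e < 2 * sqn w + 1" "cmod (w - e) > 1 \<longleftrightarrow> 3 * edge_fn w e < sqn w + 2"
    "cmod w > 1 \<longleftrightarrow> 1 < sqn w"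
proof -
  have "sqn (w - e / 2) = sqn w - 3 / 2 * edge_fn w e + sqn e / 4"
    by (simp add: sqn_def edge_fn_def power2_eq_square field_simps)
  then show "cmod (w - e / 2) > 1 / 2 \<longleftrightarrow> 3 * edge_fn w e < 2 * sqn w + 1"
    using cmod_less_iff_sqn(2)[of "1 / 2" "w - e / 2"] sqn_min_vec[OF assms] by (auto simp: power_divide)
  show "cmod (w - e) > 1 \<longleftrightarrow> 3 * edge_fn w e < sqn w + 2" "cmod w > 1 \<longleftrightarrow> 1 < sqn w"
    using sqn_diff_min_vec[OF assms, of w] cmod_less_iff_sqn(2)[of 1 "w - e"] cmod_less_iff_sqn(2)[of 1 w] by auto
qed

text \<open>In the sector between the rays through \<open>1\<close> and \<open>zeta\<close> use the coordinates
  \<open>p = edge_fn z sqrt_m3\<close> and \<open>q = edge_fn z (cnj eta)\<close>, for which \<open>edge_fn z eta = p + q\<close>.\<close>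

lemma sector_values:
  shows "edge_fn z (J_vec 1 0) = edge_fn z (J_vec 0 1) + edge_fn z (J_vec 1 (- 1))"
    and "sqn z = (edge_fn z (J_vec 0 1))\<^sup>2 + edge_fn z (J_vec 0 1) * edge_fn z (J_vec 1 (- 1)) + (edge_fn z (J_vec 1 (- 1)))\<^sup>2"
    and "Im z > 0 \<longleftrightarrow> edge_fn z (J_vec 0 1) > 0"
    and "Re z = edge_fn z (J_vec 1 (- 1)) + edge_fn z (J_vec 0 1) / 2"
    and "Im z < sqrt 3 * Re z \<longleftrightarrow> edge_fn z (J_vec 1 (- 1)) > 0"
proof -
  show "edge_fn z (J_vec 1 0) = edge_fn z (J_vec 0 1) + edge_fn z (J_vec 1 (- 1))"
    by (simp add: edge_fn_add_right[symmetric] J_vec_add)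
  show "sqn z = (edge_fn z (J_vec 0 1))\<^sup>2 + edge_fn z (J_vec 0 1) * edge_fn z (J_vec 1 (- 1)) + (edge_fn z (J_vec 1 (- 1)))\<^sup>2"
    by (rule sqn_split) (auto simp: min_vecs_def J_vec_add)
  show "Im z > 0 \<longleftrightarrow> edge_fn z (J_vec 0 1) > 0" "Re z = edge_fn z (J_vec 1 (- 1)) + edge_fn z (J_vec 0 1) / 2"
    by (auto simp: edge_fn_def J_vec_def zero_less_mult_iff field_simps)
  have "sqrt 3 * edge_fn z (J_vec 1 (- 1)) = sqrt 3 * Re z - Im z"
    by (simp add: edge_fn_def J_vec_def field_simps)
  then show "Im z < sqrt 3 * Re z \<longleftrightarrow> edge_fn z (J_vec 1 (- 1)) > 0"
    by (smt (verit) real_sqrt_gt_0_iff zero_less_mult_iff)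
qed

text \<open>The three circles each pass through two vertices of the triangle 0, 1,
  \<open>zeta\<close>, and all three meet in its centre \<open>p = q = 1 / 3\<close>; hence the open
  discs have no common point. The estimate uses that the first two discs force
  \<open>p + q < 2 / 3\<close>.\<close>

lemma three_discs_disjoint:
  fixes p q :: real
  assumes "p\<^sup>2 + p * q + q\<^sup>2 < p" "p\<^sup>2 + p * q + q\<^sup>2 < q"
  shows "2 * (p + q) < p\<^sup>2 + p * q + q\<^sup>2 + 1"
proof -
  define s N where "s = p + q" and "N = p\<^sup>2 + p * q + q\<^sup>2"
  have N: "4 * N = 3 * s\<^sup>2 + (p - q)\<^sup>2" by (simp add: s_def N_def power2_eq_square algebra_simps)
  have "2 * N < s" using assms by (simp add: s_def N_def)
  then have "3 * s\<^sup>2 < 2 * s" using N zero_le_power2[of "p - q"] by linarith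
  then have "s * (3 * s - 2) < 0" by (simp add: power2_eq_square algebra_simps)
  then have s: "0 < s" "s < 2 / 3" by (auto simp: mult_less_0_iff)
  then have "0 < (2 - 3 * s) * (2 - s)" by (intro mult_pos_pos) auto
  then have "8 * s < 4 + 3 * s\<^sup>2" by (simp add: power2_eq_square algebra_simps)
  then have "8 * s < 4 + 4 * N" using N zero_le_power2[of "p - q"] by linarith
  then show ?thesis by (simp add: s_def N_def)
qed

text \<open>Outside both inner discs \<open>d < u\<close>, and outside the outer disc
  \<open>u < d^2\<close>; as \<open>u\<close> lies between 0 and 1, these are incompatible.\<close>

lemma three_discs_cover:
  fixes p q :: real
  assumes "0 < p" "0 < q" "p + q < 1" "p < p\<^sup>2 + p * q + q\<^sup>2" "q < p\<^sup>2 + p * q + q\<^sup>2"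
    "2 * (p + q) < p\<^sup>2 + p * q + q\<^sup>2 + 1"
  shows False
proof -
  define s d u where "s = p + q" and "d = \<bar>p - q\<bar>" and "u = 3 * s - 2"
  have N: "4 * (p\<^sup>2 + p * q + q\<^sup>2) = 3 * s\<^sup>2 + d\<^sup>2"
    by (simp add: s_def d_def power2_eq_square algebra_simps)
  have ds: "0 \<le> d" "d < s" "s < 1" using assms by (auto simp: s_def d_def)
  have "2 * p = s + d \<or> 2 * q = s + d" by (auto simp: s_def d_def)
  then have 1: "2 * s + 2 * d < 3 * s\<^sup>2 + d\<^sup>2" using assms(4,5) N by auto
  have 2: "8 * s < 3 * s\<^sup>2 + d\<^sup>2 + 4" using assms(6) N by (simp add: s_def)
  have "d * (2 - s) \<le> d * (2 - d)" using ds by (intro mult_left_mono) auto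
  also have "\<dots> < s * u" using 1 by (simp add: u_def power2_eq_square algebra_simps)
  finally have a: "d * (2 - s) < s * u" .
  have "0 \<le> d * (2 - s)" using ds by simp
  then have "0 < s * u" using a by simp
  then have u: "0 < u" "u < 1" using ds by (auto simp: zero_less_mult_iff u_def)
  have "d \<le> d * (2 - s)" using ds by (simp add: mult_le_cancel_left1)
  also note a
  also have "s * u \<le> u" using ds u by simp
  finally have "d < u" .
  moreover have "u * (2 - s) < d\<^sup>2" using 2 by (simp add: u_def power2_eq_square algebra_simps)
  then have "u < d\<^sup>2" using ds u by (smt (verit) mult_le_cancel_left1)
  ultimately show False using ds u by (smt (verit) mult_left_le power2_eq_square)
qed


lemma sector_min_vecs: "J_vec 1 0 \<in> min_vecs" "J_vec 0 1 \<in> min_vecs" "J_vec 1 (- 1) \<in> min_vecs"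
  by (auto simp: min_vecs_def)

lemma ball_min_vecs: "(\<forall>e\<in>min_vecs. P e) \<longleftrightarrow> (\<forall>e\<in>{J_vec 1 0, J_vec 0 1, J_vec 1 (- 1)}. P e \<and> P (- e))"
  unfolding min_vecs_def by (auto simp: J_vec_uminus)

text \<open>Of the twelve disc conditions on \<open>z\<close>, the inner one for \<open>eta\<close>
  always holds in the open sector, three are undecided, and the remaining eight never hold.\<close>

lemma nat_ext_sector:
  assumes z: "z \<in> hexagon" "generic z"
    and pos: "0 < edge_fn z (J_vec 0 1)" "0 < edge_fn z (J_vec 1 (- 1))"
  shows "(z, w) \<in> nat_ext \<longleftrightarrow> 1 < sqn w \<and> 3 * edge_fn w (J_vec 1 0) < 2 * sqn w + 1 \<and>
    (sqn z < edge_fn z (J_vec 0 1) \<longrightarrow> 3 * edge_fn w (J_vec 0 1) < 2 * sqn w + 1) \<and>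
    (sqn z < edge_fn z (J_vec 1 (- 1)) \<longrightarrow> 3 * edge_fn w (J_vec 1 (- 1)) < 2 * sqn w + 1) \<and>
    (sqn z + 1 < 2 * edge_fn z (J_vec 1 0) \<longrightarrow> 3 * edge_fn w (J_vec 1 0) < sqn w + 2)"
proof -
  define p q where "p = edge_fn z (J_vec 0 1)" and "q = edge_fn z (J_vec 1 (- 1))"
  have N: "sqn z = p\<^sup>2 + p * q + q\<^sup>2" and e0: "edge_fn z (J_vec 1 0) = p + q"
    using sector_values[of z] by (simp_all add: p_def q_def)
  have pq: "0 < p" "0 < q" "p + q < 1"
    using pos z(1) sector_min_vecs(1) e0 by (auto simp: p_def q_def hexagon_def)
  have "0 < p * q" using pq by simp
  then have N0: "0 < sqn z" unfolding N using zero_le_power2[of p] zero_le_power2[of q] by linarith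
  have "p\<^sup>2 + p * q + q\<^sup>2 < (p + q)\<^sup>2" using \<open>0 < p * q\<close> by (simp add: power2_eq_square algebra_simps)
  also have "(p + q)\<^sup>2 \<le> p + q" using pq mult_left_le[of "p + q" "p + q"] by (simp add: power2_eq_square)
  finally have Nlt: "sqn z < p + q" by (simp add: N)
  have "0 < (p - 1)\<^sup>2 + p * q + q\<^sup>2" "0 < (q - 1)\<^sup>2 + p * q + p\<^sup>2"
    using \<open>0 < p * q\<close> zero_le_power2[of "p - 1"] zero_le_power2[of "q - 1"] zero_le_power2[of p] zero_le_power2[of q]
    by linarith+
  then have o: "\<not> sqn z + 1 < 2 * p" "\<not> sqn z + 1 < 2 * q" unfolding N by (simp_all add: power2_eq_square algebra_simps)
  have gen: "\<forall>e\<in>min_vecs. sqn z \<noteq> edge_fn z e" using z(2) by (auto simp: generic_def)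
  have "(z, w) \<in> nat_ext \<longleftrightarrow> 1 < sqn w \<and> (\<forall>e\<in>min_vecs. (sqn z < edge_fn z e \<longrightarrow> 3 * edge_fn w e < 2 * sqn w + 1) \<and>
     (sqn z + 1 < 2 * edge_fn z e \<longrightarrow> 3 * edge_fn w e < sqn w + 2))"
    using z(1) gen unfolding nat_ext_def by auto
  then show ?thesis
    unfolding ball_min_vecs using N0 Nlt o pq
    by (simp add: e0 p_def[symmetric] q_def[symmetric] conj_ac)
qed

lemma V1_iff:
  "z \<in> V1 1 \<longleftrightarrow> z \<in> U \<and> sqn z < edge_fn z (J_vec 1 (- 1)) \<and> sqn z < edge_fn z (J_vec 0 1)"
  "z \<in> V1 2 \<longleftrightarrow> z \<in> U \<and> 2 * edge_fn z (J_vec 1 0) < sqn z + 1 \<and> edge_fn z (J_vec 0 1) < sqn z \<and> Re z > 0 \<and> Im z > 0"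
  "z \<in> V1 3 \<longleftrightarrow> z \<in> U \<and> 2 * edge_fn z (J_vec 1 0) < sqn z + 1 \<and> edge_fn z (J_vec 1 (- 1)) < sqn z \<and> Im z > 0 \<and> Im z < sqrt 3 * Re z"
  "z \<in> V1 4 \<longleftrightarrow> z \<in> U \<and> sqn z < edge_fn z (J_vec 1 (- 1)) \<and> sqn z + 1 < 2 * edge_fn z (J_vec 1 0)"
  "z \<in> V1 5 \<longleftrightarrow> z \<in> U \<and> sqn z + 1 < 2 * edge_fn z (J_vec 1 0) \<and> sqn z < edge_fn z (J_vec 0 1)"
  "z \<in> V1 6 \<longleftrightarrow> z \<in> U \<and> edge_fn z (J_vec 1 (- 1)) < sqn z \<and> edge_fn z (J_vec 0 1) < sqn z \<and> Re z > 0 \<and> Im z > 0"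
  unfolding V1_def eta_J_vec[symmetric]
  using inner_circle[OF sector_min_vecs(2), of z] inner_circle[OF sector_min_vecs(3), of z] outer_circle[OF sector_min_vecs(1), of z]
  by (auto simp: eta_J_vec sqrt_m3_J_vec J_vec_cnj)

lemma V1_dual_iff:
  "w \<in> V1_dual 1 \<longleftrightarrow> 1 < sqn w \<and> 3 * edge_fn w (J_vec 0 1) < 2 * sqn w + 1 \<and> 3 * edge_fn w (J_vec 1 0) < 2 * sqn w + 1
     \<and> 3 * edge_fn w (J_vec 1 (- 1)) < 2 * sqn w + 1"
  "w \<in> V1_dual 2 \<longleftrightarrow> 1 < sqn w \<and> 3 * edge_fn w (J_vec 1 0) < 2 * sqn w + 1 \<and> 3 * edge_fn w (J_vec 1 (- 1)) < 2 * sqn w + 1"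
  "w \<in> V1_dual 3 \<longleftrightarrow> 1 < sqn w \<and> 3 * edge_fn w (J_vec 0 1) < 2 * sqn w + 1 \<and> 3 * edge_fn w (J_vec 1 0) < 2 * sqn w + 1"
  "w \<in> V1_dual 4 \<longleftrightarrow> 1 < sqn w \<and> 3 * edge_fn w (J_vec 1 0) < sqn w + 2 \<and> 3 * edge_fn w (J_vec 1 (- 1)) < 2 * sqn w + 1"
  "w \<in> V1_dual 5 \<longleftrightarrow> 1 < sqn w \<and> 3 * edge_fn w (J_vec 1 0) < sqn w + 2 \<and> 3 * edge_fn w (J_vec 0 1) < 2 * sqn w + 1"
  "w \<in> V1_dual 6 \<longleftrightarrow> 1 < sqn w \<and> 3 * edge_fn w (J_vec 1 0) < sqn w + 2"
  unfolding V1_dual_def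
  using dual_circles[OF sector_min_vecs(1), of w] dual_circles[OF sector_min_vecs(2), of w] dual_circles[OF sector_min_vecs(3), of w]
  by (auto simp: eta_J_vec sqrt_m3_J_vec J_vec_cnj)

text \<open>Pieces 2 and 6 are cut out of a quadrant, which is wider than the sector. Lying outside
  the disc around \<open>sqrt_m3 / 3\<close> excludes the rest, since \<open>q \<le> 0\<close> would
  give \<open>sqn z \<le> p^2 \<le> p\<close>. For pieces 4 and 5 the outer disc already lies in the
  sector.\<close>

lemma V1_sector:
  assumes "z \<in> V1 k" "k \<in> {1..6}" "z \<in> hexagon"
  shows "0 < edge_fn z (J_vec 0 1)" "0 < edge_fn z (J_vec 1 (- 1))"
proof -
  define p q where "p = edge_fn z (J_vec 0 1)" and "q = edge_fn z (J_vec 1 (- 1))"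
  have N: "sqn z = p\<^sup>2 + p * q + q\<^sup>2" and e0: "edge_fn z (J_vec 1 0) = p + q"
    and Im: "Im z > 0 \<longleftrightarrow> 0 < p" and Re: "Re z = q + p / 2" and ReIm: "Im z < sqrt 3 * Re z \<longleftrightarrow> 0 < q"
    using sector_values[of z] by (simp_all add: p_def q_def)
  have lt: "p < 1" "q < 1" using assms(3) sector_min_vecs by (auto simp: p_def q_def hexagon_def)
  have pos: "0 < q" if "p < sqn z" "0 < p" "0 < q + p / 2"
  proof (rule ccontr)
    assume "\<not> 0 < q"
    then have "q * (q + p) \<le> 0" using that by (auto simp: mult_le_0_iff)
    then have "sqn z \<le> p * p" by (simp add: N power2_eq_square algebra_simps)
    also have "\<dots> \<le> p" using that lt by (simp add: mult_left_le)
    finally show False using that by simp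
  qed
  have out: "0 < p \<and> 0 < q" if "sqn z + 1 < 2 * (p + q)"
    using outer_disc_lower[of p q] outer_disc_lower[of q p] that unfolding N by (simp add: algebra_simps)
  have N0: "0 \<le> sqn z" by simp
  have "k = 1 \<or> k = 2 \<or> k = 3 \<or> k = 4 \<or> k = 5 \<or> k = 6" using assms(2) by auto
  then have "0 < p \<and> 0 < q"
  proof (elim disjE)
    assume "k = 1"
    then show ?thesis using assms(1) N0 unfolding \<open>k = 1\<close> V1_iff p_def[symmetric] q_def[symmetric] by linarith
  next
    assume "k = 2"
    then show ?thesis using assms(1) pos by (simp add: V1_iff p_def[symmetric] q_def[symmetric] Im Re)
  next
    assume "k = 3"
    then show ?thesis using assms(1) by (simp add: V1_iff Im ReIm)
  next
    assume "k = 4"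
    then show ?thesis using assms(1) out by (simp add: V1_iff e0)
  next
    assume "k = 5"
    then show ?thesis using assms(1) out by (simp add: V1_iff e0)
  next
    assume "k = 6"
    then show ?thesis using assms(1) pos by (simp add: V1_iff p_def[symmetric] q_def[symmetric] Im Re)
  qed
  then show "0 < edge_fn z (J_vec 0 1)" "0 < edge_fn z (J_vec 1 (- 1))" by (simp_all add: p_def q_def)
qed

text \<open>Let \<open>A\<close>, \<open>B\<close>, \<open>C\<close> stand for the three discs. Six
  of the eight combinations occur: the pairwise overlaps are the pieces 1, 4, 5, and the parts
  covered by a single disc are 2, 3, 6.\<close>

lemma V1_dual_nat_ext:
  assumes z: "z \<in> hexagon" "generic z" "z \<in> U"
    and pos: "0 < edge_fn z (J_vec 0 1)" "0 < edge_fn z (J_vec 1 (- 1))"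
  shows "(\<exists>k\<in>{1..6}. z \<in> V1 k \<and> w \<in> V1_dual k) \<longleftrightarrow> (z, w) \<in> nat_ext"
proof -
  define p q where "p = edge_fn z (J_vec 0 1)" and "q = edge_fn z (J_vec 1 (- 1))"
  have N: "sqn z = p\<^sup>2 + p * q + q\<^sup>2" and e0: "edge_fn z (J_vec 1 0) = p + q"
    and Im: "Im z > 0 \<longleftrightarrow> 0 < p" and Re: "Re z = q + p / 2" and ReIm: "Im z < sqrt 3 * Re z \<longleftrightarrow> 0 < q"
    using sector_values[of z] by (simp_all add: p_def q_def)
  have pq: "0 < p" "0 < q" "p + q < 1"
    using pos z(1) sector_min_vecs(1) e0 by (auto simp: p_def q_def hexagon_def)
  define A B C where "A \<longleftrightarrow> sqn z < p" and "B \<longleftrightarrow> sqn z < q" and "C \<longleftrightarrow> sqn z + 1 < 2 * (p + q)"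
  have neq: "sqn z \<noteq> p" "sqn z \<noteq> q" "sqn z + 1 \<noteq> 2 * (p + q)"
    using z(2) sector_min_vecs unfolding generic_def p_def q_def e0[unfolded p_def q_def, symmetric] by auto
  have nA: "p < sqn z \<longleftrightarrow> \<not> A" and nB: "q < sqn z \<longleftrightarrow> \<not> B" and nC: "2 * (p + q) < sqn z + 1 \<longleftrightarrow> \<not> C"
    using neq by (auto simp: A_def B_def C_def)
  have ABC: "\<not> (A \<and> B \<and> C)" using three_discs_disjoint[of p q] by (auto simp: A_def B_def C_def N)
  have cover: "A \<or> B \<or> C"
    using three_discs_cover[OF pq] nA nB nC unfolding N by blast
  \<comment> \<open>Outside the unit disc, avoiding the large disc around \<open>eta\<close> entails
    avoiding the small one around \<open>eta / 2\<close>; this is why the dual pieces 4 to 6 list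
    only the former.\<close>
  have impl: "1 < sqn w \<Longrightarrow> 3 * edge_fn w (J_vec 1 0) < sqn w + 2 \<Longrightarrow> 3 * edge_fn w (J_vec 1 0) < 2 * sqn w + 1" by simp
  have V: "z \<in> V1 1 \<longleftrightarrow> A \<and> B" "z \<in> V1 2 \<longleftrightarrow> \<not> C \<and> \<not> A" "z \<in> V1 3 \<longleftrightarrow> \<not> C \<and> \<not> B"
    "z \<in> V1 4 \<longleftrightarrow> B \<and> C" "z \<in> V1 5 \<longleftrightarrow> A \<and> C" "z \<in> V1 6 \<longleftrightarrow> \<not> A \<and> \<not> B"
  proof -
    have "Im z > 0" "Im z < sqrt 3 * Re z" "Re z > 0" using Im ReIm Re pq by simp_all
    then show "z \<in> V1 1 \<longleftrightarrow> A \<and> B" "z \<in> V1 2 \<longleftrightarrow> \<not> C \<and> \<not> A" "z \<in> V1 3 \<longleftrightarrow> \<not> C \<and> \<not> B"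
      "z \<in> V1 4 \<longleftrightarrow> B \<and> C" "z \<in> V1 5 \<longleftrightarrow> A \<and> C" "z \<in> V1 6 \<longleftrightarrow> \<not> A \<and> \<not> B"
      unfolding V1_iff p_def[symmetric] q_def[symmetric] e0 nA nB nC A_def[symmetric] B_def[symmetric] C_def[symmetric]
      using z(3) by auto
  qed
  have W: "(z, w) \<in> nat_ext \<longleftrightarrow> 1 < sqn w \<and> 3 * edge_fn w (J_vec 1 0) < 2 * sqn w + 1 \<and>
    (A \<longrightarrow> 3 * edge_fn w (J_vec 0 1) < 2 * sqn w + 1) \<and> (B \<longrightarrow> 3 * edge_fn w (J_vec 1 (- 1)) < 2 * sqn w + 1) \<and>
    (C \<longrightarrow> 3 * edge_fn w (J_vec 1 0) < sqn w + 2)"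
    unfolding nat_ext_sector[OF z(1,2) pos] e0 p_def[symmetric] q_def[symmetric] A_def B_def C_def ..
  have "(\<exists>k\<in>{1..6}. z \<in> V1 k \<and> w \<in> V1_dual k) \<longleftrightarrow> (z \<in> V1 1 \<and> w \<in> V1_dual 1) \<or> (z \<in> V1 2 \<and> w \<in> V1_dual 2)
     \<or> (z \<in> V1 3 \<and> w \<in> V1_dual 3) \<or> (z \<in> V1 4 \<and> w \<in> V1_dual 4) \<or> (z \<in> V1 5 \<and> w \<in> V1_dual 5) \<or> (z \<in> V1 6 \<and> w \<in> V1_dual 6)"
    (is "?L \<longleftrightarrow> ?R")
  proof -
    have "{1..6::nat} = {1, 2, 3, 4, 5, 6}" by auto
    then show ?thesis by (simp del: One_nat_def)
  qed
  also have "\<dots> \<longleftrightarrow> (z, w) \<in> nat_ext"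
    unfolding V W V1_dual_iff using ABC cover impl
    by (cases A; cases B; cases C) (simp_all, auto)
  finally show ?thesis .
qed

section \<open>Reduction to one sector, and the shape of \<open>U\<close>\<close>

lemma sector_exists:
  obtains j z0 where "j \<le> 5" "z = zeta ^ j * z0" "0 \<le> edge_fn z0 (J_vec 0 1)" "0 \<le> edge_fn z0 (J_vec 1 (- 1))"
proof -
  define p q where "p = edge_fn z (J_vec 0 1)" and "q = edge_fn z (J_vec 1 (- 1))"
  have v: "edge_fn z (J_vec a c) = (a + c) * p + a * q" for a c
    unfolding p_def q_def by (subst edge_fn_J_vec_right, subst (2) edge_fn_J_vec_right) (simp add: algebra_simps)
  have rot: "edge_fn (z / zeta ^ j) e = edge_fn z (zeta ^ j * e)" for j e
    using edge_fn_rotate[OF cmod_zeta_power, of j "z / zeta ^ j" e] by simp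
  have zj: "zeta ^ 1 * J_vec a c = J_vec (- c) (a + c)" "zeta ^ 2 * J_vec a c = J_vec (- a - c) a"
    "zeta ^ 3 * J_vec a c = J_vec (- a) (- c)" "zeta ^ 4 * J_vec a c = J_vec c (- a - c)"
    "zeta ^ 5 * J_vec a c = J_vec (a + c) (- a)" for a c
    by (simp_all add: eval_nat_numeral mult.assoc zeta_mult_J_vec)
  have "\<exists>j\<le>5. 0 \<le> edge_fn (z / zeta ^ j) (J_vec 0 1) \<and> 0 \<le> edge_fn (z / zeta ^ j) (J_vec 1 (- 1))"
  proof -
    consider "0 \<le> p" "0 \<le> q" | "q \<le> 0" "0 \<le> p + q" | "0 \<le> p" "p + q \<le> 0" | "p \<le> 0" "q \<le> 0"
      | "0 \<le> q" "p + q \<le> 0" | "p \<le> 0" "0 \<le> p + q" by linarith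
    then show ?thesis
    proof cases
      case 1 then show ?thesis by (intro exI[of _ 0]) (simp add: p_def q_def)
    next
      case 2
      have "0 \<le> edge_fn (z / zeta ^ 1) (J_vec 0 1) \<and> 0 \<le> edge_fn (z / zeta ^ 1) (J_vec 1 (- 1))"
        unfolding rot zj v using 2 by simp
      then show ?thesis by (meson one_le_numeral)
    next
      case 3
      have "0 \<le> edge_fn (z / zeta ^ 2) (J_vec 0 1) \<and> 0 \<le> edge_fn (z / zeta ^ 2) (J_vec 1 (- 1))"
        unfolding rot zj v using 3 by simp
      then show ?thesis by (intro exI[of _ 2]) simp
    next
      case 4
      have "0 \<le> edge_fn (z / zeta ^ 3) (J_vec 0 1) \<and> 0 \<le> edge_fn (z / zeta ^ 3) (J_vec 1 (- 1))"
        unfolding rot zj v using 4 by simp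
      then show ?thesis by (intro exI[of _ 3]) simp
    next
      case 5
      have "0 \<le> edge_fn (z / zeta ^ 4) (J_vec 0 1) \<and> 0 \<le> edge_fn (z / zeta ^ 4) (J_vec 1 (- 1))"
        unfolding rot zj v using 5 by simp
      then show ?thesis by (intro exI[of _ 4]) simp
    next
      case 6
      have "0 \<le> edge_fn (z / zeta ^ 5) (J_vec 0 1) \<and> 0 \<le> edge_fn (z / zeta ^ 5) (J_vec 1 (- 1))"
        unfolding rot zj v using 6 by simp
      then show ?thesis by (intro exI[of _ 5]) simp
    qed
  qed
  then obtain j where "j \<le> 5" "0 \<le> edge_fn (z / zeta ^ j) (J_vec 0 1)" "0 \<le> edge_fn (z / zeta ^ j) (J_vec 1 (- 1))"
    by blast
  then show ?thesis by (intro that[of j "z / zeta ^ j"]) simp_all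
qed

lemma zeta_powers: "zeta ^ 2 = - cnj zeta" "zeta ^ 3 = - 1" "zeta ^ 4 = - zeta" "zeta ^ 5 = cnj zeta" "zeta ^ 6 = 1"
proof -
  show 2: "zeta ^ 2 = - cnj zeta" by (simp add: zeta_eq complex_eq_iff power2_eq_square)
  show 3: "zeta ^ 3 = - 1" by (simp add: zeta_eq complex_eq_iff eval_nat_numeral field_simps)
  have "zeta ^ 4 = zeta ^ 3 * zeta" "zeta ^ 5 = zeta ^ 3 * zeta ^ 2" "zeta ^ 6 = zeta ^ 3 * zeta ^ 3"
    by (simp_all add: eval_nat_numeral mult_ac)
  then show "zeta ^ 4 = - zeta" "zeta ^ 5 = cnj zeta" "zeta ^ 6 = 1" by (simp_all add: 2 3)
qed

text \<open>\<open>q\<close>, \<open>p\<close> and \<open>1 - p - q\<close> are the barycentric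
  coordinates of \<open>z0\<close> with respect to 1, \<open>zeta\<close> and 0.\<close>

lemma hexagon_subset_hull: "hexagon \<subseteq> convex hull {zeta ^ k | k. k \<le> 5}"
proof
  let ?C = "convex hull {zeta ^ k | k. k \<le> 5}"
  fix z assume z: "z \<in> hexagon"
  obtain j z0 where j: "j \<le> 5" "z = zeta ^ j * z0" and pos: "0 \<le> edge_fn z0 (J_vec 0 1)" "0 \<le> edge_fn z0 (J_vec 1 (- 1))"
    by (rule sector_exists)
  define p q where "p = edge_fn z0 (J_vec 0 1)" and "q = edge_fn z0 (J_vec 1 (- 1))"
  have z0: "z0 \<in> hexagon" using z j(2) hexagon_rotate by simp
  have lt: "p + q < 1" using z0 sector_min_vecs(1) sector_values(1)[of z0] by (auto simp: hexagon_def p_def q_def)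
  have eq: "z0 = of_real q + of_real p * zeta"
    by (simp add: complex_eq_iff p_def q_def edge_fn_def J_vec_def zeta_eq field_simps)
  have mem: "zeta ^ k \<in> ?C" if "k \<le> 5" for k by (rule hull_inc) (use that in blast)
  have zero: "0 \<in> ?C"
  proof -
    have "(1 / 2) *\<^sub>R zeta ^ 0 + (1 / 2) *\<^sub>R zeta ^ 3 \<in> ?C" by (intro convexD[OF convex_convex_hull] mem) auto
    then show ?thesis by (simp add: zeta_powers)
  qed
  have memS: "zeta ^ Suc j \<in> ?C"
  proof (cases "j = 5")
    case True
    then have "zeta ^ Suc j = zeta ^ 0" using zeta_powers(5) by simp
    then show ?thesis using mem[of 0] by simp
  next
    case False
    then show ?thesis using j(1) by (intro mem) simp
  qed
  have "z = q *\<^sub>R zeta ^ j + p *\<^sub>R zeta ^ Suc j + (1 - p - q) *\<^sub>R 0"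
    by (simp add: j(2) eq scaleR_conv_of_real algebra_simps)
  moreover have "\<dots> \<in> ?C"
  proof (cases "p + q = 0")
    case True
    then have "p = 0" "q = 0" using pos by (auto simp: p_def q_def)
    then show ?thesis using zero by simp
  next
    case False
    then have s: "0 < p + q" using pos by (simp add: p_def q_def)
    have 1: "(q / (p + q)) *\<^sub>R zeta ^ j + (p / (p + q)) *\<^sub>R zeta ^ Suc j \<in> ?C"
      using pos s by (intro convexD[OF convex_convex_hull] mem[OF j(1)] memS) (auto simp: p_def q_def add_divide_distrib[symmetric])
    have "(p + q) *\<^sub>R ((q / (p + q)) *\<^sub>R zeta ^ j + (p / (p + q)) *\<^sub>R zeta ^ Suc j) + (1 - (p + q)) *\<^sub>R 0 \<in> ?C"
      using s lt by (intro convexD[OF convex_convex_hull] 1 zero) auto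
    then show ?thesis using s by (simp add: scaleR_add_right)
  qed
  ultimately show "z \<in> ?C" by simp
qed

lemma open_hexagon: "open hexagon"
proof -
  have eq: "hexagon = (\<Inter>e\<in>min_vecs. {z. edge_fn z e < 1})" by (auto simp: hexagon_def)
  have "open {z. edge_fn z e < 1}" for e
    unfolding edge_fn_def by (intro open_Collect_less continuous_intros)
  then show ?thesis unfolding eq by (intro open_INT finite_min_vecs ballI)
qed

lemma hexagon_subset_U: "hexagon \<subseteq> U"
  using interior_maximal[OF hexagon_subset_hull open_hexagon] by (auto simp: U_def)

lemma convex_cl_hexagon: "convex cl_hexagon"
proof (rule convexI)
  fix x y :: complex and u v :: real
  assume xy: "x \<in> cl_hexagon" "y \<in> cl_hexagon" and uv: "0 \<le> u" "0 \<le> v" "u + v = 1"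
  have "edge_fn (u *\<^sub>R x + v *\<^sub>R y) e \<le> 1" if "e \<in> min_vecs" for e
  proof -
    have "u * edge_fn x e + v * edge_fn y e \<le> u * 1 + v * 1"
      using xy that uv by (intro add_mono mult_left_mono) (auto simp: cl_hexagon_def)
    then show ?thesis using uv by (simp add: edge_fn_add scaleR_conv_of_real)
  qed
  then show "u *\<^sub>R x + v *\<^sub>R y \<in> cl_hexagon" by (simp add: cl_hexagon_def)
qed

lemma zeta_power_cl_hexagon: "zeta ^ k \<in> cl_hexagon"
proof -
  have "edge_fn (zeta ^ k) e \<le> 1" if e: "e \<in> min_vecs" for e
  proof -
    obtain d where d: "d \<in> min_vecs" "e = zeta ^ k * d" using zeta_power_surj[OF e] by blast
    have "edge_fn (zeta ^ k) e = edge_fn 1 d"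
      using edge_fn_rotate[OF cmod_zeta_power, of k 1 d] by (simp add: d(2))
    also have "\<dots> \<le> 1" using d(1) by (auto simp: min_vecs_def edge_fn_def J_vec_def)
    finally show ?thesis .
  qed
  then show ?thesis by (simp add: cl_hexagon_def)
qed

lemma U_subset_cl_hexagon: "U \<subseteq> cl_hexagon"
proof -
  have pts: "1 \<in> cl_hexagon" "- 1 \<in> cl_hexagon" "zeta \<in> cl_hexagon" "- zeta \<in> cl_hexagon" "cnj zeta \<in> cl_hexagon" "- cnj zeta \<in> cl_hexagon"
    using zeta_power_cl_hexagon[of 0] zeta_power_cl_hexagon[of 3] zeta_power_cl_hexagon[of 1]
      zeta_power_cl_hexagon[of 4] zeta_power_cl_hexagon[of 5] zeta_power_cl_hexagon[of 2]
    by (simp_all add: zeta_powers)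
  have seg: "of_real t * x + of_real (1 - t) * y \<in> cl_hexagon"
    if "x \<in> cl_hexagon" "y \<in> cl_hexagon" "0 < t \<and> t < 1" for x y t
    using convexD[OF convex_cl_hexagon that(1,2), of t "1 - t"] that(3) by (simp add: scaleR_conv_of_real)
  have "convex hull {zeta ^ k | k. k \<le> 5} \<subseteq> cl_hexagon"
    by (rule hull_minimal) (use zeta_power_cl_hexagon convex_cl_hexagon in auto)
  then have "interior (convex hull {zeta ^ k | k. k \<le> 5}) \<subseteq> cl_hexagon"
    using interior_subset by blast
  moreover have "{of_real t * zeta + of_real (1 - t) * (- cnj zeta) | t. 0 < t \<and> t < 1} \<subseteq> cl_hexagon"
    using seg[OF pts(3,6)] by blast
  moreover have "{of_real t * (- zeta) + of_real (1 - t) * (- 1) | t. 0 < t \<and> t < 1} \<subseteq> cl_hexagon"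
    using seg[OF pts(4,2)] by blast
  moreover have "{of_real t + of_real (1 - t) * cnj zeta | t. 0 < t \<and> t < 1} \<subseteq> cl_hexagon"
    using seg[OF pts(1,5)] by auto
  ultimately show ?thesis using pts by (auto simp: U_def)
qed

text \<open>A point in an open hexagon of the tiling lies in no other closed one, hence in no other
  translate of \<open>U\<close>; this determines the description operator away from the
  edges.\<close>

lemma nearest_J_eqI:
  assumes "b \<in> ideal_J" "z - b \<in> hexagon"
  shows "nearest_J z = b"
  unfolding nearest_J_def
proof (rule the_equality)
  show "b \<in> ideal_J \<and> (\<exists>u\<in>U. z = b + u)"
    using assms hexagon_subset_U by (auto intro!: bexI[of _ "z - b"])
next
  fix a assume a: "a \<in> ideal_J \<and> (\<exists>u\<in>U. z = a + u)"
  then have "(z - b) - (a - b) \<in> cl_hexagon" using U_subset_cl_hexagon by auto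
  from hexagon_translate_disjoint[OF assms(2) this] a assms(1) show "a = b" by (simp add: ideal_J_diff)
qed

lemma U_hat_iff_nat_ext:
  assumes z: "z \<in> hexagon" "generic z"
  shows "(z, w) \<in> U_hat \<longleftrightarrow> (z, w) \<in> nat_ext"
proof
  assume "(z, w) \<in> U_hat"
  then obtain k l where kl: "k \<in> {1..6}" "l \<in> {1..6}" "z \<in> V k l" "w \<in> V_dual k l"
    by (auto simp: U_hat_def)
  then obtain z0 w0 where zw: "z = zeta ^ (l - 1) * z0" "w = zeta ^ (l - 1) * w0" "z0 \<in> V1 k" "w0 \<in> V1_dual k"
    by (auto simp: V_def V_dual_def)
  have z0: "z0 \<in> hexagon" "generic z0" using z zw(1) hexagon_rotate generic_rotate by auto
  have "(\<exists>k\<in>{1..6}. z0 \<in> V1 k \<and> w0 \<in> V1_dual k)" using kl zw by blast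
  then have "(z0, w0) \<in> nat_ext"
    using V1_dual_nat_ext[OF z0 _ V1_sector[OF zw(3) kl(1) z0(1)]] z0(1) hexagon_subset_U by blast
  then show "(z, w) \<in> nat_ext" unfolding zw(1,2) by (rule nat_ext_rotate)
next
  assume W: "(z, w) \<in> nat_ext"
  obtain j z0 where j: "j \<le> 5" "z = zeta ^ j * z0" and pos: "0 \<le> edge_fn z0 (J_vec 0 1)" "0 \<le> edge_fn z0 (J_vec 1 (- 1))"
    by (rule sector_exists)
  \<comment> \<open>As \<open>zeta ^ 6 = 1\<close>, the exponent \<open>6 - j\<close> undoes the
    rotation by \<open>zeta ^ j\<close>.\<close>
  define w0 where "w0 = zeta ^ (6 - j) * w"
  have z0: "z0 \<in> hexagon" "generic z0" using z j(2) hexagon_rotate generic_rotate by auto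
  have j6: "zeta ^ (6 - j) * zeta ^ j = 1" using j(1) zeta_powers(5) by (simp add: power_add[symmetric])
  have "(zeta ^ (6 - j) * z, w0) \<in> nat_ext" unfolding w0_def by (rule nat_ext_rotate[OF W])
  then have W0: "(z0, w0) \<in> nat_ext" using j6 by (simp add: j(2) mult.assoc[symmetric])
  have w: "w = zeta ^ j * w0" using j6 by (simp add: w0_def mult.assoc[symmetric] mult.commute)
  have pos': "0 < edge_fn z0 (J_vec 0 1)" "0 < edge_fn z0 (J_vec 1 (- 1))"
    using pos z0(2) sector_min_vecs unfolding generic_def by (force simp: less_le)+
  have "z0 \<in> U" using z0(1) hexagon_subset_U by blast
  then obtain k where k: "k \<in> {1..6}" "z0 \<in> V1 k" "w0 \<in> V1_dual k"
    using V1_dual_nat_ext[OF z0 _ pos', of w0] W0 by blast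
  have "z \<in> V k (Suc j)" "w \<in> V_dual k (Suc j)" using k by (auto simp: V_def V_dual_def j(2) w)
  then show "(z, w) \<in> U_hat" unfolding U_hat_def using k(1) j(1) by force
qed

section \<open>Integrals near a cusp\<close>

lemma nn_integral_even_le:
  fixes f :: "real \<Rightarrow> ennreal"
  assumes [measurable]: "f \<in> borel_measurable borel" and even: "\<And>x. f (- x) = f x"
  shows "(\<integral>\<^sup>+x. f x \<partial>lborel) \<le> 2 * (\<integral>\<^sup>+x. f x * indicator {0..} x \<partial>lborel)"
proof -
  have "(\<integral>\<^sup>+x. f x \<partial>lborel) \<le> (\<integral>\<^sup>+x. f x * indicator {0..} x + f x * indicator {..0} x \<partial>lborel)"
    by (intro nn_integral_mono) (auto simp: indicator_def)
  also have "\<dots> = (\<integral>\<^sup>+x. f x * indicator {0..} x \<partial>lborel) + (\<integral>\<^sup>+x. f x * indicator {..0} x \<partial>lborel)"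
    by (intro nn_integral_add) auto
  also have "(\<integral>\<^sup>+x. f x * indicator {..0} x \<partial>lborel) = (\<integral>\<^sup>+x. f x * indicator {0..} x \<partial>lborel)"
    by (subst nn_integral_real_affine[where c = "- 1" and t = 0])
      (auto intro!: nn_integral_cong simp: even indicator_def)
  finally show ?thesis by (simp add: mult_2)
qed

lemma nn_integral_inverse_quadratic:
  assumes s: "0 < s"
  shows "(\<integral>\<^sup>+x. ennreal (1 / (s\<^sup>2 + (x - c)\<^sup>2)) \<partial>lborel) \<le> ennreal (pi / s)"
proof -
  have "(\<integral>\<^sup>+x. ennreal (1 / (s\<^sup>2 + (x - c)\<^sup>2)) \<partial>lborel) = (\<integral>\<^sup>+x. ennreal (1 / (s\<^sup>2 + x\<^sup>2)) \<partial>lborel)"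
    by (subst nn_integral_real_affine[where c = 1 and t = c]) auto
  also have "\<dots> \<le> 2 * (\<integral>\<^sup>+x. ennreal (1 / (s\<^sup>2 + x\<^sup>2)) * indicator {0..} x \<partial>lborel)"
    by (rule nn_integral_even_le) auto
  also have "(\<integral>\<^sup>+x. ennreal (1 / (s\<^sup>2 + x\<^sup>2)) * indicator {0..} x \<partial>lborel) = ennreal (pi / 2 / s - arctan (0 / s) / s)"
  proof (rule nn_integral_FTC_atLeast)
    fix x :: real
    have "s\<^sup>2 + x\<^sup>2 > 0" using s by (simp add: add_pos_nonneg)
    moreover have "1 + (x / s)\<^sup>2 = (s\<^sup>2 + x\<^sup>2) / s\<^sup>2" using s by (simp add: field_simps)
    ultimately have "inverse (1 + (x / s)\<^sup>2) * (1 / s) / s = 1 / (s\<^sup>2 + x\<^sup>2)"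
      using s by (simp add: power2_eq_square)
    moreover have "DERIV (\<lambda>x. arctan (x / s) / s) x :> inverse (1 + (x / s)\<^sup>2) * (1 / s) / s"
      using s by (auto intro!: derivative_eq_intros)
    ultimately show "DERIV (\<lambda>x. arctan (x / s) / s) x :> 1 / (s\<^sup>2 + x\<^sup>2)" by simp
    have "((\<lambda>x. arctan (x / s)) \<longlongrightarrow> pi / 2) at_top"
      by (rule filterlim_compose[OF tendsto_arctan_at_top])
        (use s in \<open>auto intro!: filterlim_tendsto_pos_mult_at_top[OF tendsto_const _ filterlim_ident, of "1 / s", simplified]\<close>)
    then show "((\<lambda>x. arctan (x / s) / s) \<longlongrightarrow> pi / 2 / s) at_top"
      by (intro tendsto_divide tendsto_const) (use s in auto)
  qed (use s in auto)
  also have "2 * ennreal (pi / 2 / s - arctan (0 / s) / s) = ennreal (pi / s)"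
    by (simp add: ennreal_mult'[symmetric] flip: ennreal_numeral)
  finally show ?thesis .
qed

lemma lborel_complex_pair: "distr (lborel \<Otimes>\<^sub>M lborel) borel (\<lambda>(x, y). Complex x y) = lborel"
proof (rule lborel_eqI[symmetric])
  fix l u :: complex
  assume le: "\<And>b. b \<in> Basis \<Longrightarrow> l \<bullet> b \<le> u \<bullet> b"
  have [measurable]: "(\<lambda>(x, y). Complex x y) \<in> borel_measurable (lborel \<Otimes>\<^sub>M lborel)"
    by (simp add: borel_measurable_complex_iff split_beta)
  have "(\<lambda>(x, y). Complex x y) -` box l u = box (Re l) (Re u) \<times> box (Im l) (Im u)"
    by (auto simp: box_def Basis_complex_def inner_complex_def)
  then have "emeasure (distr (lborel \<Otimes>\<^sub>M lborel) borel (\<lambda>(x, y). Complex x y)) (box l u)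
      = emeasure (lborel \<Otimes>\<^sub>M lborel) (box (Re l) (Re u) \<times> box (Im l) (Im u))"
    by (subst emeasure_distr) (auto simp: space_pair_measure)
  also have "\<dots> = ennreal (Re u - Re l) * ennreal (Im u - Im l)"
    using le[of 1] le[of \<i>]
    by (subst lborel.emeasure_pair_measure_Times) (auto simp: Basis_complex_def inner_complex_def)
  also have "\<dots> = ennreal (\<Prod>b\<in>Basis. (u - l) \<bullet> b)"
    using le[of 1] le[of \<i>] by (auto simp: Basis_complex_def inner_complex_def ennreal_mult)
  finally show "emeasure (distr (lborel \<Otimes>\<^sub>M lborel) borel (\<lambda>(x, y). Complex x y)) (box l u) = (\<Prod>b\<in>Basis. (u - l) \<bullet> b)" .
qed simp

lemma nn_integral_complex_iterated:
  fixes f :: "complex \<Rightarrow> ennreal"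
  assumes [measurable]: "f \<in> borel_measurable borel"
  shows "(\<integral>\<^sup>+z. f z \<partial>lborel) = (\<integral>\<^sup>+x. \<integral>\<^sup>+y. f (Complex x y) \<partial>lborel \<partial>lborel)"
proof -
  have [measurable]: "(\<lambda>(x, y). Complex x y) \<in> borel_measurable (lborel \<Otimes>\<^sub>M lborel)"
    by (simp add: borel_measurable_complex_iff split_beta)
  have "(\<integral>\<^sup>+z. f z \<partial>lborel) = (\<integral>\<^sup>+z. f z \<partial>distr (lborel \<Otimes>\<^sub>M lborel) borel (\<lambda>(x, y). Complex x y))"
    by (simp only: lborel_complex_pair)
  also have "\<dots> = (\<integral>\<^sup>+p. f (case p of (x, y) \<Rightarrow> Complex x y) \<partial>(lborel \<Otimes>\<^sub>M lborel))"
    by (rule nn_integral_distr) auto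
  also have "\<dots> = (\<integral>\<^sup>+x. \<integral>\<^sup>+y. f (Complex x y) \<partial>lborel \<partial>lborel)"
    by (subst lborel.nn_integral_fst[symmetric]) auto
  finally show ?thesis .
qed

lemma nn_integral_complex_product_le:
  fixes f :: "complex \<Rightarrow> ennreal"
  assumes [measurable]: "f \<in> borel_measurable borel" "g \<in> borel_measurable borel" "h \<in> borel_measurable borel"
    and le: "\<And>x y. f (Complex x y) \<le> g x * h y"
  shows "(\<integral>\<^sup>+z. f z \<partial>lborel) \<le> (\<integral>\<^sup>+x. g x \<partial>lborel) * (\<integral>\<^sup>+y. h y \<partial>lborel)"
proof -
  have "(\<integral>\<^sup>+z. f z \<partial>lborel) \<le> (\<integral>\<^sup>+x. \<integral>\<^sup>+y. g x * h y \<partial>lborel \<partial>lborel)"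
    unfolding nn_integral_complex_iterated[OF assms(1)] by (intro nn_integral_mono le)
  also have "\<dots> = (\<integral>\<^sup>+x. g x \<partial>lborel) * (\<integral>\<^sup>+y. h y \<partial>lborel)"
    by (simp add: nn_integral_cmult nn_integral_multc)
  finally show ?thesis .
qed

text \<open>\<open>(s^2 + a + b)^2 \<ge> (s^2 + a) * (s^2 + b)\<close> bounds the integral by a
  product of two arctangent integrals, each at most \<open>pi / s\<close>.\<close>

lemma nn_integral_inverse_quartic:
  assumes s: "0 < s"
  shows "(\<integral>\<^sup>+w. ennreal (1 / (s\<^sup>2 + (cmod (w - c))\<^sup>2)\<^sup>2) \<partial>lborel) \<le> ennreal (pi\<^sup>2 / s\<^sup>2)"
proof -
  have "(\<integral>\<^sup>+w. ennreal (1 / (s\<^sup>2 + (cmod (w - c))\<^sup>2)\<^sup>2) \<partial>lborel)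
      \<le> (\<integral>\<^sup>+x. ennreal (1 / (s\<^sup>2 + (x - Re c)\<^sup>2)) \<partial>lborel) * (\<integral>\<^sup>+y. ennreal (1 / (s\<^sup>2 + (y - Im c)\<^sup>2)) \<partial>lborel)"
  proof (rule nn_integral_complex_product_le)
    fix x y :: real
    define a b where "a = (x - Re c)\<^sup>2" and "b = (y - Im c)\<^sup>2"
    have ab: "0 \<le> a" "0 \<le> b" by (simp_all add: a_def b_def)
    have s2: "0 < s\<^sup>2" using s by simp
    have "(s\<^sup>2 + a) * (s\<^sup>2 + b) \<le> (s\<^sup>2 + (a + b)) * (s\<^sup>2 + (a + b))"
      using ab s2 by (intro mult_mono) auto
    then have "1 / (s\<^sup>2 + (a + b))\<^sup>2 \<le> 1 / ((s\<^sup>2 + a) * (s\<^sup>2 + b))"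
      using ab s2 by (intro divide_left_mono) (auto simp: power2_eq_square intro!: mult_pos_pos add_pos_nonneg)
    moreover have "(cmod (Complex x y - c))\<^sup>2 = a + b" by (simp add: cmod_power2 a_def b_def)
    ultimately show "ennreal (1 / (s\<^sup>2 + (cmod (Complex x y - c))\<^sup>2)\<^sup>2)
        \<le> ennreal (1 / (s\<^sup>2 + (x - Re c)\<^sup>2)) * ennreal (1 / (s\<^sup>2 + (y - Im c)\<^sup>2))"
      using ab s2 by (simp add: ennreal_mult'[symmetric] a_def[symmetric] b_def[symmetric])
  qed auto
  also have "\<dots> \<le> ennreal (pi / s) * ennreal (pi / s)"
    by (intro mult_mono nn_integral_inverse_quadratic s) auto
  also have "\<dots> = ennreal (pi\<^sup>2 / s\<^sup>2)"
    using s by (simp add: ennreal_mult'[symmetric] power2_eq_square)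
  finally show ?thesis .
qed

text \<open>Since the squared modulus dominates the product of the coordinates' moduli,
  \<open>1 / cmod z\<close> is at most a product of two inverse square roots, each integrable near
  0.\<close>

lemma nn_integral_inverse_cmod_finite:
  "(\<integral>\<^sup>+z. ennreal (1 / cmod z) * indicator {z. cmod z \<le> 1} z \<partial>lborel) < \<infinity>"
proof -
  \<comment> \<open>The value infinity at 0 makes the product bound hold on the axes as
    well.\<close>
  define g where "g x = (if x = 0 then \<infinity> else ennreal (\<bar>x\<bar> powr (- 1 / 2))) * indicator {- 1..1} x" for x :: real
  have [measurable]: "g \<in> borel_measurable borel" unfolding g_def by measurable
  have "(\<integral>\<^sup>+x. g x \<partial>lborel) \<le> 2 * (\<integral>\<^sup>+x. g x * indicator {0..} x \<partial>lborel)"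
    by (rule nn_integral_even_le) (auto simp: g_def indicator_def)
  also have "(\<integral>\<^sup>+x. g x * indicator {0..} x \<partial>lborel) = (\<integral>\<^sup>+x. ennreal (x powr (- 1 / 2)) * indicator {0..1} x \<partial>lborel)"
  proof (rule nn_integral_cong_AE)
    show "AE x in lborel. g x * indicator {0..} x = ennreal (x powr (- 1 / 2)) * indicator {0..1} x"
      using AE_lborel_singleton[of 0]
    proof eventually_elim
      case (elim x)
      then show ?case by (cases "0 \<le> x"; cases "x \<le> 1") (simp_all add: g_def)
    qed
  qed
  also have "\<dots> = ennreal (1 powr (- 1 / 2 + 1) / (- 1 / 2 + 1))"
    by (rule nn_integral_has_integral_lebesgue'[OF _ has_integral_powr_from_0]) auto
  finally have g: "(\<integral>\<^sup>+x. g x \<partial>lborel) < \<infinity>"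
    by (rule le_less_trans) (simp add: ennreal_mult_less_top)
  have "(\<integral>\<^sup>+z. ennreal (1 / cmod z) * indicator {z. cmod z \<le> 1} z \<partial>lborel) \<le> (\<integral>\<^sup>+x. g x \<partial>lborel) * (\<integral>\<^sup>+y. g y \<partial>lborel)"
  proof (rule nn_integral_complex_product_le)
    fix x y :: real
    show "ennreal (1 / cmod (Complex x y)) * indicator {z. cmod z \<le> 1} (Complex x y) \<le> g x * g y"
    proof (cases "cmod (Complex x y) \<le> 1 \<and> x \<noteq> 0 \<and> y \<noteq> 0")
      case True
      have xy: "\<bar>x\<bar> \<le> 1" "\<bar>y\<bar> \<le> 1"
        using True abs_Re_le_cmod[of "Complex x y"] abs_Im_le_cmod[of "Complex x y"] by auto
      have "\<bar>x\<bar> * \<bar>y\<bar> \<le> x\<^sup>2 + y\<^sup>2"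
        using zero_le_power2[of "\<bar>x\<bar> - \<bar>y\<bar>"] mult_nonneg_nonneg[of "\<bar>x\<bar>" "\<bar>y\<bar>"]
        unfolding power2_diff power2_abs by linarith
      then have "sqrt (\<bar>x\<bar> * \<bar>y\<bar>) \<le> cmod (Complex x y)" by (simp add: complex_norm)
      then have "1 / cmod (Complex x y) \<le> 1 / sqrt (\<bar>x\<bar> * \<bar>y\<bar>)"
        using True by (intro divide_left_mono) (auto simp: zero_less_mult_iff complex_eq_iff)
      also have "\<dots> = \<bar>x\<bar> powr (- 1 / 2) * \<bar>y\<bar> powr (- 1 / 2)"
        using True by (simp add: powr_minus_divide powr_half_sqrt real_sqrt_mult)
      finally show ?thesis using True xy
        by (simp add: g_def indicator_def ennreal_mult'[symmetric] abs_le_iff)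
    next
      case False
      show ?thesis
      proof (cases "cmod (Complex x y) \<le> 1 \<and> (x \<noteq> 0 \<or> y \<noteq> 0)")
        case True
        have "\<bar>x\<bar> \<le> 1" "\<bar>y\<bar> \<le> 1"
          using True abs_Re_le_cmod[of "Complex x y"] abs_Im_le_cmod[of "Complex x y"] by auto
        then have "g x * g y = \<infinity>" using False True
          by (auto simp: g_def indicator_def abs_le_iff ennreal_mult_top ennreal_top_mult)
        then show ?thesis by simp
      qed (auto simp: indicator_def complex_norm)
    qed
  qed auto
  also have "\<dots> < \<infinity>" using g by (simp add: ennreal_mult_less_top)
  finally show ?thesis .
qed

text \<open>The region outside the two circles of radius 1/2 that touch the real axis, and each
  other, at 0; a double cusp along the axis, truncated at \<open>R\<close>.\<close>

definition cusp :: "real \<Rightarrow> complex set" where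
  "cusp R = {s. \<bar>Im s\<bar> \<le> (cmod s)\<^sup>2 \<and> cmod s \<le> R}"

lemma cusp_measurable [measurable]: "cusp R \<in> sets borel"
  unfolding cusp_def by measurable

text \<open>Near the axis the cusp has height at most \<open>4 * x^2\<close> over the abscissa
  \<open>x\<close>, which cancels the singularity \<open>1 / x^2\<close>; where the imaginary part
  exceeds 1/2 in modulus, the integrand is at most 4.\<close>

lemma nn_integral_cusp_finite:
  "(\<integral>\<^sup>+s. ennreal (1 / (cmod s)\<^sup>2) * indicator (cusp R) s \<partial>lborel) < \<infinity>"
proof -
  define f where "f s = ennreal (1 / (Re s)\<^sup>2) * indicator {s. \<bar>Re s\<bar> \<le> R \<and> \<bar>Im s\<bar> \<le> 2 * (Re s)\<^sup>2} s" for s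
  have [measurable]: "f \<in> borel_measurable borel" unfolding f_def by measurable
  have "(\<integral>\<^sup>+s. f s \<partial>lborel) \<le> (\<integral>\<^sup>+x. 4 * indicator {- R..R} x \<partial>lborel)"
    unfolding nn_integral_complex_iterated[OF \<open>f \<in> borel_measurable borel\<close>]
  proof (rule nn_integral_mono)
    fix x :: real
    have "(\<integral>\<^sup>+y. f (Complex x y) \<partial>lborel) = (\<integral>\<^sup>+y. ennreal (1 / x\<^sup>2) * indicator {- R..R} x * indicator {- 2 * x\<^sup>2..2 * x\<^sup>2} y \<partial>lborel)"
      by (intro nn_integral_cong) (auto simp: f_def indicator_def abs_le_iff)
    also have "\<dots> = ennreal (1 / x\<^sup>2) * indicator {- R..R} x * emeasure lborel {- 2 * x\<^sup>2..2 * x\<^sup>2}"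
      by (subst nn_integral_cmult_indicator) auto
    also have "\<dots> \<le> 4 * indicator {- R..R} x"
      by (cases "x = 0") (auto simp: indicator_def ennreal_mult'[symmetric] simp flip: ennreal_numeral)
    finally show "(\<integral>\<^sup>+y. f (Complex x y) \<partial>lborel) \<le> 4 * indicator {- R..R} x" .
  qed
  also have "\<dots> < \<infinity>" by (simp add: nn_integral_cmult ennreal_mult_less_top emeasure_lborel_Icc_eq)
  finally have f: "(\<integral>\<^sup>+s. f s \<partial>lborel) < \<infinity>" .
  have "(\<integral>\<^sup>+s. ennreal (1 / (cmod s)\<^sup>2) * indicator (cusp R) s \<partial>lborel)
     \<le> (\<integral>\<^sup>+s. f s + 4 * indicator (cball 0 R) s \<partial>lborel)"
  proof (rule nn_integral_mono)
    fix s :: complex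
    show "ennreal (1 / (cmod s)\<^sup>2) * indicator (cusp R) s \<le> f s + 4 * indicator (cball 0 R) s"
    proof (cases "s \<in> cusp R \<and> s \<noteq> 0")
      case True
      then have s: "\<bar>Im s\<bar> \<le> (Re s)\<^sup>2 + (Im s)\<^sup>2" "cmod s \<le> R" "0 < (cmod s)\<^sup>2"
        by (auto simp: cusp_def cmod_power2[symmetric])
      show ?thesis
      proof (cases "\<bar>Im s\<bar> \<le> 1 / 2")
        case small: True
        then have "(Im s)\<^sup>2 \<le> \<bar>Im s\<bar> / 2"
          using mult_left_mono[OF small, of "\<bar>Im s\<bar>"] by (simp add: power2_eq_square)
        then have im: "\<bar>Im s\<bar> \<le> 2 * (Re s)\<^sup>2" using s(1) by linarith
        then have "Re s \<noteq> 0" using True by (auto simp: complex_eq_iff)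
        then have "1 / (cmod s)\<^sup>2 \<le> 1 / (Re s)\<^sup>2"
          by (intro divide_left_mono) (auto simp: cmod_power2 zero_less_mult_iff add_pos_nonneg)
        moreover have "\<bar>Re s\<bar> \<le> R" using abs_Re_le_cmod[of s] s(2) by simp
        ultimately have "ennreal (1 / (cmod s)\<^sup>2) \<le> f s"
          using im by (simp add: f_def ennreal_leI)
        then show ?thesis using True by (auto simp: indicator_def intro: add_increasing2)
      next
        case False
        then have "1 / 2 \<le> cmod s" using abs_Im_le_cmod[of s] by linarith
        then have "(1 / 2)\<^sup>2 \<le> (cmod s)\<^sup>2" by (intro power_mono) auto
        then have "1 / (cmod s)\<^sup>2 \<le> 4" using s(3) by (simp add: field_simps power2_eq_square)
        then have "ennreal (1 / (cmod s)\<^sup>2) \<le> 4" by (metis ennreal_leI ennreal_numeral)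
        then show ?thesis using s(2) by (auto simp: indicator_def intro: add_increasing)
      qed
    qed (auto simp: indicator_def)
  qed
  also have "\<dots> = (\<integral>\<^sup>+s. f s \<partial>lborel) + 4 * emeasure lborel (cball (0::complex) R)"
  proof -
    have [measurable]: "cball (0::complex) R \<in> sets borel" by (rule borel_closed) simp
    have "(\<integral>\<^sup>+s. 4 * indicator (cball (0::complex) R) s \<partial>lborel) = 4 * emeasure lborel (cball (0::complex) R)"
      by (rule nn_integral_cmult_indicator) simp
    then show ?thesis by (subst nn_integral_add) auto
  qed
  also have "\<dots> < \<infinity>"
    using f emeasure_bounded_finite[OF bounded_cball[of "0::complex" R]] by (simp add: ennreal_mult_less_top)
  finally show ?thesis .
qed

text \<open>Invariance under orthogonal maps is carried over from \<open>real^2\<close>; by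
  \<open>lborel_eqI\<close> it suffices to test boxes, whose preimages are images under the inverse
  map.\<close>

lemma lborel_orthogonal_complex:
  fixes f :: "complex \<Rightarrow> complex"
  assumes f: "orthogonal_transformation f"
  shows "distr lborel borel f = lborel"
proof (rule lborel_eqI[symmetric])
  fix l u :: complex
  assume le: "\<And>b. b \<in> Basis \<Longrightarrow> l \<bullet> b \<le> u \<bullet> b"
  define g where "g = inv f"
  have gf: "g (f z) = z" and fg: "f (g z) = z" for z
    using orthogonal_transformation_bij[OF f] by (simp_all add: g_def bij_def surj_f_inv_f)
  have g: "orthogonal_transformation g" unfolding g_def by (rule orthogonal_transformation_inv[OF f])
  define h where "h v = complex_to_vec2 (g (vec2_to_complex v))" for v
  have nv: "norm (complex_to_vec2 z) = cmod z" for z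
    by (simp add: complex_to_vec2_def cmod_def norm_vec_def L2_set_def sum_2)
  have nv': "cmod (vec2_to_complex v) = norm v" for v using nv[of "vec2_to_complex v"] by simp
  have lin: "linear h"
    unfolding h_def[abs_def] using bounded_linear_complex_to_vec2 bounded_linear_vec2_to_complex g
    by (intro linear_compose[of vec2_to_complex "\<lambda>z. complex_to_vec2 (g z)", unfolded o_def]
        linear_compose[of g complex_to_vec2, unfolded o_def])
      (auto simp: bounded_linear.linear orthogonal_transformation_linear)
  have h: "orthogonal_transformation h"
    unfolding orthogonal_transformation using lin g by (simp add: h_def nv nv' orthogonal_transformation_norm)
  let ?B = "box (complex_to_vec2 l) (complex_to_vec2 u)"
  have fm [measurable]: "f \<in> borel_measurable borel"
    using orthogonal_transformation_linear[OF f] by (intro borel_measurable_continuous_onI linear_continuous_on linear_conv_bounded_linear[THEN iffD1])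
  have pre: "vec2_to_complex -` box l u = ?B"
    by (auto simp: box_def Basis_complex_def Basis_vec2 inner_complex_def vec2_to_complex_def
        complex_to_vec2_def inner_axis)
  have pre2: "vec2_to_complex -` (f -` box l u) = h ` ?B"
  proof -
    have "v \<in> h ` ?B \<longleftrightarrow> f (vec2_to_complex v) \<in> box l u" for v
    proof -
      have "v \<in> h ` ?B \<longleftrightarrow> complex_to_vec2 (f (vec2_to_complex v)) \<in> ?B"
        unfolding h_def image_iff by (metis gf fg vec2_complex_inverse)
      also have "\<dots> \<longleftrightarrow> f (vec2_to_complex v) \<in> box l u" unfolding pre[symmetric] by simp
      finally show ?thesis .
    qed
    then show ?thesis by auto
  qed
  have fB: "f -` box l u \<in> sets borel" using measurable_sets[OF fm, of "box l u"] by simp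
  have "emeasure (distr lborel borel f) (box l u) = emeasure lborel (f -` box l u)"
    by (subst emeasure_distr) auto
  also have "\<dots> = emeasure (distr lborel borel vec2_to_complex) (f -` box l u)"
    by (simp only: lborel_complex_eq_distr)
  also have "\<dots> = emeasure lborel (h ` ?B)"
    using fB by (subst emeasure_distr) (auto simp: pre2)
  also have "\<dots> = emeasure lebesgue (h ` ?B)"
    using measurable_sets[OF borel_measurable_vec2_complex(1) fB] by (simp add: pre2)
  also have "\<dots> = emeasure lebesgue ?B"
    using measure_orthogonal_image[OF h, of ?B] measurable_orthogonal_image[OF h, of ?B]
      emeasure_eq_measure2[of "h ` ?B" lebesgue] emeasure_eq_measure2[of ?B lebesgue] by simp
  also have "\<dots> = emeasure (distr lborel borel vec2_to_complex) (box l u)"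
    by (subst emeasure_distr) (auto simp: pre)
  also have "\<dots> = ennreal (\<Prod>b\<in>Basis. (u - l) \<bullet> b)"
    unfolding lborel_complex_eq_distr using le by (subst emeasure_lborel_box) auto
  finally show "emeasure (distr lborel borel f) (box l u) = (\<Prod>b\<in>Basis. (u - l) \<bullet> b)" .
qed simp

lemma lborel_rotate: "cmod c = 1 \<Longrightarrow> distr lborel borel (\<lambda>z. c * z) = lborel"
  by (rule lborel_orthogonal_complex)
    (auto simp: orthogonal_transformation norm_mult intro: linearI simp: algebra_simps)

lemma nn_integral_rotated_cusp_finite:
  assumes "cmod u = 1"
  shows "(\<integral>\<^sup>+z. ennreal (1 / (cmod (z - 1))\<^sup>2) * indicator (cusp R) (u * (z - 1)) \<partial>lborel) < \<infinity>"
proof -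
  have "(\<integral>\<^sup>+z. ennreal (1 / (cmod z)\<^sup>2) * indicator (cusp R) z \<partial>lborel)
     = (\<integral>\<^sup>+z. ennreal (1 / (cmod z)\<^sup>2) * indicator (cusp R) z \<partial>distr lborel borel (\<lambda>z. u * z))"
    by (simp only: lborel_rotate[OF assms])
  also have "\<dots> = (\<integral>\<^sup>+z. ennreal (1 / (cmod (u * z))\<^sup>2) * indicator (cusp R) (u * z) \<partial>lborel)"
    by (rule nn_integral_distr) auto
  also have "\<dots> = (\<integral>\<^sup>+z. ennreal (1 / (cmod (u * z))\<^sup>2) * indicator (cusp R) (u * z) \<partial>distr lborel borel ((+) (- 1)))"
    by (simp only: lborel_distr_plus)
  also have "\<dots> = (\<integral>\<^sup>+z. ennreal (1 / (cmod (u * (- 1 + z)))\<^sup>2) * indicator (cusp R) (u * (- 1 + z)) \<partial>lborel)"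
    by (rule nn_integral_distr) auto
  also have "\<dots> = (\<integral>\<^sup>+z. ennreal (1 / (cmod (z - 1))\<^sup>2) * indicator (cusp R) (u * (z - 1)) \<partial>lborel)"
    using assms by (simp add: norm_mult)
  finally show ?thesis using nn_integral_cusp_finite[of R] by simp
qed

section \<open>Finiteness of the invariant mass\<close>

lemma borel_measurable_edge_fn [measurable]: "(\<lambda>z. edge_fn z e) \<in> borel_measurable borel"
  unfolding edge_fn_def by measurable

lemma borel_measurable_sqn [measurable]: "sqn \<in> borel_measurable borel"
  unfolding sqn_eq[abs_def] by measurable

lemma sets_pair_lborel: "sets (lborel \<Otimes>\<^sub>M lborel) = sets (borel \<Otimes>\<^sub>M (borel :: 'a::euclidean_space measure))"
  by (intro sets_pair_measure_cong) simp_all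

lemma nat_ext_measurable [measurable]: "nat_ext \<in> sets (borel \<Otimes>\<^sub>M borel)"
proof -
  have "nat_ext = {p \<in> space (borel \<Otimes>\<^sub>M borel). 1 < sqn (snd p) \<and> (\<forall>e\<in>min_vecs. edge_fn (fst p) e < 1 \<and>
     sqn (fst p) \<noteq> edge_fn (fst p) e \<and>
     (sqn (fst p) < edge_fn (fst p) e \<longrightarrow> 3 * edge_fn (snd p) e < 2 * sqn (snd p) + 1) \<and>
     (sqn (fst p) + 1 < 2 * edge_fn (fst p) e \<longrightarrow> 3 * edge_fn (snd p) e < sqn (snd p) + 2))}"
    by (auto simp: nat_ext_def hexagon_def space_pair_measure)
  also have "\<dots> \<in> sets (borel \<Otimes>\<^sub>M borel)"
    using finite_min_vecs by measurable
  finally show ?thesis .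
qed

section \<open>Symmetries of the domain\<close>

lemma edge_fn_cnj: "edge_fn (cnj z) e = edge_fn z (cnj e)"
  by (simp add: edge_fn_def)

lemma sqn_cnj [simp]: "sqn (cnj z) = sqn z"
  by (simp add: sqn_def)

lemma nat_ext_cnj: assumes "(z, w) \<in> nat_ext" shows "(cnj z, cnj w) \<in> nat_ext"
proof -
  have "\<forall>e\<in>min_vecs. edge_fn z (cnj e) < 1 \<and> sqn z \<noteq> edge_fn z (cnj e) \<and>
     (sqn z < edge_fn z (cnj e) \<longrightarrow> 3 * edge_fn w (cnj e) < 2 * sqn w + 1) \<and>
     (sqn z + 1 < 2 * edge_fn z (cnj e) \<longrightarrow> 3 * edge_fn w (cnj e) < sqn w + 2)"
    using assms by (auto simp: nat_ext_def hexagon_def)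
  then show ?thesis using assms by (simp add: nat_ext_def hexagon_def edge_fn_cnj)
qed

text \<open>A fundamental domain for the dihedral group of the hexagon, with \<open>1\<close> as the nearest vertex.\<close>

definition half_sector :: "complex set" where
  "half_sector = {z. 0 \<le> edge_fn z (J_vec 0 1) \<and> edge_fn z (J_vec 0 1) \<le> edge_fn z (J_vec 1 (- 1))}"

text \<open>The flag appends the reflection \<open>z \<mapsto> zeta * cnj z\<close>, which exchanges
  the vertices 1 and \<open>zeta\<close>.\<close>

definition dihedral :: "nat \<times> bool \<Rightarrow> complex \<Rightarrow> complex" where
  "dihedral kb z = (if snd kb then zeta * cnj (zeta ^ fst kb * z) else zeta ^ fst kb * z)"

lemma dihedral_half_sector: obtains k b where "k \<le> 6" "dihedral (k, b) z \<in> half_sector"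
proof -
  obtain j z0 where j: "j \<le> 5" "z = zeta ^ j * z0" and pos: "0 \<le> edge_fn z0 (J_vec 0 1)" "0 \<le> edge_fn z0 (J_vec 1 (- 1))"
    by (rule sector_exists)
  have "zeta ^ (6 - j) * zeta ^ j = 1" using j(1) zeta_powers(5) by (simp add: power_add[symmetric])
  then have z0: "zeta ^ (6 - j) * z = z0" by (simp add: j(2) mult.assoc[symmetric])
  show ?thesis
  proof (cases "edge_fn z0 (J_vec 0 1) \<le> edge_fn z0 (J_vec 1 (- 1))")
    case True
    then show ?thesis using pos z0 by (intro that[of "6 - j" False]) (auto simp: dihedral_def half_sector_def)
  next
    case False
    have "edge_fn (zeta * cnj z0) (J_vec 0 1) = edge_fn z0 (J_vec 1 (- 1))"
      using edge_fn_rotate[OF cmod_zeta, of "cnj z0" "J_vec 1 0"]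
      by (simp add: zeta_mult_J_vec edge_fn_cnj J_vec_cnj)
    moreover have "edge_fn (zeta * cnj z0) (J_vec 1 (- 1)) = edge_fn z0 (J_vec 0 1)"
      using edge_fn_rotate[OF cmod_zeta, of "cnj z0" "J_vec 0 (- 1)"]
      by (simp add: zeta_mult_J_vec edge_fn_cnj J_vec_cnj)
    ultimately show ?thesis using pos z0 False
      by (intro that[of "6 - j" True]) (auto simp: dihedral_def half_sector_def)
  qed
qed

lemma dihedral_nat_ext: "(z, w) \<in> nat_ext \<Longrightarrow> (dihedral kb z, dihedral kb w) \<in> nat_ext"
  using nat_ext_rotate[of z w "fst kb"] nat_ext_rotate[OF nat_ext_cnj, of "zeta ^ fst kb * z" "zeta ^ fst kb * w" 1]
  by (auto simp: dihedral_def)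

lemma dihedral_norm: "cmod (dihedral kb w) = cmod w"
  by (simp add: dihedral_def norm_mult norm_power)

lemma dihedral_dist: "cmod (dihedral kb z - dihedral kb w) = cmod (z - w)"
proof -
  have "dihedral kb z - dihedral kb w = dihedral kb (z - w)" by (simp add: dihedral_def algebra_simps)
  then show ?thesis using dihedral_norm by simp
qed

lemma linear_dihedral: "linear (dihedral kb)"
  by (rule linearI) (auto simp: dihedral_def algebra_simps)

lemma lborel_dihedral: "distr lborel borel (dihedral kb) = lborel"
  by (rule lborel_orthogonal_complex) (simp add: orthogonal_transformation linear_dihedral dihedral_norm)

lemma borel_measurable_dihedral [measurable]: "dihedral kb \<in> borel_measurable borel"
  using linear_dihedral[of kb]
  by (intro borel_measurable_continuous_onI linear_continuous_on linear_conv_bounded_linear[THEN iffD1])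

lemma nn_integral_pair_dihedral:
  assumes [measurable]: "f \<in> borel_measurable (borel \<Otimes>\<^sub>M borel)"
  shows "(\<integral>\<^sup>+z. \<integral>\<^sup>+w. f (dihedral kb z, dihedral kb w) \<partial>lborel \<partial>lborel) = (\<integral>\<^sup>+z. \<integral>\<^sup>+w. f (z, w) \<partial>lborel \<partial>lborel)"
proof -
  have *: "(\<integral>\<^sup>+w. g (dihedral kb w) \<partial>lborel) = (\<integral>\<^sup>+w. g w \<partial>lborel)"
    if "g \<in> borel_measurable borel" for g :: "complex \<Rightarrow> ennreal"
  proof -
    have "(\<integral>\<^sup>+w. g w \<partial>lborel) = (\<integral>\<^sup>+w. g w \<partial>distr lborel borel (dihedral kb))" by (simp only: lborel_dihedral)
    also have "\<dots> = (\<integral>\<^sup>+w. g (dihedral kb w) \<partial>lborel)" using that by (intro nn_integral_distr) auto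
    finally show ?thesis ..
  qed
  have "(\<integral>\<^sup>+z. \<integral>\<^sup>+w. f (dihedral kb z, dihedral kb w) \<partial>lborel \<partial>lborel) = (\<integral>\<^sup>+z. \<integral>\<^sup>+w. f (dihedral kb z, w) \<partial>lborel \<partial>lborel)"
    by (intro nn_integral_cong *[where g = "\<lambda>w. f (dihedral kb _, w)"]) measurable
  also have "\<dots> = (\<integral>\<^sup>+z. \<integral>\<^sup>+w. f (z, w) \<partial>lborel \<partial>lborel)"
    by (rule *) measurable
  finally show ?thesis .
qed

lemma half_sector_coordinates:
  assumes z: "z \<in> hexagon" "z \<in> half_sector"
  defines "p \<equiv> edge_fn z (J_vec 0 1)" and "q \<equiv> edge_fn z (J_vec 1 (- 1))"
  shows "0 \<le> p" "p \<le> q" "p + q < 1" "sqn z = p\<^sup>2 + p * q + q\<^sup>2" "z - 1 = of_real (q - 1) + of_real p * zeta"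
    "(cmod (z - 1))\<^sup>2 = (1 - q)\<^sup>2 - (1 - q) * p + p\<^sup>2"
proof -
  show "0 \<le> p" "p \<le> q" using z(2) by (simp_all add: half_sector_def p_def q_def)
  show "p + q < 1" using z(1) sector_min_vecs(1) sector_values(1)[of z] by (auto simp: hexagon_def p_def q_def)
  show "sqn z = p\<^sup>2 + p * q + q\<^sup>2" using sector_values(2)[of z] by (simp add: p_def q_def)
  show eq: "z - 1 = of_real (q - 1) + of_real p * zeta"
    by (simp add: complex_eq_iff p_def q_def edge_fn_def J_vec_def zeta_eq field_simps)
  have "(cmod (z - 1))\<^sup>2 = (q - 1 + p / 2)\<^sup>2 + (p * sqrt 3 / 2)\<^sup>2"
    unfolding eq cmod_power2 by (simp add: zeta_eq)
  also have "\<dots> = (1 - q)\<^sup>2 - (1 - q) * p + p\<^sup>2"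
    by (simp add: power_mult_distrib power_divide power2_eq_square field_simps)
  finally show "(cmod (z - 1))\<^sup>2 = (1 - q)\<^sup>2 - (1 - q) * p + p\<^sup>2" .
qed

text \<open>In the half sector the hexagon approaches the unit circle only at 1 and transversally,
  so the distances to the vertex and to the circle are comparable. The factor 8 is
  \<open>4 * 2\<close>, from \<open>1 - q \<le> 4 * (1 - sqn z)\<close> and
  \<open>1 - sqn z \<le> 2 * (1 - cmod z)\<close>.\<close>

lemma half_sector_dist_vertex:
  assumes z: "z \<in> hexagon" "z \<in> half_sector"
  shows "cmod (z - 1) \<le> 8 * (1 - cmod z)"
proof -
  define p q where "p = edge_fn z (J_vec 0 1)" and "q = edge_fn z (J_vec 1 (- 1))"
  note c = half_sector_coordinates[OF z, folded p_def q_def]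
  have "(cmod (z - 1))\<^sup>2 \<le> (1 - q)\<^sup>2"
    using c(1-3) mult_left_mono[of p "1 - q" p] unfolding c(6) by (simp add: power2_eq_square algebra_simps)
  then have s: "cmod (z - 1) \<le> 1 - q" by (rule power2_le_imp_le) (use c(1-3) in auto)
  have "1 - q \<le> 4 * (1 - sqn z)"
  proof (cases "q \<ge> 1 / 2")
    case True
    have "p * (p + q) \<le> (1 - q) * 1" using c(1-3) by (intro mult_mono) auto
    moreover have "0 \<le> (1 - q) * (q - 1 / 2)" using True c(1-3) by (intro mult_nonneg_nonneg) auto
    ultimately have "p * p + p * q \<le> 1 - q" "q * q \<le> 3 / 2 * q - 1 / 2" by (simp_all add: field_simps)
    moreover have "1 - q \<le> 4 * (1 - (A + B + C))" if "A + B \<le> 1 - q" "C \<le> 3 / 2 * q - 1 / 2" for A B C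
      using that c(1-3) by argo
    ultimately show ?thesis unfolding c(4) power2_eq_square by blast
  next
    case False
    have "p * p \<le> q * q" "p * q \<le> q * q" using c(1-3) by (auto intro!: mult_mono)
    moreover have "q * q \<le> 1 / 2 * (1 / 2)" by (rule mult_mono) (use c(1-3) False in auto)
    moreover have "1 - q \<le> 4 * (1 - (A + B + C))" if "A \<le> C" "B \<le> C" "C \<le> 1 / 2 * (1 / 2)" for A B C
    proof -
      have "C \<le> 1 / 4" "0 \<le> q" using that c(1,2) by simp_all
      then show ?thesis using that by argo
    qed
    ultimately show ?thesis unfolding c(4) power2_eq_square by blast
  qed
  moreover have "1 - sqn z \<le> 2 * (1 - cmod z)"
    using zero_le_power2[of "1 - cmod z"] by (simp add: sqn_eq power2_eq_square algebra_simps)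
  ultimately show ?thesis using s by simp
qed

text \<open>As \<open>w\<close> lies outside the unit circle, \<open>cmod (z - w)\<close> dominates
  \<open>1 - cmod z\<close>, hence the distances of \<open>z\<close> and \<open>w\<close> to the
  vertex with factors 8 and 9; 145 is \<open>8^2 + 9^2\<close>. The bound is symmetric, so either
  variable may be integrated out first.\<close>

lemma kernel_bound:
  assumes z: "z \<in> hexagon" "z \<in> half_sector" and w: "1 < cmod w"
  shows "1 / cmod (z - w) ^ 4 \<le> 145\<^sup>2 / ((cmod (z - 1))\<^sup>2 + (cmod (w - 1))\<^sup>2)\<^sup>2"
proof -
  define d where "d = cmod (z - w)"
  have "1 - cmod z \<le> d" using w norm_triangle_ineq2[of w z] by (simp add: d_def norm_minus_commute)
  then have 1: "cmod (z - 1) \<le> 8 * d" using half_sector_dist_vertex[OF z] by simp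
  have "cmod (w - 1) \<le> cmod (z - w) + cmod (z - 1)"
    by (metis norm_minus_commute norm_triangle_sub add.commute diff_diff_eq2 diff_add_cancel norm_triangle_ineq)
  then have 2: "cmod (w - 1) \<le> 9 * d" using 1 by (simp add: d_def)
  have "(cmod (z - 1))\<^sup>2 + (cmod (w - 1))\<^sup>2 \<le> (8 * d)\<^sup>2 + (9 * d)\<^sup>2"
    using 1 2 by (intro add_mono power_mono) auto
  then have 3: "(cmod (z - 1))\<^sup>2 + (cmod (w - 1))\<^sup>2 \<le> 145 * d\<^sup>2" by (simp add: power_mult_distrib)
  have pos: "0 < (cmod (z - 1))\<^sup>2 + (cmod (w - 1))\<^sup>2"
    using hexagon_cmod_less[OF z(1)] by (intro add_pos_nonneg) auto
  have "((cmod (z - 1))\<^sup>2 + (cmod (w - 1))\<^sup>2)\<^sup>2 \<le> (145 * d\<^sup>2)\<^sup>2" using 3 pos by (intro power_mono) auto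
  then have "((cmod (z - 1))\<^sup>2 + (cmod (w - 1))\<^sup>2)\<^sup>2 \<le> 145\<^sup>2 * d ^ 4" by (simp add: power_mult_distrib power_mult[symmetric])
  then have "((cmod (z - 1))\<^sup>2 + (cmod (w - 1))\<^sup>2)\<^sup>2 / 145\<^sup>2 \<le> d ^ 4" by (simp add: field_simps)
  moreover have "0 < ((cmod (z - 1))\<^sup>2 + (cmod (w - 1))\<^sup>2)\<^sup>2 / 145\<^sup>2"
    using pos by (intro divide_pos_pos zero_less_power) auto
  ultimately have "1 / d ^ 4 \<le> 1 / (((cmod (z - 1))\<^sup>2 + (cmod (w - 1))\<^sup>2)\<^sup>2 / 145\<^sup>2)"
    by (intro frac_le) auto
  then show ?thesis by (simp add: d_def)
qed

text \<open>Rotation by 30 degrees, turning the common tangent at 1 of the circles around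
  \<open>eta\<close> and \<open>cnj eta / 2\<close> into the real axis.\<close>

definition cusp_dir :: complex where
  "cusp_dir = Complex (sqrt 3 / 2) (1 / 2)"

lemma cmod_cusp_dir: "cmod cusp_dir = 1"
  by (simp add: cusp_dir_def cmod_def power_divide)

text \<open>Outside the outer disc, \<open>z\<close> is squeezed between the real axis and a circle
  tangent to it at 1; outside the disc around \<open>cnj eta / 3\<close>, between an edge of the
  hexagon and a circle tangent to that edge. Inside both discs, \<open>w\<close> must avoid the
  discs around \<open>eta\<close> and \<open>cnj eta / 2\<close>, which touch each other at
  1.\<close>

lemma nat_ext_cusp:
  assumes W: "(z, w) \<in> nat_ext" and z: "z \<in> half_sector" and w: "cmod w < 5"
  shows "z - 1 \<in> cusp 6 \<or> zeta * (z - 1) \<in> cusp 6 \<or> cusp_dir * (w - 1) \<in> cusp 6"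
proof -
  have zh: "z \<in> hexagon" using W by (auto simp: nat_ext_def)
  define p q where "p = edge_fn z (J_vec 0 1)" and "q = edge_fn z (J_vec 1 (- 1))"
  note c = half_sector_coordinates[OF zh z, folded p_def q_def]
  have s6: "cmod (z - 1) \<le> 6" using hexagon_cmod_less[OF zh] norm_triangle_ineq4[of z 1] by simp
  have t6: "cmod (w - 1) \<le> 6" using w norm_triangle_ineq4[of w 1] by simp
  have s3: "sqrt 3 \<le> 2" by (simp add: real_le_lsqrt)
  have small: "sqrt 3 / 2 * x \<le> x" if "0 \<le> x" for x using mult_right_mono[OF s3 that] by simp
  consider (1) "sqn z + 1 \<ge> 2 * (p + q)" | (2) "sqn z \<ge> q" | (3) "sqn z + 1 < 2 * (p + q)" "sqn z < q" by linarith
  then show ?thesis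
  proof cases
    case 1
    have "Im (z - 1) = sqrt 3 / 2 * p" unfolding c(5) by (simp add: zeta_eq)
    moreover have "p \<le> (cmod (z - 1))\<^sup>2" using 1 unfolding c(4,6) by (simp add: power2_eq_square algebra_simps)
    ultimately have "\<bar>Im (z - 1)\<bar> \<le> (cmod (z - 1))\<^sup>2" using small[OF c(1)] c(1) by (simp only: abs_mult) simp
    then show ?thesis using s6 unfolding cusp_def by blast
  next
    case 2
    have "Im (zeta * (z - 1)) = - (sqrt 3 / 2 * (1 - p - q))" unfolding c(5) by (simp add: zeta_eq field_simps)
    moreover have "1 - p - q \<le> (cmod (z - 1))\<^sup>2" using 2 unfolding c(4,6) by (simp add: power2_eq_square algebra_simps)
    moreover have "0 \<le> 1 - p - q" using c(3) by simp
    ultimately have "\<bar>Im (zeta * (z - 1))\<bar> \<le> (cmod (z - 1))\<^sup>2" using small[of "1 - p - q"] c(3)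
      by (simp only: abs_minus_cancel abs_mult) simp
    then have "zeta * (z - 1) \<in> cusp 6"
      using s6 unfolding cusp_def mem_Collect_eq norm_mult cmod_zeta mult_1_left by (rule conjI)
    then show ?thesis by blast
  next
    case 3
    have "edge_fn z (J_vec 1 0) = p + q" using sector_values(1)[of z] by (simp add: p_def q_def)
    then have "3 * edge_fn w (J_vec 1 0) < sqn w + 2" "3 * edge_fn w (J_vec 1 (- 1)) < 2 * sqn w + 1"
      using W 3 sector_min_vecs by (auto simp: nat_ext_def q_def)
    moreover have "Im (cusp_dir * (w - 1)) = (Re w - 1 + sqrt 3 * Im w) / 2"
      by (simp add: cusp_dir_def field_simps)
    moreover have "(cmod (w - 1))\<^sup>2 = sqn w - 2 * Re w + 1"
      unfolding cmod_power2 sqn_def by (simp add: power2_eq_square algebra_simps)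
    ultimately have "\<bar>Im (cusp_dir * (w - 1))\<bar> \<le> (cmod (w - 1))\<^sup>2"
      by (simp add: edge_fn_def J_vec_def abs_le_iff field_simps)
    then have "cusp_dir * (w - 1) \<in> cusp 6"
      using t6 unfolding cusp_def mem_Collect_eq norm_mult cmod_cusp_dir mult_1_left by (rule conjI)
    then show ?thesis by blast
  qed
qed

text \<open>Integrating out the unconstrained variable leaves
  \<open>pi^2 / (cmod (z - 1))^2\<close>, a weight that is integrable over a cusp.\<close>

lemma cusp_pair_finite:
  assumes "cmod u = 1"
  shows "(\<integral>\<^sup>+z. \<integral>\<^sup>+w. indicator (cusp R) (u * (z - 1)) * ennreal (1 / ((cmod (z - 1))\<^sup>2 + (cmod (w - 1))\<^sup>2)\<^sup>2) \<partial>lborel \<partial>lborel) < \<infinity>"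
proof -
  have "(\<integral>\<^sup>+z. \<integral>\<^sup>+w. indicator (cusp R) (u * (z - 1)) * ennreal (1 / ((cmod (z - 1))\<^sup>2 + (cmod (w - 1))\<^sup>2)\<^sup>2) \<partial>lborel \<partial>lborel)
      \<le> (\<integral>\<^sup>+z. ennreal (pi\<^sup>2) * (ennreal (1 / (cmod (z - 1))\<^sup>2) * indicator (cusp R) (u * (z - 1))) \<partial>lborel)"
  proof (rule nn_integral_mono_AE)
    show "AE z in lborel. (\<integral>\<^sup>+w. indicator (cusp R) (u * (z - 1)) * ennreal (1 / ((cmod (z - 1))\<^sup>2 + (cmod (w - 1))\<^sup>2)\<^sup>2) \<partial>lborel)
       \<le> ennreal (pi\<^sup>2) * (ennreal (1 / (cmod (z - 1))\<^sup>2) * indicator (cusp R) (u * (z - 1)))"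
      using AE_lborel_singleton[of 1]
    proof eventually_elim
      case (elim z)
      have "(\<integral>\<^sup>+w. indicator (cusp R) (u * (z - 1)) * ennreal (1 / ((cmod (z - 1))\<^sup>2 + (cmod (w - 1))\<^sup>2)\<^sup>2) \<partial>lborel)
        = indicator (cusp R) (u * (z - 1)) * (\<integral>\<^sup>+w. ennreal (1 / ((cmod (z - 1))\<^sup>2 + (cmod (w - 1))\<^sup>2)\<^sup>2) \<partial>lborel)"
        by (rule nn_integral_cmult) measurable
      also have "\<dots> \<le> indicator (cusp R) (u * (z - 1)) * ennreal (pi\<^sup>2 / (cmod (z - 1))\<^sup>2)"
        using elim by (intro mult_left_mono nn_integral_inverse_quartic) auto
      also have "ennreal (pi\<^sup>2 / (cmod (z - 1))\<^sup>2) = ennreal (pi\<^sup>2) * ennreal (1 / (cmod (z - 1))\<^sup>2)"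
        by (simp add: ennreal_mult'[symmetric])
      finally show ?case by (simp add: mult_ac)
    qed
  qed
  also have "\<dots> = ennreal (pi\<^sup>2) * (\<integral>\<^sup>+z. ennreal (1 / (cmod (z - 1))\<^sup>2) * indicator (cusp R) (u * (z - 1)) \<partial>lborel)"
    by (rule nn_integral_cmult) measurable
  also have "\<dots> < \<infinity>" using nn_integral_rotated_cusp_finite[OF assms, of R] by (simp add: ennreal_mult_less_top)
  finally show ?thesis .
qed

lemma half_sector_measurable [measurable]: "half_sector \<in> sets borel"
  unfolding half_sector_def by measurable

lemma near_half_sector_finite:
  "(\<integral>\<^sup>+z. \<integral>\<^sup>+w. indicator {(z, w). (z, w) \<in> nat_ext \<and> z \<in> half_sector \<and> cmod w < 5} (z, w) * kernel_hat (z, w) \<partial>lborel \<partial>lborel) < \<infinity>"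
proof -
  define k where "k z w = ennreal (1 / ((cmod (z - 1))\<^sup>2 + (cmod (w - 1))\<^sup>2)\<^sup>2)" for z w
  define f1 where "f1 z w = indicator (cusp 6) (1 * (z - 1)) * k z w" for z w
  define f2 where "f2 z w = indicator (cusp 6) (zeta * (z - 1)) * k z w" for z w
  \<comment> \<open>Here the cusp constrains \<open>w\<close>; with the arguments of
    \<open>k\<close> exchanged, Fubini brings the integral into the form of the other two.\<close>
  define f3 where "f3 z w = indicator (cusp 6) (cusp_dir * (w - 1)) * k w z" for z w
  have [measurable]: "case_prod f1 \<in> borel_measurable (borel \<Otimes>\<^sub>M borel)" "case_prod f2 \<in> borel_measurable (borel \<Otimes>\<^sub>M borel)"
    "case_prod f3 \<in> borel_measurable (borel \<Otimes>\<^sub>M borel)"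
    unfolding f1_def f2_def f3_def k_def split_beta' by measurable
  have F1: "(\<integral>\<^sup>+z. \<integral>\<^sup>+w. f1 z w \<partial>lborel \<partial>lborel) < \<infinity>" unfolding f1_def k_def by (rule cusp_pair_finite) simp
  have F2: "(\<integral>\<^sup>+z. \<integral>\<^sup>+w. f2 z w \<partial>lborel \<partial>lborel) < \<infinity>" unfolding f2_def k_def by (rule cusp_pair_finite) simp
  have "(\<integral>\<^sup>+z. \<integral>\<^sup>+w. f3 z w \<partial>lborel \<partial>lborel) = (\<integral>\<^sup>+w. \<integral>\<^sup>+z. f3 z w \<partial>lborel \<partial>lborel)"
    by (rule lborel_pair.Fubini'[symmetric]) measurable
  also have "\<dots> < \<infinity>" unfolding f3_def k_def by (rule cusp_pair_finite) (rule cmod_cusp_dir)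
  finally have F3: "(\<integral>\<^sup>+z. \<integral>\<^sup>+w. f3 z w \<partial>lborel \<partial>lborel) < \<infinity>" .
  have "(\<integral>\<^sup>+z. \<integral>\<^sup>+w. indicator {(z, w). (z, w) \<in> nat_ext \<and> z \<in> half_sector \<and> cmod w < 5} (z, w) * kernel_hat (z, w) \<partial>lborel \<partial>lborel)
      \<le> (\<integral>\<^sup>+z. \<integral>\<^sup>+w. ennreal (145\<^sup>2) * (f1 z w + f2 z w + f3 z w) \<partial>lborel \<partial>lborel)"
  proof (intro nn_integral_mono)
    fix z w :: complex
    show "indicator {(z, w). (z, w) \<in> nat_ext \<and> z \<in> half_sector \<and> cmod w < 5} (z, w) * kernel_hat (z, w)
       \<le> ennreal (145\<^sup>2) * (f1 z w + f2 z w + f3 z w)"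
    proof (cases "(z, w) \<in> nat_ext \<and> z \<in> half_sector \<and> cmod w < 5")
      case True
      then have zw: "z \<in> hexagon" "1 < cmod w" using dual_circles(3)[OF some_min_vecs(1)] by (auto simp: nat_ext_def)
      have "kernel_hat (z, w) \<le> ennreal (145\<^sup>2) * k z w"
      proof -
        have "kernel_hat (z, w) \<le> ennreal (145\<^sup>2 * (1 / ((cmod (z - 1))\<^sup>2 + (cmod (w - 1))\<^sup>2)\<^sup>2))"
          unfolding kernel_hat_def prod.case using kernel_bound[OF zw(1) _ zw(2)] True by (intro ennreal_leI) simp
        also have "\<dots> = ennreal (145\<^sup>2) * k z w" unfolding k_def by (rule ennreal_mult) auto
        finally show ?thesis .
      qed
      also have "k z w \<le> f1 z w + f2 z w + f3 z w"
      proof -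
        have k: "k z w = k w z" by (simp add: k_def add.commute)
        have "k z w = f1 z w \<or> k z w = f2 z w \<or> k z w = f3 z w"
          using nat_ext_cusp[of z w] True by (auto simp: f1_def f2_def f3_def k)
        then show ?thesis by (auto intro: add_increasing add_increasing2)
      qed
      finally show ?thesis using True by (simp add: mult_left_mono)
    next
      case False
      then have "indicator {(z, w). (z, w) \<in> nat_ext \<and> z \<in> half_sector \<and> cmod w < 5} (z, w) = (0 :: ennreal)"
        by (auto simp: indicator_def)
      then show ?thesis by simp
    qed
  qed
  also have "\<dots> = ennreal (145\<^sup>2) * ((\<integral>\<^sup>+z. \<integral>\<^sup>+w. f1 z w \<partial>lborel \<partial>lborel) + (\<integral>\<^sup>+z. \<integral>\<^sup>+w. f2 z w \<partial>lborel \<partial>lborel) + (\<integral>\<^sup>+z. \<integral>\<^sup>+w. f3 z w \<partial>lborel \<partial>lborel))"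
    by (simp add: nn_integral_add nn_integral_cmult)
  also have "\<dots> < \<infinity>" using F1 F2 F3 by (simp add: ennreal_mult_less_top)
  finally show ?thesis .
qed

text \<open>\<open>cmod (z - w) \<ge> cmod w / 2\<close> gives the factor \<open>16 = 2^4\<close>,
  and \<open>1 + ln (cmod w) \<le> cmod w\<close> leaves a tail of order -3, which inversion turns
  into \<open>1 / cmod w\<close> on the unit disc.\<close>

lemma far_finite:
  "(\<integral>\<^sup>+z. \<integral>\<^sup>+w. indicator {(z, w). z \<in> hexagon \<and> 5 \<le> cmod w} (z, w) * (ennreal (1 + ln (cmod w)) * kernel_hat (z, w)) \<partial>lborel \<partial>lborel) < \<infinity>"
proof -
  define f where "f w = ennreal (1 / cmod w) * indicator {w. cmod w \<le> 1} w" for w :: complex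
  have [measurable]: "f \<in> borel_measurable borel" unfolding f_def by measurable
  have hex: "emeasure lborel hexagon < \<infinity>"
    by (rule emeasure_bounded_finite) (use hexagon_cmod_less in \<open>auto intro!: boundedI[of _ 1] less_imp_le\<close>)
  have [measurable]: "hexagon \<in> sets borel" using open_hexagon by simp
  have "(\<integral>\<^sup>+z. \<integral>\<^sup>+w. indicator {(z, w). z \<in> hexagon \<and> 5 \<le> cmod w} (z, w) * (ennreal (1 + ln (cmod w)) * kernel_hat (z, w)) \<partial>lborel \<partial>lborel)
      \<le> (\<integral>\<^sup>+z. \<integral>\<^sup>+w. ennreal 16 * indicator hexagon z * (f (1 / w) * ennreal (1 / cmod w ^ 4)) \<partial>lborel \<partial>lborel)"
  proof (intro nn_integral_mono)
    fix z w :: complex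
    show "indicator {(z, w). z \<in> hexagon \<and> 5 \<le> cmod w} (z, w) * (ennreal (1 + ln (cmod w)) * kernel_hat (z, w))
       \<le> ennreal 16 * indicator hexagon z * (f (1 / w) * ennreal (1 / cmod w ^ 4))"
    proof (cases "z \<in> hexagon \<and> 5 \<le> cmod w")
      case True
      then have z1: "cmod z < 1" and w5: "5 \<le> cmod w" using hexagon_cmod_less by auto
      have "cmod w / 2 \<le> cmod (z - w)" using z1 w5 norm_triangle_ineq2[of w z] by (simp add: norm_minus_commute)
      then have "(cmod w / 2) ^ 4 \<le> cmod (z - w) ^ 4" by (intro power_mono) auto
      moreover have "0 < (cmod w / 2) ^ 4" using w5 by (intro zero_less_power) auto
      ultimately have "1 / cmod (z - w) ^ 4 \<le> 1 / (cmod w / 2) ^ 4" by (intro frac_le) auto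
      then have k: "1 / cmod (z - w) ^ 4 \<le> 16 * (1 / cmod w ^ 4)" by (simp add: power_divide)
      have "0 < cmod w" "0 \<le> ln (cmod w)" using w5 by (auto simp: ln_ge_zero)
      then have l: "1 + ln (cmod w) \<le> cmod w" "0 \<le> 1 + ln (cmod w)" using ln_le_minus_one[of "cmod w"] by linarith+
      have "(1 + ln (cmod w)) * (1 / cmod (z - w) ^ 4) \<le> cmod w * (16 * (1 / cmod w ^ 4))"
        using k l by (intro mult_mono) auto
      then have "ennreal (1 + ln (cmod w)) * kernel_hat (z, w) \<le> ennreal (16 * (cmod w * (1 / cmod w ^ 4)))"
        using l by (simp add: kernel_hat_def ennreal_mult'[symmetric] ennreal_leI mult.commute)
      also have "\<dots> = ennreal 16 * (ennreal (cmod w) * ennreal (1 / cmod w ^ 4))"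
      proof -
        have "ennreal (16 * (cmod w * (1 / cmod w ^ 4))) = ennreal 16 * ennreal (cmod w * (1 / cmod w ^ 4))"
          by (rule ennreal_mult) auto
        also have "ennreal (cmod w * (1 / cmod w ^ 4)) = ennreal (cmod w) * ennreal (1 / cmod w ^ 4)"
          by (rule ennreal_mult) auto
        finally show ?thesis .
      qed
      also have "ennreal (cmod w) = f (1 / w)"
      proof -
        have "cmod (1 / w) \<le> 1" using w5 by (simp add: norm_divide divide_le_eq_1)
        then show ?thesis by (simp add: f_def norm_divide)
      qed
      finally show ?thesis using True by (simp add: mult.assoc)
    next
      case False
      then have "indicator {(z, w). z \<in> hexagon \<and> 5 \<le> cmod w} (z, w) = (0 :: ennreal)"
        by (auto simp: indicator_def)
      then show ?thesis by simp
    qed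
  qed
  also have "\<dots> = ennreal 16 * emeasure lborel hexagon * (\<integral>\<^sup>+w. f (1 / w) * ennreal (1 / cmod w ^ 4) \<partial>lborel)"
    by (simp add: nn_integral_cmult nn_integral_multc)
  also have "(\<integral>\<^sup>+w. f (1 / w) * ennreal (1 / cmod w ^ 4) \<partial>lborel) = (\<integral>\<^sup>+w. f w \<partial>lborel)"
    by (rule nn_integral_inverse_complex) measurable
  also have "ennreal 16 * emeasure lborel hexagon * (\<integral>\<^sup>+w. f w \<partial>lborel) < \<infinity>"
    using hex nn_integral_inverse_cmod_finite unfolding f_def by (simp add: ennreal_mult_less_top)
  finally show ?thesis .
qed

lemma borel_measurable_kernel_hat [measurable]: "kernel_hat \<in> borel_measurable (borel \<Otimes>\<^sub>M borel)"
  unfolding kernel_hat_def split_beta' by measurable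

lemma dihedral_kernel_hat: "kernel_hat (dihedral kb z, dihedral kb w) = kernel_hat (z, w)"
  by (simp add: kernel_hat_def dihedral_dist)

lemma near_finite:
  "(\<integral>\<^sup>+z. \<integral>\<^sup>+w. indicator {(z, w). (z, w) \<in> nat_ext \<and> cmod w < 5} (z, w) * kernel_hat (z, w) \<partial>lborel \<partial>lborel) < \<infinity>"
proof -
  define f where "f p = indicator {(z, w). (z, w) \<in> nat_ext \<and> z \<in> half_sector \<and> cmod w < 5} p * kernel_hat p" for p
  have "{(z, w). (z, w) \<in> nat_ext \<and> z \<in> half_sector \<and> cmod w < 5}
      = {p \<in> space (borel \<Otimes>\<^sub>M borel). p \<in> nat_ext \<and> fst p \<in> half_sector \<and> cmod (snd p) < 5}"
    by (auto simp: space_pair_measure)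
  also have "\<dots> \<in> sets (borel \<Otimes>\<^sub>M borel)" by measurable
  finally have [measurable]: "f \<in> borel_measurable (borel \<Otimes>\<^sub>M borel)" unfolding f_def by measurable
  \<comment> \<open>The exponents come as \<open>6 - j\<close> and so reach 6; counting group
    elements twice is harmless in an upper bound.\<close>
  define G where "G = {0..6::nat} \<times> (UNIV :: bool set)"
  have finG: "finite G" by (simp add: G_def)
  have "(\<integral>\<^sup>+z. \<integral>\<^sup>+w. indicator {(z, w). (z, w) \<in> nat_ext \<and> cmod w < 5} (z, w) * kernel_hat (z, w) \<partial>lborel \<partial>lborel)
      \<le> (\<integral>\<^sup>+z. \<integral>\<^sup>+w. (\<Sum>g\<in>G. f (dihedral g z, dihedral g w)) \<partial>lborel \<partial>lborel)"
  proof (intro nn_integral_mono)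
    fix z w :: complex
    show "indicator {(z, w). (z, w) \<in> nat_ext \<and> cmod w < 5} (z, w) * kernel_hat (z, w)
       \<le> (\<Sum>g\<in>G. f (dihedral g z, dihedral g w))"
    proof (cases "(z, w) \<in> nat_ext \<and> cmod w < 5")
      case True
      obtain k b where kb: "k \<le> 6" "dihedral (k, b) z \<in> half_sector" by (rule dihedral_half_sector)
      have "kernel_hat (z, w) = f (dihedral (k, b) z, dihedral (k, b) w)"
        using True kb dihedral_nat_ext[of z w "(k, b)"] by (simp add: f_def dihedral_kernel_hat dihedral_norm)
      also have "\<dots> \<le> (\<Sum>g\<in>G. f (dihedral g z, dihedral g w))"
        using kb(1) finG by (intro member_le_sum) (auto simp: G_def)
      finally show ?thesis using True by simp
    next
      case False
      then have "indicator {(z, w). (z, w) \<in> nat_ext \<and> cmod w < 5} (z, w) = (0 :: ennreal)"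
        by (auto simp: indicator_def)
      then show ?thesis by simp
    qed
  qed
  also have "\<dots> = (\<Sum>g\<in>G. \<integral>\<^sup>+z. \<integral>\<^sup>+w. f (dihedral g z, dihedral g w) \<partial>lborel \<partial>lborel)"
    by (simp add: nn_integral_sum)
  also have "\<dots> = (\<Sum>g\<in>G. \<integral>\<^sup>+z. \<integral>\<^sup>+w. f (z, w) \<partial>lborel \<partial>lborel)"
    by (intro sum.cong refl nn_integral_pair_dihedral) measurable
  also have "\<dots> < \<infinity>"
    using near_half_sector_finite unfolding f_def by (simp add: ennreal_mult_less_top of_nat_less_top)
  finally show ?thesis .
qed

text \<open>The weight \<open>1 + ln (cmod w)\<close> controls the total mass and the integral of
  the logarithm at once, because \<open>cmod w > 1\<close>.\<close>

theorem nat_ext_log_integral_finite: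
  "(\<integral>\<^sup>+p. indicator nat_ext p * (ennreal (1 + ln (cmod (snd p))) * kernel_hat p) \<partial>(lborel \<Otimes>\<^sub>M lborel)) < \<infinity>"
proof -
  define n where "n p = indicator {(z, w). (z, w) \<in> nat_ext \<and> cmod w < 5} p * kernel_hat p" for p
  define f where "f p = indicator {(z, w). z \<in> hexagon \<and> 5 \<le> cmod w} p * (ennreal (1 + ln (cmod (snd p))) * kernel_hat p)" for p
  have [measurable]: "hexagon \<in> sets borel" using open_hexagon by simp
  have "{(z, w). (z, w) \<in> nat_ext \<and> cmod w < 5} = {p \<in> space (borel \<Otimes>\<^sub>M borel). p \<in> nat_ext \<and> cmod (snd p) < 5}"
    by (auto simp: space_pair_measure)
  also have "\<dots> \<in> sets (borel \<Otimes>\<^sub>M borel)" by measurable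
  finally have nm [measurable]: "n \<in> borel_measurable (borel \<Otimes>\<^sub>M borel)" unfolding n_def by measurable
  have "{(z, w). z \<in> hexagon \<and> 5 \<le> cmod w} = {p \<in> space (borel \<Otimes>\<^sub>M borel). fst p \<in> hexagon \<and> 5 \<le> cmod (snd p)}"
    by (auto simp: space_pair_measure)
  also have "\<dots> \<in> sets (borel \<Otimes>\<^sub>M borel)" by measurable
  finally have fm [measurable]: "f \<in> borel_measurable (borel \<Otimes>\<^sub>M borel)" unfolding f_def by measurable
  have "(\<integral>\<^sup>+p. indicator nat_ext p * (ennreal (1 + ln (cmod (snd p))) * kernel_hat p) \<partial>(lborel \<Otimes>\<^sub>M lborel))
     \<le> (\<integral>\<^sup>+p. 5 * n p + f p \<partial>(lborel \<Otimes>\<^sub>M lborel))"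
  proof (rule nn_integral_mono)
    fix p :: "complex \<times> complex"
    obtain z w where p: "p = (z, w)" by (cases p)
    show "indicator nat_ext p * (ennreal (1 + ln (cmod (snd p))) * kernel_hat p) \<le> 5 * n p + f p"
    proof (cases "(z, w) \<in> nat_ext")
      case True
      then have zh: "z \<in> hexagon" and w1: "1 < cmod w"
        using dual_circles(3)[OF some_min_vecs(1)] by (auto simp: nat_ext_def)
      show ?thesis
      proof (cases "cmod w < 5")
        case w5: True
        have "1 + ln (cmod w) \<le> 5" using ln_le_minus_one[of "cmod w"] w1 w5 by linarith
        then have "ennreal (1 + ln (cmod w)) \<le> 5" by (metis ennreal_leI ennreal_numeral)
        then show ?thesis using True w5 by (auto simp: p n_def intro!: add_increasing2 mult_right_mono)
      next
        case False
        then show ?thesis using True zh by (auto simp: p f_def intro!: add_increasing)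
      qed
    qed (simp add: p)
  qed
  also have "\<dots> = 5 * (\<integral>\<^sup>+p. n p \<partial>(lborel \<Otimes>\<^sub>M lborel)) + (\<integral>\<^sup>+p. f p \<partial>(lborel \<Otimes>\<^sub>M lborel))"
    by (simp add: nn_integral_add nn_integral_cmult)
  also have "(\<integral>\<^sup>+p. n p \<partial>(lborel \<Otimes>\<^sub>M lborel)) = (\<integral>\<^sup>+z. \<integral>\<^sup>+w. n (z, w) \<partial>lborel \<partial>lborel)"
    by (rule lborel.nn_integral_fst[symmetric]) measurable
  also have "(\<integral>\<^sup>+p. f p \<partial>(lborel \<Otimes>\<^sub>M lborel)) = (\<integral>\<^sup>+z. \<integral>\<^sup>+w. f (z, w) \<partial>lborel \<partial>lborel)"
    by (rule lborel.nn_integral_fst[symmetric]) measurable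
  also have "5 * (\<integral>\<^sup>+z. \<integral>\<^sup>+w. n (z, w) \<partial>lborel \<partial>lborel) + (\<integral>\<^sup>+z. \<integral>\<^sup>+w. f (z, w) \<partial>lborel \<partial>lborel) < \<infinity>"
    using near_finite far_finite unfolding n_def f_def by (simp add: ennreal_mult_less_top)
  finally show ?thesis .
qed

section \<open>The natural extension as an invertible measure preserving map\<close>

text \<open>Being the identity off the pieces makes the map total, as
  \<open>measure_preserving_self\<close> demands of maps defined only almost everywhere.\<close>

definition piecewise_map :: "'i set \<Rightarrow> ('i \<Rightarrow> 'a set) \<Rightarrow> ('i \<Rightarrow> 'a \<Rightarrow> 'a) \<Rightarrow> 'a \<Rightarrow> 'a" where
  "piecewise_map I P t x = (if x \<in> (\<Union>i\<in>I. P i) then t (THE i. i \<in> I \<and> x \<in> P i) x else x)"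

lemma piecewise_map_eq:
  assumes "disjoint_family_on P I" "i \<in> I" "x \<in> P i"
  shows "piecewise_map I P t x = t i x"
proof -
  have "(THE j. j \<in> I \<and> x \<in> P j) = i"
    using assms by (intro the_equality) (auto simp: disjoint_family_on_def)
  then show ?thesis using assms by (auto simp: piecewise_map_def)
qed

text \<open>\<open>Q i\<close> stands for the image of \<open>P i\<close>. Countable additivity
  splits the preimage of \<open>A\<close> over the \<open>P i\<close>, the pieces are exchanged for
  \<open>Q i \<inter> A\<close>, and these reassemble to \<open>A\<close> because the images cover
  almost everywhere.\<close>

lemma piecewise_map_preserving:
  assumes I: "countable I" and disj: "disjoint_family_on P I" "disjoint_family_on Q I"
    and sets: "\<And>i. i \<in> I \<Longrightarrow> P i \<in> sets M" "\<And>i. i \<in> I \<Longrightarrow> Q i \<in> sets M"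
    and t: "\<And>i. i \<in> I \<Longrightarrow> t i \<in> measurable M M"
    and cover: "AE x in M. x \<in> (\<Union>i\<in>I. P i)" "AE x in M. x \<in> (\<Union>i\<in>I. Q i)"
    and eq: "\<And>i A. i \<in> I \<Longrightarrow> A \<in> sets M \<Longrightarrow> emeasure M (P i \<inter> t i -` A) = emeasure M (Q i \<inter> A)"
  shows "measure_preserving_self M (piecewise_map I P t)"
proof -
  let ?T = "piecewise_map I P t"
  have pre: "?T -` A \<inter> space M = (\<Union>i\<in>I. P i \<inter> t i -` A) \<union> ((space M - (\<Union>i\<in>I. P i)) \<inter> A)"
    (is "_ = ?B A \<union> ?C A") if "A \<in> sets M" for A
  proof -
    have "x \<in> ?T -` A \<inter> space M \<longleftrightarrow> x \<in> ?B A \<union> ?C A" for x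
    proof (cases "x \<in> (\<Union>i\<in>I. P i)")
      case True
      then obtain i where i: "i \<in> I" "x \<in> P i" by auto
      have uniq: "j = i" if "j \<in> I" "x \<in> P j" for j using that i disj(1) by (auto simp: disjoint_family_on_def)
      have "x \<in> space M" using i sets(1) sets.sets_into_space by blast
      have "x \<in> ?B A \<longleftrightarrow> t i x \<in> A" using i uniq by blast
      moreover have "x \<notin> ?C A" using True by blast
      moreover have "x \<in> ?T -` A \<inter> space M \<longleftrightarrow> t i x \<in> A"
        using \<open>x \<in> space M\<close> piecewise_map_eq[OF disj(1) i, of t] by simp
      ultimately show ?thesis by blast
    next
      case False
      then have "?T x = x" unfolding piecewise_map_def by (rule if_not_P)
      then have "x \<in> ?T -` A \<inter> space M \<longleftrightarrow> x \<in> A" using sets.sets_into_space[OF that] by auto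
      moreover have "x \<notin> ?B A" using False by blast
      moreover have "x \<in> ?C A \<longleftrightarrow> x \<in> A" using False sets.sets_into_space[OF that] by blast
      ultimately show ?thesis by blast
    qed
    then show ?thesis by (rule set_eqI)
  qed
  have setB: "P i \<inter> t i -` A \<in> sets M" if "i \<in> I" "A \<in> sets M" for i A
  proof -
    have "P i \<inter> t i -` A = P i \<inter> (t i -` A \<inter> space M)" using sets.sets_into_space[OF sets(1)[OF that(1)]] by blast
    moreover have "P i \<inter> (t i -` A \<inter> space M) \<in> sets M"
      by (intro sets.Int sets(1) measurable_sets[OF t] that)
    ultimately show ?thesis by simp
  qed
  have setP: "(\<Union>i\<in>I. P i) \<in> sets M" using I sets by (intro sets.countable_UN') auto
  have setB': "(\<Union>i\<in>I. P i \<inter> t i -` A) \<in> sets M" if "A \<in> sets M" for A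
    using I setB that by (intro sets.countable_UN') auto
  have T: "?T \<in> measurable M M"
  proof (rule measurableI)
    show "?T x \<in> space M" if "x \<in> space M" for x
    proof (cases "x \<in> (\<Union>i\<in>I. P i)")
      case True
      then obtain i where i: "i \<in> I" "x \<in> P i" by auto
      then show ?thesis using piecewise_map_eq[OF disj(1) i, of t] measurable_space[OF t[OF i(1)] that] by simp
    qed (use that in \<open>simp add: piecewise_map_def\<close>)
    show "?T -` A \<inter> space M \<in> sets M" if "A \<in> sets M" for A
      unfolding pre[OF that] using setB'[OF that] setP that by auto
  qed
  moreover have "distr M M ?T = M"
  proof (rule measure_eqI)
    fix A assume "A \<in> sets (distr M M ?T)"
    then have A: "A \<in> sets M" by simp
    have "emeasure (distr M M ?T) A = emeasure M (?T -` A \<inter> space M)" using A T by (intro emeasure_distr)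
    also have "\<dots> = emeasure M (\<Union>i\<in>I. P i \<inter> t i -` A)"
      unfolding pre[OF A]
      by (rule emeasure_eq_AE) (use cover(1) setB'[OF A] setP A in auto)
    also have "\<dots> = (\<integral>\<^sup>+i. emeasure M (P i \<inter> t i -` A) \<partial>count_space I)"
    proof (rule emeasure_UN_countable)
      show "disjoint_family_on (\<lambda>i. P i \<inter> t i -` A) I" using disj(1) unfolding disjoint_family_on_def by blast
    qed (use setB A I in auto)
    also have "\<dots> = (\<integral>\<^sup>+i. emeasure M (Q i \<inter> A) \<partial>count_space I)"
      using eq A by (intro nn_integral_cong) auto
    also have "\<dots> = emeasure M (\<Union>i\<in>I. Q i \<inter> A)"
    proof (rule emeasure_UN_countable[symmetric])
      show "disjoint_family_on (\<lambda>i. Q i \<inter> A) I" using disj(2) unfolding disjoint_family_on_def by blast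
    qed (use sets(2) A I in auto)
    also have "\<dots> = emeasure M A"
    proof (rule emeasure_eq_AE)
      show "(\<Union>i\<in>I. Q i \<inter> A) \<in> sets M" using sets(2) A I by (intro sets.countable_UN') auto
    qed (use cover(2) A in auto)
    finally show "emeasure (distr M M ?T) A = emeasure M A" .
  qed simp
  ultimately show ?thesis by (simp add: measure_preserving_self_def)
qed

section \<open>Null sets in the plane and in the product\<close>

lemma AE_not_in_negligible:
  fixes N :: "complex set"
  assumes "negligible N" "N \<in> sets borel"
  shows "AE z in lborel. z \<notin> N"
proof -
  have "N \<in> null_sets lborel"
    using assms by (simp add: negligible_iff_null_sets null_sets_completion_iff)
  then show ?thesis by (rule AE_not_in)
qed

lemma AE_edge_fn_neq:
  assumes "e \<in> min_vecs" shows "AE z in lborel. edge_fn z e \<noteq> c"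
proof -
  have eq: "{z. edge_fn z e = c} = {z. ((2 / 3) *\<^sub>R e) \<bullet> z = c}"
    by (auto simp: edge_fn_def inner_complex_def algebra_simps)
  have "e \<noteq> 0" using sqn_min_vec[OF assms] by (auto simp: sqn_def)
  then have "negligible {z. edge_fn z e = c}" unfolding eq by (intro negligible_hyperplane) auto
  moreover have "{z. edge_fn z e = c} \<in> sets borel" by measurable
  ultimately show ?thesis using AE_not_in_negligible by fastforce
qed

lemma AE_circle_neq:
  assumes "e \<in> min_vecs" shows "AE z in lborel. sqn z \<noteq> edge_fn z e" "AE z in lborel. sqn z + 1 \<noteq> 2 * edge_fn z e"
proof -
  have *: "AE z in lborel. z \<notin> sphere a r" for a :: complex and r
    by (rule AE_not_in_negligible) (auto simp: negligible_sphere)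
  have 1: "z \<in> sphere (e / 3) rad" if "sqn z = edge_fn z e" for z
    using inner_circle[OF assms, of z] that by (simp add: dist_norm norm_minus_commute)
  have 2: "z \<in> sphere (2 / 3 * e) rad" if "sqn z + 1 = 2 * edge_fn z e" for z
    using outer_circle[OF assms, of z] that unfolding mem_sphere dist_norm norm_minus_commute[of "2 / 3 * e" z] by linarith
  show "AE z in lborel. sqn z \<noteq> edge_fn z e"
    using *[of "e / 3" rad] by eventually_elim (use 1 in blast)
  show "AE z in lborel. sqn z + 1 \<noteq> 2 * edge_fn z e"
    using *[of "2 / 3 * e" rad] by eventually_elim (use 2 in blast)
qed

lemma AE_generic: "AE z in lborel. generic z"
  unfolding generic_def
  by (intro AE_finite_allI finite_min_vecs AE_conjI AE_edge_fn_neq AE_circle_neq)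

text \<open>The density in the inversion formula is positive off 0, so null sets have null
  preimages.\<close>

lemma AE_inverse:
  assumes "AE z in lborel. P (z :: complex)"
  shows "AE z in lborel. P (1 / z)"
proof -
  obtain N where N: "{z \<in> space lborel. \<not> P z} \<subseteq> N" "emeasure lborel N = 0" "N \<in> sets lborel"
    using AE_E[OF assms] by blast
  have [measurable]: "N \<in> sets borel" using N(3) by simp
  have "(\<integral>\<^sup>+z. indicator N (1 / z) * ennreal (1 / cmod z ^ 4) \<partial>lborel) = (\<integral>\<^sup>+z. indicator N z \<partial>lborel)"
    by (rule nn_integral_inverse_complex) measurable
  also have "\<dots> = 0" using N by simp
  finally have "AE z in lborel. indicator N (1 / z) * ennreal (1 / cmod z ^ 4) = 0"
    by (subst (asm) nn_integral_0_iff_AE) auto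
  with AE_lborel_singleton[of 0] show ?thesis
  proof eventually_elim
    case (elim z)
    then have "1 / z \<notin> N" by (auto simp: indicator_def ennreal_eq_0_iff not_le split: if_splits)
    then show ?case using N(1) by auto
  qed
qed

lemma AE_translate:
  assumes "AE z in lborel. P (z :: complex)"
  shows "AE z in lborel. P (z - b)"
proof -
  have "AE z in distr lborel borel ((+) (- b)). P z"
    using assms by (simp only: lborel_distr_plus)
  then have "AE z in lborel. P (- b + z)" by (intro AE_distrD[of "(+) (- b)" lborel borel P]) auto
  then show ?thesis by (simp add: algebra_simps)
qed

lemma AE_fst:
  assumes "AE z in lborel. P (z :: complex)"
  shows "AE p in lborel \<Otimes>\<^sub>M (lborel :: complex measure). P (fst p)"
proof -
  obtain N where N: "{z \<in> space lborel. \<not> P z} \<subseteq> N" "emeasure lborel N = 0" "N \<in> sets lborel"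
    using AE_E[OF assms] by blast
  have "N \<in> null_sets lborel" using N by auto
  then have "N \<times> (UNIV :: complex set) \<in> null_sets (lborel \<Otimes>\<^sub>M lborel)" by (intro lborel.times_in_null_sets1) auto
  then have "AE p in lborel \<Otimes>\<^sub>M (lborel :: complex measure). p \<notin> N \<times> UNIV" by (rule AE_not_in)
  then show ?thesis by eventually_elim (use N(1) in auto)
qed

text \<open>Left unnormalized, and living on the whole product: the restriction to
  \<open>nat_ext\<close> sits in the density, so the branches are total measurable maps of its
  space.\<close>

definition ext_measure :: "(complex \<times> complex) measure" where
  "ext_measure = density (lborel \<Otimes>\<^sub>M lborel) (\<lambda>p. indicator nat_ext p * kernel_hat p)"

lemma sets_ext_measure [measurable_cong, simp]: "sets ext_measure = sets (borel \<Otimes>\<^sub>M borel)"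
  by (simp add: ext_measure_def sets_pair_lborel)

lemma space_ext_measure [simp]: "space ext_measure = UNIV"
  by (simp add: ext_measure_def space_pair_measure)

lemma nat_ext_cmod: "(z, w) \<in> nat_ext \<Longrightarrow> cmod z < 1" "(z, w) \<in> nat_ext \<Longrightarrow> 1 < cmod w"
  using hexagon_cmod_less dual_circles(3)[OF some_min_vecs(1)] by (auto simp: nat_ext_def)

lemma kernel_hat_pos: "p \<in> nat_ext \<Longrightarrow> 0 < kernel_hat p"
proof -
  assume p: "p \<in> nat_ext"
  obtain z w where zw: "p = (z, w)" by (cases p)
  have "z \<noteq> w" using nat_ext_cmod[of z w] p zw by auto
  then show ?thesis by (simp add: zw kernel_hat_def)
qed

lemma AE_ext_measure: "(AE p in ext_measure. P p) \<longleftrightarrow> (AE p in lborel \<Otimes>\<^sub>M lborel. p \<in> nat_ext \<longrightarrow> P p)"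
proof -
  have "(\<lambda>p. indicator nat_ext p * kernel_hat p) \<in> borel_measurable (lborel \<Otimes>\<^sub>M lborel)" by measurable
  moreover have "0 < indicator nat_ext p * kernel_hat p \<longleftrightarrow> p \<in> nat_ext" for p
    using kernel_hat_pos[of p] by (auto simp: indicator_def)
  ultimately show ?thesis unfolding ext_measure_def by (simp add: AE_density)
qed

lemma nn_integral_ext_measure:
  assumes "f \<in> borel_measurable (borel \<Otimes>\<^sub>M borel)"
  shows "(\<integral>\<^sup>+p. f p \<partial>ext_measure) = (\<integral>\<^sup>+p. indicator nat_ext p * kernel_hat p * f p \<partial>(lborel \<Otimes>\<^sub>M lborel))"
proof -
  have [measurable]: "f \<in> borel_measurable (lborel \<Otimes>\<^sub>M lborel)"
    using assms by (simp add: measurable_cong_sets[OF sets_pair_lborel refl])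
  show ?thesis unfolding ext_measure_def by (rule nn_integral_density) measurable
qed

lemma ext_measure_log_finite: "(\<integral>\<^sup>+p. ennreal (1 + ln (cmod (snd p))) \<partial>ext_measure) < \<infinity>"
proof -
  have "(\<integral>\<^sup>+p. ennreal (1 + ln (cmod (snd p))) \<partial>ext_measure)
     = (\<integral>\<^sup>+p. indicator nat_ext p * kernel_hat p * ennreal (1 + ln (cmod (snd p))) \<partial>(lborel \<Otimes>\<^sub>M lborel))"
    by (rule nn_integral_ext_measure) measurable
  then show ?thesis using nat_ext_log_integral_finite by (simp add: mult_ac)
qed

lemma AE_in_nat_ext: "AE p in ext_measure. p \<in> nat_ext"
  by (simp add: AE_ext_measure)

lemma finite_ext_measure: "finite_measure ext_measure"
proof
  have "emeasure ext_measure (space ext_measure) = (\<integral>\<^sup>+p. 1 \<partial>ext_measure)" by simp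
  also have "\<dots> \<le> (\<integral>\<^sup>+p. ennreal (1 + ln (cmod (snd p))) \<partial>ext_measure)"
  proof (rule nn_integral_mono_AE)
    show "AE p in ext_measure. 1 \<le> ennreal (1 + ln (cmod (snd p)))"
      using AE_in_nat_ext
    proof eventually_elim
      case (elim p)
      then have "1 < cmod (snd p)" using nat_ext_cmod[of "fst p" "snd p"] by simp
      then have "1 \<le> 1 + ln (cmod (snd p))" by (simp add: ln_ge_zero)
      then show ?case by (metis ennreal_1 ennreal_leI)
    qed
  qed
  also have "\<dots> < \<infinity>" by (rule ext_measure_log_finite)
  finally show "emeasure ext_measure (space ext_measure) \<noteq> \<infinity>" by simp
qed

lemma integrable_log_ext_measure: "integrable ext_measure (\<lambda>p. ln (cmod (snd p)))"
proof (rule integrableI_bounded)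
  have "(\<integral>\<^sup>+p. ennreal (norm (ln (cmod (snd p)))) \<partial>ext_measure) \<le> (\<integral>\<^sup>+p. ennreal (1 + ln (cmod (snd p))) \<partial>ext_measure)"
  proof (rule nn_integral_mono_AE)
    show "AE p in ext_measure. ennreal (norm (ln (cmod (snd p)))) \<le> ennreal (1 + ln (cmod (snd p)))"
      using AE_in_nat_ext
    proof eventually_elim
      case (elim p)
      then have "1 < cmod (snd p)" using nat_ext_cmod[of "fst p" "snd p"] by simp
      then have "0 \<le> ln (cmod (snd p))" by (simp add: ln_ge_zero)
      then show ?case by (intro ennreal_leI) simp
    qed
  qed
  also have "\<dots> < \<infinity>" by (rule ext_measure_log_finite)
  finally show "(\<integral>\<^sup>+p. ennreal (norm (ln (cmod (snd p)))) \<partial>ext_measure) < \<infinity>" .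
qed measurable

section \<open>The branches and their inverses\<close>

definition fwd :: "complex \<Rightarrow> complex \<times> complex \<Rightarrow> complex \<times> complex" where
  "fwd b p = (1 / fst p - b, 1 / snd p - b)"

definition bwd :: "complex \<Rightarrow> complex \<times> complex \<Rightarrow> complex \<times> complex" where
  "bwd b p = (1 / (fst p + b), 1 / (snd p + b))"

lemma measurable_fwd [measurable]: "fwd b \<in> measurable (borel \<Otimes>\<^sub>M borel) (borel \<Otimes>\<^sub>M borel)"
  unfolding fwd_def[abs_def] by measurable

lemma measurable_bwd [measurable]: "bwd b \<in> measurable (borel \<Otimes>\<^sub>M borel) (borel \<Otimes>\<^sub>M borel)"
  unfolding bwd_def[abs_def] by measurable

lemma bwd_fwd: "fst p \<noteq> 0 \<Longrightarrow> snd p \<noteq> 0 \<Longrightarrow> bwd b (fwd b p) = p"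
  by (simp add: bwd_def fwd_def)

lemma fwd_bwd: "fwd b (bwd b p) = p"
  by (simp add: bwd_def fwd_def)

definition fwd_dom :: "complex \<Rightarrow> (complex \<times> complex) set" where
  "fwd_dom b = {p \<in> nat_ext. fwd b p \<in> nat_ext}"

definition bwd_dom :: "complex \<Rightarrow> (complex \<times> complex) set" where
  "bwd_dom b = {p \<in> nat_ext. bwd b p \<in> nat_ext}"

lemma fwd_dom_measurable [measurable]: "fwd_dom b \<in> sets (borel \<Otimes>\<^sub>M borel)"
proof -
  have "fwd_dom b = {p \<in> space (borel \<Otimes>\<^sub>M borel). p \<in> nat_ext \<and> fwd b p \<in> nat_ext}" by (auto simp: fwd_dom_def space_pair_measure)
  also have "\<dots> \<in> sets (borel \<Otimes>\<^sub>M borel)" by measurable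
  finally show ?thesis .
qed

lemma bwd_dom_measurable [measurable]: "bwd_dom b \<in> sets (borel \<Otimes>\<^sub>M borel)"
proof -
  have "bwd_dom b = {p \<in> space (borel \<Otimes>\<^sub>M borel). p \<in> nat_ext \<and> bwd b p \<in> nat_ext}" by (auto simp: bwd_dom_def space_pair_measure)
  also have "\<dots> \<in> sets (borel \<Otimes>\<^sub>M borel)" by measurable
  finally show ?thesis .
qed

lemma nat_ext_nonzero': "p \<in> nat_ext \<Longrightarrow> fst p \<noteq> 0 \<and> snd p \<noteq> 0"
  using nat_ext_nonzero[of "fst p" "snd p"] by simp

lemma fwd_in_bwd_dom: "p \<in> fwd_dom b \<Longrightarrow> fwd b p \<in> bwd_dom b"
  using nat_ext_nonzero'[of p] by (simp add: fwd_dom_def bwd_dom_def bwd_fwd)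

lemma bwd_in_fwd_dom: "p \<in> bwd_dom b \<Longrightarrow> bwd b p \<in> fwd_dom b"
  by (simp add: fwd_dom_def bwd_dom_def fwd_bwd)

lemma disjoint_fwd_dom: "disjoint_family_on fwd_dom ideal_J"
  unfolding disjoint_family_on_def
proof (intro ballI impI)
  fix a b assume ab: "a \<in> ideal_J" "b \<in> ideal_J" "a \<noteq> b"
  have False if p: "p \<in> fwd_dom a" "p \<in> fwd_dom b" for p
  proof -
    have "1 / fst p - a \<in> hexagon" "1 / fst p - b \<in> hexagon"
      using p by (auto simp: fwd_dom_def fwd_def nat_ext_def)
    then show False using nearest_J_eqI[OF ab(1)] nearest_J_eqI[OF ab(2)] ab(3) by metis
  qed
  then show "fwd_dom a \<inter> fwd_dom b = {}" by blast
qed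

lemma disjoint_bwd_dom: "disjoint_family_on bwd_dom ideal_J"
  unfolding disjoint_family_on_def
proof (intro ballI impI)
  fix a b assume ab: "a \<in> ideal_J" "b \<in> ideal_J" "a \<noteq> b"
  have False if p: "p \<in> bwd_dom a" "p \<in> bwd_dom b" for p
  proof -
    have "(1 / (fst p + a), 1 / (snd p + a)) \<in> nat_ext" "(1 / (fst p + b), 1 / (snd p + b)) \<in> nat_ext"
      using p by (auto simp: bwd_dom_def bwd_def)
    from nat_ext_inj[OF this ab(1,2)] ab(3) show False by simp
  qed
  then show "bwd_dom a \<inter> bwd_dom b = {}" by blast
qed

lemma nn_integral_pair_inverse:
  assumes [measurable]: "g \<in> borel_measurable (borel \<Otimes>\<^sub>M borel)"
  shows "(\<integral>\<^sup>+p. g (fwd b p) * (ennreal (1 / cmod (fst p) ^ 4) * ennreal (1 / cmod (snd p) ^ 4)) \<partial>(lborel \<Otimes>\<^sub>M lborel))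
     = (\<integral>\<^sup>+p. g p \<partial>(lborel \<Otimes>\<^sub>M lborel))"
proof -
  have one: "(\<integral>\<^sup>+z. h (1 / z - b) * ennreal (1 / cmod z ^ 4) \<partial>lborel) = (\<integral>\<^sup>+z. h z \<partial>lborel)"
    if [measurable]: "h \<in> borel_measurable borel" for h :: "complex \<Rightarrow> ennreal"
  proof -
    have "(\<integral>\<^sup>+z. h (1 / z - b) * ennreal (1 / cmod z ^ 4) \<partial>lborel) = (\<integral>\<^sup>+z. h (z - b) \<partial>lborel)"
      by (rule nn_integral_inverse_complex) measurable
    also have "\<dots> = (\<integral>\<^sup>+z. h z \<partial>distr lborel borel ((+) (- b)))"
      by (subst nn_integral_distr) auto
    also have "\<dots> = (\<integral>\<^sup>+z. h z \<partial>lborel)" by (simp only: lborel_distr_plus)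
    finally show ?thesis .
  qed
  have "(\<integral>\<^sup>+p. g (fwd b p) * (ennreal (1 / cmod (fst p) ^ 4) * ennreal (1 / cmod (snd p) ^ 4)) \<partial>(lborel \<Otimes>\<^sub>M lborel))
     = (\<integral>\<^sup>+z. \<integral>\<^sup>+w. g (1 / z - b, 1 / w - b) * (ennreal (1 / cmod z ^ 4) * ennreal (1 / cmod w ^ 4)) \<partial>lborel \<partial>lborel)"
    by (subst lborel.nn_integral_fst[symmetric]) (auto simp: fwd_def)
  also have "\<dots> = (\<integral>\<^sup>+z. (\<integral>\<^sup>+w. g (1 / z - b, 1 / w - b) * ennreal (1 / cmod w ^ 4) \<partial>lborel) * ennreal (1 / cmod z ^ 4) \<partial>lborel)"
    by (intro nn_integral_cong, subst nn_integral_multc[symmetric]) (auto simp: mult_ac)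
  also have "\<dots> = (\<integral>\<^sup>+z. (\<integral>\<^sup>+w. g (1 / z - b, w) \<partial>lborel) * ennreal (1 / cmod z ^ 4) \<partial>lborel)"
    by (intro nn_integral_cong arg_cong2[where f = "(*)"] refl one) measurable
  also have "\<dots> = (\<integral>\<^sup>+z. \<integral>\<^sup>+w. g (z, w) \<partial>lborel \<partial>lborel)"
    by (rule one) measurable
  also have "\<dots> = (\<integral>\<^sup>+p. g p \<partial>(lborel \<Otimes>\<^sub>M lborel))"
    by (rule lborel.nn_integral_fst) measurable
  finally show ?thesis .
qed

text \<open>The images differ by \<open>(w - z) / (z * w)\<close>; the fourth powers of
  \<open>cmod z\<close> and \<open>cmod w\<close> are cancelled exactly by the Jacobians of the two
  inversions.\<close>

lemma kernel_hat_fwd: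
  assumes "z \<noteq> 0" "w \<noteq> 0" "z \<noteq> w"
  shows "kernel_hat (fwd b (z, w)) * (ennreal (1 / cmod z ^ 4) * ennreal (1 / cmod w ^ 4)) = kernel_hat (z, w)"
proof -
  have "(1 / z - b) - (1 / w - b) = (w - z) / (z * w)" using assms by (simp add: field_simps)
  then have "cmod ((1 / z - b) - (1 / w - b)) = cmod (z - w) / (cmod z * cmod w)"
    by (simp add: norm_divide norm_mult norm_minus_commute)
  then have "1 / cmod ((1 / z - b) - (1 / w - b)) ^ 4 * (1 / cmod z ^ 4 * (1 / cmod w ^ 4)) = 1 / cmod (z - w) ^ 4"
    using assms by (simp add: power_divide power_mult_distrib)
  then show ?thesis by (simp add: kernel_hat_def fwd_def ennreal_mult'[symmetric])
qed

lemma emeasure_fwd: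
  assumes A: "A \<in> sets ext_measure"
  shows "emeasure ext_measure (fwd_dom b \<inter> fwd b -` A) = emeasure ext_measure (bwd_dom b \<inter> A)"
proof -
  have [measurable]: "A \<in> sets (borel \<Otimes>\<^sub>M borel)" using A by simp
  define g where "g p = indicator nat_ext p * kernel_hat p * indicator (bwd_dom b \<inter> A) p" for p
  have gm [measurable]: "g \<in> borel_measurable (borel \<Otimes>\<^sub>M borel)" unfolding g_def by measurable
  have pre [measurable]: "fwd_dom b \<inter> fwd b -` A \<in> sets (borel \<Otimes>\<^sub>M borel)"
  proof -
    have "fwd_dom b \<inter> fwd b -` A = fwd_dom b \<inter> (fwd b -` A \<inter> space (borel \<Otimes>\<^sub>M borel))"
      by (auto simp: space_pair_measure)
    also have "\<dots> \<in> sets (borel \<Otimes>\<^sub>M borel)" by measurable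
    finally show ?thesis .
  qed
  have "emeasure ext_measure (fwd_dom b \<inter> fwd b -` A) = (\<integral>\<^sup>+p. indicator (fwd_dom b \<inter> fwd b -` A) p \<partial>ext_measure)"
    by (rule nn_integral_indicator[symmetric]) simp
  also have "\<dots> = (\<integral>\<^sup>+p. indicator nat_ext p * kernel_hat p * indicator (fwd_dom b \<inter> fwd b -` A) p \<partial>(lborel \<Otimes>\<^sub>M lborel))"
    by (rule nn_integral_ext_measure) measurable
  also have "\<dots> = (\<integral>\<^sup>+p. g (fwd b p) * (ennreal (1 / cmod (fst p) ^ 4) * ennreal (1 / cmod (snd p) ^ 4)) \<partial>(lborel \<Otimes>\<^sub>M lborel))"
  proof (rule nn_integral_cong)
    fix p :: "complex \<times> complex"
    obtain z w where p: "p = (z, w)" by (cases p)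
    show "indicator nat_ext p * kernel_hat p * indicator (fwd_dom b \<inter> fwd b -` A) p
       = g (fwd b p) * (ennreal (1 / cmod (fst p) ^ 4) * ennreal (1 / cmod (snd p) ^ 4))"
    proof (cases "z = 0 \<or> w = 0")
      case True
      then have "p \<notin> nat_ext" using nat_ext_nonzero' p by fastforce
      then show ?thesis using True by (auto simp: p)
    next
      case False
      then have bf: "bwd b (fwd b p) = p" by (intro bwd_fwd) (auto simp: p)
      show ?thesis
      proof (cases "p \<in> fwd_dom b \<and> fwd b p \<in> A")
        case True
        then have "z \<noteq> w" using nat_ext_cmod[of z w] by (auto simp: p fwd_dom_def)
        then show ?thesis using True False kernel_hat_fwd[of z w b] bf
          by (simp add: g_def p fwd_dom_def bwd_dom_def)
      next
        case False
        then have "\<not> (fwd b p \<in> nat_ext \<and> fwd b p \<in> bwd_dom b \<inter> A)"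
          using bf by (auto simp: bwd_dom_def fwd_dom_def)
        then have "g (fwd b p) = 0" by (auto simp: g_def indicator_def)
        moreover have "indicator (fwd_dom b \<inter> fwd b -` A) p = (0 :: ennreal)" using False by (auto simp: indicator_def)
        ultimately show ?thesis by simp
      qed
    qed
  qed
  also have "\<dots> = (\<integral>\<^sup>+p. g p \<partial>(lborel \<Otimes>\<^sub>M lborel))" by (rule nn_integral_pair_inverse) measurable
  also have "\<dots> = (\<integral>\<^sup>+p. indicator (bwd_dom b \<inter> A) p \<partial>ext_measure)"
    unfolding g_def by (rule nn_integral_ext_measure[symmetric]) measurable
  also have "\<dots> = emeasure ext_measure (bwd_dom b \<inter> A)" by (rule nn_integral_indicator) simp
  finally show ?thesis .
qed

text \<open>This is \<open>emeasure_fwd\<close> for the preimage of \<open>A\<close> under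
  \<open>bwd b\<close>, which inverts \<open>fwd b\<close> on its domain.\<close>

lemma emeasure_bwd:
  assumes A: "A \<in> sets ext_measure"
  shows "emeasure ext_measure (bwd_dom b \<inter> bwd b -` A) = emeasure ext_measure (fwd_dom b \<inter> A)"
proof -
  have "bwd b -` A \<in> sets ext_measure"
    using measurable_sets[OF measurable_bwd, of A b] A by (simp add: space_pair_measure)
  from emeasure_fwd[OF this, of b]
  have "emeasure ext_measure (bwd_dom b \<inter> bwd b -` A) = emeasure ext_measure (fwd_dom b \<inter> fwd b -` (bwd b -` A))" ..
  also have "fwd_dom b \<inter> fwd b -` (bwd b -` A) = fwd_dom b \<inter> A"
  proof -
    have "bwd b (fwd b p) = p" if "p \<in> fwd_dom b" for p
      using nat_ext_nonzero'[of p] that by (simp add: fwd_dom_def bwd_fwd)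
    then have "x \<in> fwd_dom b \<inter> fwd b -` (bwd b -` A) \<longleftrightarrow> x \<in> fwd_dom b \<inter> A" for x
      by (cases "x \<in> fwd_dom b") simp_all
    then show ?thesis by (rule set_eqI)
  qed
  finally show ?thesis .
qed

text \<open>The closed hexagons cover the plane, so a digit exists; for almost every
  \<open>z\<close> all the countably many points \<open>1 / z - b\<close> are generic, which moves
  the remainder into the open hexagon and off the circles.\<close>

lemma AE_fwd_dom: "AE p in ext_measure. p \<in> (\<Union>b\<in>ideal_J. fwd_dom b)"
proof -
  have "AE z in lborel. \<forall>b\<in>ideal_J. generic (1 / z - b)"
    using AE_inverse[OF AE_translate[OF AE_generic]]
    by (intro AE_ball_countable'[OF _ countable_ideal_J]) auto
  from AE_fst[OF this] have "AE p in lborel \<Otimes>\<^sub>M (lborel :: complex measure). p \<in> nat_ext \<longrightarrow> p \<in> (\<Union>b\<in>ideal_J. fwd_dom b)"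
  proof eventually_elim
    case (elim p)
    show ?case
    proof
      assume p: "p \<in> nat_ext"
      obtain b where b: "b \<in> ideal_J" "1 / fst p - b \<in> cl_hexagon" by (rule cl_hexagon_covers)
      have g: "generic (1 / fst p - b)" using elim b by blast
      then have h: "1 / fst p - b \<in> hexagon"
        using b(2) by (force simp: hexagon_def cl_hexagon_def generic_def less_le)
      have "(1 / fst p - b, 1 / snd p - b) \<in> nat_ext"
        by (rule nat_ext_into[OF _ b(1) h]) (use p g in \<open>auto simp: generic_def\<close>)
      then show "p \<in> (\<Union>b\<in>ideal_J. fwd_dom b)" using p b(1) by (auto simp: fwd_dom_def fwd_def)
    qed
  qed
  then show ?thesis by (simp add: AE_ext_measure)
qed

text \<open>The images of the branches are disjoint and have the full (finite) mass, hence they cover.\<close>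
lemma AE_bwd_dom: "AE p in ext_measure. p \<in> (\<Union>b\<in>ideal_J. bwd_dom b)"
proof -
  interpret finite_measure ext_measure by (rule finite_ext_measure)
  have [simp]: "fwd_dom b \<in> sets ext_measure" "bwd_dom b \<in> sets ext_measure" for b by simp_all
  have UN: "(\<Union>b\<in>ideal_J. fwd_dom b) \<in> sets ext_measure" "(\<Union>b\<in>ideal_J. bwd_dom b) \<in> sets ext_measure"
    by (auto intro!: sets.countable_UN' countable_ideal_J)
  have "emeasure ext_measure (\<Union>b\<in>ideal_J. bwd_dom b) = (\<integral>\<^sup>+b. emeasure ext_measure (bwd_dom b) \<partial>count_space ideal_J)"
    by (rule emeasure_UN_countable) (auto simp: countable_ideal_J disjoint_bwd_dom)
  also have "\<dots> = (\<integral>\<^sup>+b. emeasure ext_measure (fwd_dom b) \<partial>count_space ideal_J)"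
  proof -
    have "UNIV \<in> sets ext_measure" by (metis sets.top space_ext_measure)
    from emeasure_fwd[OF this] show ?thesis by simp
  qed
  also have "\<dots> = emeasure ext_measure (\<Union>b\<in>ideal_J. fwd_dom b)"
    by (rule emeasure_UN_countable[symmetric]) (auto simp: countable_ideal_J disjoint_fwd_dom)
  also have "\<dots> = emeasure ext_measure (space ext_measure)"
  proof (rule emeasure_eq_AE)
    show "AE p in ext_measure. p \<in> (\<Union>b\<in>ideal_J. fwd_dom b) \<longleftrightarrow> p \<in> space ext_measure"
      using AE_fwd_dom by eventually_elim simp
  qed (rule UN sets.top)+
  finally have "emeasure ext_measure (space ext_measure - (\<Union>b\<in>ideal_J. bwd_dom b)) = 0"
    using emeasure_compl[OF UN(2)] by simp
  then have "space ext_measure - (\<Union>b\<in>ideal_J. bwd_dom b) \<in> null_sets ext_measure"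
    by (rule null_setsI[OF _ sets.Diff[OF sets.top UN(2)]])
  from AE_not_in[OF this] show ?thesis by eventually_elim auto
qed

definition ext_map :: "complex \<times> complex \<Rightarrow> complex \<times> complex" where
  "ext_map = piecewise_map ideal_J fwd_dom fwd"

definition ext_inv :: "complex \<times> complex \<Rightarrow> complex \<times> complex" where
  "ext_inv = piecewise_map ideal_J bwd_dom bwd"

lemma ext_map_eq: "b \<in> ideal_J \<Longrightarrow> p \<in> fwd_dom b \<Longrightarrow> ext_map p = fwd b p"
  unfolding ext_map_def by (rule piecewise_map_eq[OF disjoint_fwd_dom])

lemma ext_inv_eq: "b \<in> ideal_J \<Longrightarrow> p \<in> bwd_dom b \<Longrightarrow> ext_inv p = bwd b p"
  unfolding ext_inv_def by (rule piecewise_map_eq[OF disjoint_bwd_dom])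

lemma measurable_ext_measure: "measurable ext_measure ext_measure = measurable (borel \<Otimes>\<^sub>M borel) (borel \<Otimes>\<^sub>M borel)"
  by (rule measurable_cong_sets) simp_all

lemma ext_map_preserving: "measure_preserving_self ext_measure ext_map"
  unfolding ext_map_def
  by (rule piecewise_map_preserving[OF countable_ideal_J disjoint_fwd_dom disjoint_bwd_dom _ _ _ AE_fwd_dom AE_bwd_dom emeasure_fwd])
    (simp_all add: measurable_ext_measure)

lemma ext_inv_preserving: "measure_preserving_self ext_measure ext_inv"
  unfolding ext_inv_def
  by (rule piecewise_map_preserving[OF countable_ideal_J disjoint_bwd_dom disjoint_fwd_dom _ _ _ AE_bwd_dom AE_fwd_dom emeasure_bwd])
    (simp_all add: measurable_ext_measure)

lemma AE_ext_inv_map: "AE p in ext_measure. ext_inv (ext_map p) = p"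
  using AE_fwd_dom
proof eventually_elim
  case (elim p)
  then obtain b where b: "b \<in> ideal_J" "p \<in> fwd_dom b" by blast
  then have "p \<in> nat_ext" by (simp add: fwd_dom_def)
  then show ?case using b ext_inv_eq[OF b(1) fwd_in_bwd_dom[OF b(2)]] nat_ext_nonzero'[of p]
    by (simp add: ext_map_eq bwd_fwd)
qed

lemma AE_ext_map_inv: "AE p in ext_measure. ext_map (ext_inv p) = p"
  using AE_bwd_dom
proof eventually_elim
  case (elim p)
  then obtain b where b: "b \<in> ideal_J" "p \<in> bwd_dom b" by blast
  then show ?case using ext_map_eq[OF b(1) bwd_in_fwd_dom[OF b(2)]] by (simp add: ext_inv_eq fwd_bwd)
qed

section \<open>Growth of the denominators\<close>

abbreviation log_snd :: "complex \<times> complex \<Rightarrow> real" where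
  "log_snd p \<equiv> ln (cmod (snd p))"

lemma ext_map_T_map:
  assumes "p \<in> (\<Union>b\<in>ideal_J. fwd_dom b)"
  shows "fst (ext_map p) = T_map (fst p)" "ext_map p = fwd (nearest_J (1 / fst p)) p" "p \<in> nat_ext"
proof -
  obtain b where b: "b \<in> ideal_J" "p \<in> fwd_dom b" using assms by blast
  then have W: "p \<in> nat_ext" "1 / fst p - b \<in> hexagon" by (auto simp: fwd_dom_def fwd_def nat_ext_def)
  have n: "nearest_J (1 / fst p) = b" by (rule nearest_J_eqI[OF b(1) W(2)])
  show "ext_map p = fwd (nearest_J (1 / fst p)) p" unfolding n by (rule ext_map_eq[OF b])
  then show "fst (ext_map p) = T_map (fst p)"
    using nat_ext_nonzero'[OF W(1)] by (simp add: fwd_def T_map_def)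
  show "p \<in> nat_ext" by (rule W)
qed

text \<open>Since \<open>x m * x (Suc m) = 1 - b * x m\<close> along either orbit, the products
  satisfy a two-step recursion, which after alternating signs is that of the denominators; hence the
  induction over two consecutive indices.\<close>

lemma q_shift_prod:
  fixes a c :: "nat \<Rightarrow> complex"
  assumes a: "\<And>k. a k \<noteq> 0" "\<And>k. a (Suc k) = 1 / a k - b_digit (Suc k) z"
    and c: "\<And>k. c k \<noteq> 0" "\<And>k. c (Suc k) = 1 / c k - b_digit (Suc k) z"
  shows "q_shift m z * (c 0 - a 0) = (- 1) ^ Suc m * ((\<Prod>k<m. c k) - (\<Prod>k<m. a k))"
proof -
  let ?P = "\<lambda>m. q_shift m z * (c 0 - a 0) = (- 1) ^ Suc m * ((\<Prod>k<m. c k) - (\<Prod>k<m. a k))"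
  have "?P m \<and> ?P (Suc m)"
  proof (induction m)
    case (Suc m)
    let ?b = "b_digit (Suc m) z"
    have rec: "(\<Prod>k<Suc (Suc m). x k) = (\<Prod>k<m. x k) - ?b * (\<Prod>k<Suc m. x k)"
      if "x m \<noteq> 0" "x (Suc m) = 1 / x m - ?b" for x :: "nat \<Rightarrow> complex"
    proof -
      have "x m * x (Suc m) = 1 - ?b * x m" using that by (simp add: right_diff_distrib)
      moreover have "(\<Prod>k<Suc (Suc m). x k) = (\<Prod>k<m. x k) * (x m * x (Suc m))" by simp
      ultimately show ?thesis by (simp only: prod.lessThan_Suc) (simp add: algebra_simps)
    qed
    have "q_shift (Suc (Suc m)) z * (c 0 - a 0) = ?b * (q_shift (Suc m) z * (c 0 - a 0)) + q_shift m z * (c 0 - a 0)"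
      by (simp add: algebra_simps)
    also have "\<dots> = ?b * ((- 1) ^ Suc (Suc m) * ((\<Prod>k<Suc m. c k) - (\<Prod>k<Suc m. a k)))
        + (- 1) ^ Suc m * ((\<Prod>k<m. c k) - (\<Prod>k<m. a k))"
      by (simp only: Suc.IH[THEN conjunct1] Suc.IH[THEN conjunct2])
    also have "\<dots> = (- 1) ^ Suc (Suc (Suc m)) * (((\<Prod>k<m. c k) - ?b * (\<Prod>k<Suc m. c k))
        - ((\<Prod>k<m. a k) - ?b * (\<Prod>k<Suc m. a k)))"
      by (simp add: algebra_simps del: prod.lessThan_Suc)
    also have "\<dots> = (- 1) ^ Suc (Suc (Suc m)) * ((\<Prod>k<Suc (Suc m). c k) - (\<Prod>k<Suc (Suc m). a k))"
      by (simp only: rec[OF c] rec[OF a])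
    finally show ?case using Suc.IH by simp
  qed simp
  then show ?thesis by simp
qed

text \<open>The first factor alone gives a bound below 1 that is uniform in \<open>n\<close>; this
  keeps the bracket in the formula for the denominators away from 0.\<close>

lemma prod_ratio_bound:
  fixes a c :: "nat \<Rightarrow> complex"
  assumes "\<And>k. cmod (a k) < 1" "\<And>k. 1 < cmod (c k)"
  shows "cmod ((\<Prod>k<Suc n. a k) / (\<Prod>k<Suc n. c k)) \<le> cmod (a 0)"
proof (induction n)
  case 0
  have "cmod (a 0) / cmod (c 0) \<le> cmod (a 0) / 1" using assms(2)[of 0] by (intro divide_left_mono) auto
  then show ?case by (simp add: norm_divide)
next
  case (Suc n)
  have eq: "(\<Prod>k<Suc (Suc n). a k) / (\<Prod>k<Suc (Suc n). c k)
      = ((\<Prod>k<Suc n. a k) / (\<Prod>k<Suc n. c k)) * (a (Suc n) / c (Suc n))" by simp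
  have "cmod (a (Suc n) / c (Suc n)) \<le> 1"
    using assms(1)[of "Suc n"] assms(2)[of "Suc n"] by (simp add: norm_divide divide_le_eq_1)
  then have "cmod ((\<Prod>k<Suc n. a k) / (\<Prod>k<Suc n. c k)) * cmod (a (Suc n) / c (Suc n)) \<le> cmod (a 0) * 1"
    using Suc.IH by (intro mult_mono) auto
  then show ?case unfolding eq norm_mult by simp
qed

text \<open>With \<open>\<rho>\<close> the quotient of the two products,
  \<open>cmod (1 - \<rho>)\<close> stays between \<open>1 - cmod (a 0)\<close> and 2. The bound
  \<open>K\<close> depends on the starting point but not on \<open>n\<close>; the sum has
  \<open>n + 1\<close> terms, for the indices 0 to \<open>n\<close>.\<close>

lemma log_q_denom_bounded:
  assumes orb: "\<And>k. (ext_map ^^ k) p \<in> (\<Union>b\<in>ideal_J. fwd_dom b)"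
  obtains K where "\<And>n. \<bar>ln (cmod (q_denom n (fst p))) - birkhoff_sum ext_map log_snd (Suc n) p\<bar> \<le> K"
proof -
  define z where "z = fst p"
  define a c where "a k = fst ((ext_map ^^ k) p)" and "c k = snd ((ext_map ^^ k) p)" for k
  have ne: "(a k, c k) \<in> nat_ext" for k using ext_map_T_map(3)[OF orb[of k]] by (simp add: a_def c_def)
  have aT: "a k = (T_map ^^ k) z" for k
  proof (induction k)
    case (Suc k)
    have "a (Suc k) = T_map (a k)" using ext_map_T_map(1)[OF orb[of k]] by (simp add: a_def)
    then show ?case using Suc by simp
  qed (simp add: a_def z_def)
  have digit: "b_digit (Suc k) z = nearest_J (1 / a k)" for k by (simp add: b_digit_def aT)
  have a1: "cmod (a k) < 1" and c1: "1 < cmod (c k)" for k using nat_ext_cmod[OF ne[of k]] by auto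
  have a0: "a k \<noteq> 0" and c0: "c k \<noteq> 0" for k using nat_ext_nonzero[OF ne[of k]] by auto
  have step: "a (Suc k) = 1 / a k - b_digit (Suc k) z" "c (Suc k) = 1 / c k - b_digit (Suc k) z" for k
    using ext_map_T_map(2)[OF orb[of k]] unfolding digit by (simp_all add: a_def c_def fwd_def)
  define r where "r = cmod (a 0)"
  have r: "r < 1" using a1[of 0] by (simp add: r_def)
  define D where "D = cmod (c 0 - a 0)"
  have "c 0 \<noteq> a 0" using a1[of 0] c1[of 0] by auto
  then have D: "0 < D" by (simp add: D_def)
  have "\<bar>ln (cmod (q_denom n z)) - birkhoff_sum ext_map log_snd (Suc n) p\<bar> \<le> (ln 2 - ln (1 - r)) + \<bar>ln D\<bar>" for n
  proof -
    define \<rho> where "\<rho> = (\<Prod>k<Suc n. a k) / (\<Prod>k<Suc n. c k)"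
    have rho: "cmod \<rho> \<le> r" unfolding \<rho>_def r_def by (rule prod_ratio_bound[OF a1 c1])
    have C0: "(\<Prod>k<Suc n. c k) \<noteq> 0" using c0 by (simp add: prod_zero_iff)
    have "q_denom n z * (c 0 - a 0) = (- 1) ^ Suc (Suc n) * ((\<Prod>k<Suc n. c k) - (\<Prod>k<Suc n. a k))"
      unfolding q_denom_def by (rule q_shift_prod[OF a0 step(1) c0 step(2)])
    also have "(\<Prod>k<Suc n. c k) - (\<Prod>k<Suc n. a k) = (\<Prod>k<Suc n. c k) * (1 - \<rho>)"
      using C0 unfolding \<rho>_def by (simp add: right_diff_distrib)
    finally have "cmod (q_denom n z * (c 0 - a 0)) = cmod ((- 1) ^ Suc (Suc n) * ((\<Prod>k<Suc n. c k) * (1 - \<rho>)))"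
      by simp
    then have q: "cmod (q_denom n z) * D = (\<Prod>k<Suc n. cmod (c k)) * cmod (1 - \<rho>)"
      unfolding norm_mult D_def prod_norm by (simp add: norm_power)
    have lo: "1 - r \<le> cmod (1 - \<rho>)" using norm_triangle_ineq2[of 1 \<rho>] rho by simp
    have hi: "cmod (1 - \<rho>) \<le> 2" using norm_triangle_ineq4[of 1 \<rho>] rho r by simp
    have pos: "0 < cmod (1 - \<rho>)" using lo r by linarith
    have prodpos: "0 < (\<Prod>k<Suc n. cmod (c k))" using c0 by (intro prod_pos) simp
    have "0 < cmod (q_denom n z) * D" unfolding q using pos prodpos by (rule mult_pos_pos[rotated])
    then have qpos: "0 < cmod (q_denom n z)" using D by (simp add: zero_less_mult_iff)
    have "ln (cmod (q_denom n z)) + ln D = ln (\<Prod>k<Suc n. cmod (c k)) + ln (cmod (1 - \<rho>))"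
      using q qpos D pos prodpos by (metis ln_mult_pos)
    also have "ln (\<Prod>k<Suc n. cmod (c k)) = (\<Sum>k<Suc n. ln (cmod (c k)))"
      by (rule ln_prod) (use c0 in auto)
    also have "(\<Sum>k<Suc n. ln (cmod (c k))) = birkhoff_sum ext_map log_snd (Suc n) p"
      by (simp add: birkhoff_sum_def c_def)
    finally have eq: "ln (cmod (q_denom n z)) - birkhoff_sum ext_map log_snd (Suc n) p = ln (cmod (1 - \<rho>)) - ln D" by simp
    have "ln (1 - r) \<le> ln (cmod (1 - \<rho>))" "ln (cmod (1 - \<rho>)) \<le> ln 2" using lo hi pos r by simp_all
    moreover have "ln (1 - r) \<le> 0" using r by (simp add: r_def ln_le_zero_iff)
    moreover have "0 \<le> ln (2::real)" by simp
    ultimately show ?thesis unfolding eq by linarith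
  qed
  then show ?thesis using that unfolding z_def by blast
qed

text \<open>The ratio of \<open>n + 1\<close> to \<open>n\<close> absorbs the shift of the index.
  \<open>L\<close> may be infinite here, so the limits are taken in the extended reals.\<close>

lemma tendsto_ereal_shift_bounded:
  fixes s t :: "nat \<Rightarrow> real"
  assumes lim: "(\<lambda>n. ereal (s n / real n)) \<longlonglongrightarrow> L" and bd: "\<And>n. \<bar>t n - s (Suc n)\<bar> \<le> K"
  shows "(\<lambda>n. ereal (t n / real n)) \<longlonglongrightarrow> L"
proof -
  have "(\<lambda>n. ereal (s (Suc n) / real (Suc n))) \<longlonglongrightarrow> L"
    using LIMSEQ_Suc[OF lim] .
  moreover have "(\<lambda>n. ereal (real (Suc n) / real n)) \<longlonglongrightarrow> ereal 1"
  proof -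
    have "(\<lambda>n. 1 + 1 / real n) \<longlonglongrightarrow> 1 + 0" by (intro tendsto_add tendsto_const lim_1_over_n)
    moreover have "eventually (\<lambda>n. 1 + 1 / real n = real (Suc n) / real n) sequentially"
      using eventually_gt_at_top[of 0] by eventually_elim (simp add: field_simps)
    ultimately show ?thesis by (simp add: tendsto_cong)
  qed
  ultimately have "(\<lambda>n. ereal (s (Suc n) / real (Suc n)) * ereal (real (Suc n) / real n)) \<longlonglongrightarrow> L * ereal 1"
    by (intro tendsto_mult_ereal) auto
  then have 1: "(\<lambda>n. ereal (s (Suc n) / real n)) \<longlonglongrightarrow> L"
    unfolding mult_1_right one_ereal_def[symmetric]
    by (rule Lim_transform_eventually) (use eventually_gt_at_top[of 0] in \<open>auto elim!: eventually_mono\<close>)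
  have "(\<lambda>n. (t n - s (Suc n)) / real n) \<longlonglongrightarrow> 0"
  proof (rule tendsto_rabs_zero_cancel, rule tendsto_sandwich[OF _ _ tendsto_const])
    show "(\<lambda>n. K * (1 / real n)) \<longlonglongrightarrow> 0" using tendsto_mult_right_zero[OF lim_1_over_n] .
    show "eventually (\<lambda>n. \<bar>(t n - s (Suc n)) / real n\<bar> \<le> K * (1 / real n)) sequentially"
      using bd by (intro always_eventually allI) (simp add: abs_divide divide_right_mono)
  qed simp
  then have 2: "(\<lambda>n. ereal ((t n - s (Suc n)) / real n)) \<longlonglongrightarrow> ereal 0" by simp
  \<comment> \<open>The second summand has the finite limit 0, so no difference of infinities can
    arise.\<close>
  have "(\<lambda>n. ereal (s (Suc n) / real n) + ereal ((t n - s (Suc n)) / real n)) \<longlonglongrightarrow> L + ereal 0"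
    by (rule tendsto_add_ereal_general1[OF _ 1 2]) simp
  then show ?thesis by (simp add: add_divide_distrib[symmetric])
qed

lemma AE_log_q_denom_limit:
  "AE p in ext_measure. \<exists>L. (\<lambda>n. ereal (birkhoff_sum ext_map log_snd n p / real n)) \<longlonglongrightarrow> L \<and>
     (\<lambda>n. ereal (birkhoff_sum ext_inv log_snd n p / real n)) \<longlonglongrightarrow> L \<and>
     (\<lambda>n. ereal (ln (cmod (q_denom n (fst p))) / real n)) \<longlonglongrightarrow> L"
  using birkhoff_two_sided[OF finite_ext_measure ext_map_preserving ext_inv_preserving AE_ext_inv_map
      AE_ext_map_inv integrable_log_ext_measure]
    mps_AE_orbit[OF ext_map_preserving AE_fwd_dom]
proof eventually_elim
  case (elim p)
  then obtain L where L: "(\<lambda>n. ereal (birkhoff_sum ext_map log_snd n p / real n)) \<longlonglongrightarrow> L"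
    "(\<lambda>n. ereal (birkhoff_sum ext_inv log_snd n p / real n)) \<longlonglongrightarrow> L" by blast
  obtain K where "\<And>n. \<bar>ln (cmod (q_denom n (fst p))) - birkhoff_sum ext_map log_snd (Suc n) p\<bar> \<le> K"
    using log_q_denom_bounded[of p] elim(2) by blast
  from tendsto_ereal_shift_bounded[OF L(1) this] L show ?case by blast
qed

text \<open>The Markov property behind the Hopf argument: equal dual coordinates and equal types give equal
  backward digits.\<close>
lemma ext_inv_same_type:
  assumes q: "(z, w) \<in> (\<Union>b\<in>ideal_J. bwd_dom b)" and ty: "same_type z z'"
  shows "(z', w) \<in> (\<Union>b\<in>ideal_J. bwd_dom b)" "snd (ext_inv (z, w)) = snd (ext_inv (z', w))"
    "same_type (fst (ext_inv (z, w))) (fst (ext_inv (z', w)))"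
proof -
  obtain b where b: "b \<in> ideal_J" "(z, w) \<in> bwd_dom b" using q by blast
  then have W: "(z, w) \<in> nat_ext" "(1 / (z + b), 1 / (w + b)) \<in> nat_ext" by (auto simp: bwd_dom_def bwd_def)
  have "b \<noteq> 0"
  proof
    assume "b = 0"
    then have "1 < cmod (1 / w)" "1 < cmod w" using nat_ext_cmod(2)[OF W(1)] nat_ext_cmod(2)[OF W(2)] by auto
    moreover from this(2) have "cmod (1 / w) < 1" by (simp add: norm_divide divide_less_eq_1)
    ultimately show False by simp
  qed
  moreover have "1 / (z + b) \<in> hexagon" using W(2) by (auto simp: nat_ext_def)
  ultimately have ty': "same_type (1 / (z + b)) (1 / (z' + b))"
    using same_type_inverse_translate[OF b(1) _ ty] by blast
  have b': "(z', w) \<in> bwd_dom b"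
    using same_type_nat_ext[OF ty W(1)] same_type_nat_ext[OF ty' W(2)] by (simp add: bwd_dom_def bwd_def)
  then show "(z', w) \<in> (\<Union>b\<in>ideal_J. bwd_dom b)" using b(1) by blast
  show "snd (ext_inv (z, w)) = snd (ext_inv (z', w))" "same_type (fst (ext_inv (z, w))) (fst (ext_inv (z', w)))"
    using ty' by (simp_all add: ext_inv_eq[OF b] ext_inv_eq[OF b(1) b'] bwd_def)
qed

text \<open>Only the orbit of \<open>(z, w)\<close> is assumed to stay in the domains; equality of
  types hands each backward digit over to the orbit of \<open>(z', w)\<close>.\<close>

lemma ext_inv_orbit_same_type:
  assumes orb: "\<And>k. (ext_inv ^^ k) (z, w) \<in> (\<Union>b\<in>ideal_J. bwd_dom b)" and ty: "same_type z z'"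
  shows "snd ((ext_inv ^^ k) (z, w)) = snd ((ext_inv ^^ k) (z', w)) \<and>
    same_type (fst ((ext_inv ^^ k) (z, w))) (fst ((ext_inv ^^ k) (z', w)))"
proof (induction k)
  case (Suc k)
  obtain x y x' where xy: "(ext_inv ^^ k) (z, w) = (x, y)" "(ext_inv ^^ k) (z', w) = (x', y)"
    using Suc by (metis prod.collapse)
  have "(x, y) \<in> (\<Union>b\<in>ideal_J. bwd_dom b)" "same_type x x'" using orb[of k] Suc by (simp_all add: xy)
  from ext_inv_same_type(2,3)[OF this] show ?case by (simp add: xy)
qed (use ty in simp)

text \<open>A digit so far from all walls of the partition that \<open>z \<mapsto> 1 / (z + far_digit)\<close> maps the whole
  hexagon into a single type.\<close>

definition far_digit :: complex where
  "far_digit = J_vec 1 4"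

lemma far_digit: "far_digit \<in> ideal_J" "e \<in> min_vecs \<Longrightarrow> 2 < \<bar>edge_fn far_digit e\<bar>" "7 \<le> cmod far_digit"
proof -
  show "far_digit \<in> ideal_J" by (auto simp: far_digit_def ideal_J_iff)
  show "e \<in> min_vecs \<Longrightarrow> 2 < \<bar>edge_fn far_digit e\<bar>" by (auto simp: far_digit_def min_vecs_def edge_fn_J_vecs)
  have "7\<^sup>2 \<le> (cmod far_digit)\<^sup>2" unfolding sqn_eq[symmetric] far_digit_def sqn_J_vec by simp
  then show "7 \<le> cmod far_digit" by (rule power2_le_imp_le) simp
qed

text \<open>Here \<open>cmod w \<ge> 6\<close>, beyond every forbidden disc, so all disc conditions
  hold whatever the position of \<open>z\<close>.\<close>

lemma far_ball_nat_ext: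
  assumes z: "z \<in> hexagon" "generic z" and w: "w \<in> ball (- far_digit) (1 / 2)"
  shows "(z, w) \<in> nat_ext"
proof -
  have "cmod far_digit \<le> cmod (w - (- far_digit)) + cmod w"
    using norm_triangle_ineq4[of "w + far_digit" w] by simp
  moreover have "cmod (w - (- far_digit)) < 1 / 2" using w by (simp add: dist_norm norm_minus_commute)
  ultimately have w6: "6 \<le> cmod w" using far_digit(3) by linarith
  have "1 < cmod (w - e)" "1 / 2 < cmod (w - e / 2)" if e: "e \<in> min_vecs" for e
  proof -
    have "cmod e \<le> 2" unfolding cmod_min_vec[OF e] by (simp add: real_le_lsqrt)
    then show "1 < cmod (w - e)" "1 / 2 < cmod (w - e / 2)"
      using norm_triangle_ineq2[of w e] norm_triangle_ineq2[of w "e / 2"] w6 by (simp_all add: norm_divide)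
  qed
  then show ?thesis using z w6 dual_circles[of _ w] unfolding nat_ext_def generic_def
    by (auto simp: sqn_eq power2_eq_square intro: less_le_trans[OF _ mult_mono[of 6 _ 6]])
qed

text \<open>The backward digit is forced: \<open>w + b\<close> has modulus below 1 because its
  inverse is a dual coordinate, so \<open>b\<close> is a lattice point at distance less than
  \<open>3 / 2 < sqrt 3\<close> from \<open>far_digit\<close>.\<close>

lemma ext_inv_far_ball:
  assumes w: "w \<in> ball (- far_digit) (1 / 2)" and q: "(z, w) \<in> (\<Union>b\<in>ideal_J. bwd_dom b)"
  shows "ext_inv (z, w) = (1 / (z + far_digit), 1 / (w + far_digit))"
proof -
  obtain b where b: "b \<in> ideal_J" "(z, w) \<in> bwd_dom b" using q by blast
  then have W: "(1 / (z + b), 1 / (w + b)) \<in> nat_ext" by (auto simp: bwd_dom_def bwd_def)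
  have "w + b \<noteq> 0" using nat_ext_nonzero(2)[OF W] by auto
  then have "cmod (w + b) < 1" using nat_ext_cmod(2)[OF W] by (simp add: norm_divide field_simps)
  moreover have "cmod (w + far_digit) < 1 / 2" using w by (simp add: dist_norm norm_minus_commute)
  moreover have "cmod (b - far_digit) \<le> cmod (w + b) + cmod (w + far_digit)"
    using norm_triangle_ineq4[of "w + b" "w + far_digit"] by simp
  ultimately have lt: "cmod (b - far_digit) < 3 / 2" by linarith
  have "b - far_digit \<in> ideal_J" using b(1) far_digit(1) by (rule ideal_J_diff)
  moreover have "3 / 2 < sqrt 3" by (rule real_less_rsqrt) (simp add: power2_eq_square)
  ultimately have "b = far_digit" using ideal_J_cases[of "b - far_digit"] lt cmod_min_vec[of "b - far_digit"] by auto
  then show ?thesis using ext_inv_eq[OF b] by (simp add: bwd_def)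
qed

text \<open>\<open>z\<close> and \<open>z'\<close> may be of different types; the first backward
  step brings both into one type, and from then on the second coordinates coincide.\<close>

lemma backward_average_far_ball:
  assumes w: "w \<in> ball (- far_digit) (1 / 2)" and z: "z \<in> hexagon" "z' \<in> hexagon"
    and orb: "\<And>k. (ext_inv ^^ k) (z, w) \<in> (\<Union>b\<in>ideal_J. bwd_dom b)"
    and q: "(z', w) \<in> (\<Union>b\<in>ideal_J. bwd_dom b)"
  shows "birkhoff_sum ext_inv log_snd n (z, w) = birkhoff_sum ext_inv log_snd n (z', w)"
proof -
  let ?x = "1 / (z + far_digit)" and ?x' = "1 / (z' + far_digit)" and ?w = "1 / (w + far_digit)"
  have "(z, w) \<in> (\<Union>b\<in>ideal_J. bwd_dom b)" using orb[of 0] by simp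
  then have e: "ext_inv (z, w) = (?x, ?w)" by (rule ext_inv_far_ball[OF w])
  have e': "ext_inv (z', w) = (?x', ?w)" by (rule ext_inv_far_ball[OF w q])
  have ty: "same_type ?x ?x'" by (rule same_type_far_translate[OF far_digit(1,2) z])
  have orb': "(ext_inv ^^ k) (?x, ?w) \<in> (\<Union>b\<in>ideal_J. bwd_dom b)" for k
    using orb[of "Suc k"] by (simp add: funpow_swap1 e)
  have "snd ((ext_inv ^^ k) (z, w)) = snd ((ext_inv ^^ k) (z', w))" for k
  proof (cases k)
    case (Suc j)
    then show ?thesis using ext_inv_orbit_same_type[OF orb' ty, of j] by (simp add: funpow_swap1 e e')
  qed simp
  then show ?thesis by (simp add: birkhoff_sum_def)
qed

section \<open>Slices over the far disc and constancy of the limit\<close>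

lemma AE_ext_measure_slice:
  assumes "AE p in ext_measure. R p"
  obtains w where "w \<in> ball (- far_digit) (1 / 2)" "AE z in lborel. z \<in> hexagon \<longrightarrow> R (z, w)"
proof -
  have "AE p in lborel \<Otimes>\<^sub>M lborel. p \<in> nat_ext \<longrightarrow> R p" using assms by (simp add: AE_ext_measure)
  then have "AE p in distr (lborel \<Otimes>\<^sub>M lborel) (lborel \<Otimes>\<^sub>M lborel) (\<lambda>(x, y). (y, x)). p \<in> nat_ext \<longrightarrow> R p"
    by (simp only: lborel_pair.distr_pair_swap[symmetric])
  then have "AE p in lborel \<Otimes>\<^sub>M lborel. (case p of (x, y) \<Rightarrow> (y, x)) \<in> nat_ext \<longrightarrow> R (case p of (x, y) \<Rightarrow> (y, x))"
    by (rule AE_distrD[OF measurable_pair_swap'])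
  from lborel_pair.AE_pair[OF this]
  have slice: "AE w in lborel. AE z in lborel. (z, w) \<in> nat_ext \<longrightarrow> R (z, w)" by simp
  \<comment> \<open>The disc has positive measure, so it contains a \<open>w\<close> whose slice is
    good; \<open>far_ball_nat_ext\<close> makes that slice the full hexagon.\<close>
  have "\<exists>w\<in>ball (- far_digit) (1 / 2). AE z in lborel. (z, w) \<in> nat_ext \<longrightarrow> R (z, w)"
  proof (rule ccontr)
    assume "\<not> ?thesis"
    with slice have "AE w in lborel. w \<notin> ball (- far_digit) (1 / 2)"
      by (auto elim!: eventually_mono)
    then have "ball (- far_digit) (1 / 2) \<in> null_sets lborel"
      by (subst AE_iff_null_sets) auto
    then have "negligible (ball (- far_digit) (1 / 2))"
      by (simp add: negligible_iff_null_sets null_sets_completionI)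
    moreover have "\<not> negligible (ball (- far_digit) (1 / 2))"
      by (rule open_not_negligible) auto
    ultimately show False by blast
  qed
  then obtain w where w: "w \<in> ball (- far_digit) (1 / 2)" "AE z in lborel. (z, w) \<in> nat_ext \<longrightarrow> R (z, w)" by blast
  have "AE z in lborel. z \<in> hexagon \<longrightarrow> R (z, w)"
    using w(2) AE_generic by eventually_elim (use far_ball_nat_ext[OF _ _ w(1)] in blast)
  with w(1) that show ?thesis by blast
qed

lemma AE_hexagon_not_False: "\<not> (AE z in lborel. z \<notin> hexagon)"
proof
  assume "AE z in lborel. z \<notin> hexagon"
  then have "hexagon \<in> null_sets lborel" using open_hexagon by (subst AE_iff_null_sets) auto
  then have "negligible hexagon" by (simp add: negligible_iff_null_sets null_sets_completionI)
  moreover have "0 \<in> hexagon" by (simp add: hexagon_def)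
  then have "\<not> negligible hexagon" using open_hexagon by (intro open_not_negligible) auto
  ultimately show False by blast
qed

lemma ext_measure_nontrivial: "\<not> (AE p in ext_measure. False)"
proof
  assume "AE p in ext_measure. False"
  then obtain w where "AE z in lborel. z \<in> hexagon \<longrightarrow> False" by (rule AE_ext_measure_slice)
  then show False using AE_hexagon_not_False by simp
qed

lemma measure_ext_measure_pos: "0 < measure ext_measure (space ext_measure)"
proof -
  interpret finite_measure ext_measure by (rule finite_ext_measure)
  have "emeasure ext_measure (space ext_measure) \<noteq> 0"
  proof
    assume "emeasure ext_measure (space ext_measure) = 0"
    then have "space ext_measure \<in> null_sets ext_measure" by (intro null_setsI sets.top)
    then have "AE p in ext_measure. p \<notin> space ext_measure" by (rule AE_not_in)
    then show False using ext_measure_nontrivial by simp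
  qed
  then show ?thesis by (simp add: emeasure_eq_measure zero_less_measure_iff)
qed

text \<open>On one slice over the far disc, the growth rate at almost every \<open>z\<close> equals
  the backward limit at \<open>(z, w)\<close>, hence the one at a fixed \<open>(z1, w)\<close>. As
  the rate does not involve \<open>w\<close>, this passes to almost every pair, where it is the
  forward average, and \<open>birkhoff_constant_limit\<close> evaluates it.\<close>

theorem AE_log_q_denom_tendsto:
  "AE z in lborel. z \<in> hexagon \<longrightarrow> (\<lambda>n. ln (cmod (q_denom n z)) / real n) \<longlonglongrightarrow>
     (\<integral>p. log_snd p \<partial>ext_measure) / measure ext_measure (space ext_measure)"
proof -
  let ?q = "\<lambda>z n. ereal (ln (cmod (q_denom n z)) / real n)"
  have "AE p in ext_measure. (\<forall>k. (ext_inv ^^ k) p \<in> (\<Union>b\<in>ideal_J. bwd_dom b)) \<and>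
     (\<exists>L. (\<lambda>n. ereal (birkhoff_sum ext_inv log_snd n p / real n)) \<longlonglongrightarrow> L \<and> ?q (fst p) \<longlonglongrightarrow> L)"
    using mps_AE_orbit[OF ext_inv_preserving AE_bwd_dom] AE_log_q_denom_limit by eventually_elim blast
  then obtain w where w: "w \<in> ball (- far_digit) (1 / 2)"
    and ae: "AE z in lborel. z \<in> hexagon \<longrightarrow> (\<forall>k. (ext_inv ^^ k) (z, w) \<in> (\<Union>b\<in>ideal_J. bwd_dom b)) \<and>
     (\<exists>L. (\<lambda>n. ereal (birkhoff_sum ext_inv log_snd n (z, w) / real n)) \<longlonglongrightarrow> L \<and> ?q (fst (z, w)) \<longlonglongrightarrow> L)"
    by (rule AE_ext_measure_slice)
  define good where "good z \<longleftrightarrow> (\<forall>k. (ext_inv ^^ k) (z, w) \<in> (\<Union>b\<in>ideal_J. bwd_dom b)) \<and>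
     (\<exists>L. (\<lambda>n. ereal (birkhoff_sum ext_inv log_snd n (z, w) / real n)) \<longlonglongrightarrow> L)" for z
  have "\<exists>z. z \<in> hexagon \<and> good z"
  proof (rule ccontr)
    assume none: "\<not> ?thesis"
    have "AE z in lborel. z \<notin> hexagon"
      using ae
    proof eventually_elim
      case (elim z)
      then have "z \<in> hexagon \<Longrightarrow> good z" unfolding good_def by blast
      with none show ?case by blast
    qed
    then show False using AE_hexagon_not_False by blast
  qed
  then obtain z1 where z1: "z1 \<in> hexagon" "\<And>k. (ext_inv ^^ k) (z1, w) \<in> (\<Union>b\<in>ideal_J. bwd_dom b)"
    and "\<exists>L. (\<lambda>n. ereal (birkhoff_sum ext_inv log_snd n (z1, w) / real n)) \<longlonglongrightarrow> L"
    unfolding good_def by blast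
  then obtain c where c: "(\<lambda>n. ereal (birkhoff_sum ext_inv log_snd n (z1, w) / real n)) \<longlonglongrightarrow> c" by blast
  have lim: "AE z in lborel. z \<in> hexagon \<longrightarrow> ?q z \<longlonglongrightarrow> c"
    using ae
  proof eventually_elim
    case (elim z)
    show ?case
    proof
      assume z: "z \<in> hexagon"
      with elim obtain L where L: "(\<lambda>n. ereal (birkhoff_sum ext_inv log_snd n (z, w) / real n)) \<longlonglongrightarrow> L" "?q z \<longlonglongrightarrow> L"
        by auto
      have "(ext_inv ^^ 0) (z, w) \<in> (\<Union>b\<in>ideal_J. bwd_dom b)" using elim z by blast
      then have "birkhoff_sum ext_inv log_snd n (z1, w) = birkhoff_sum ext_inv log_snd n (z, w)" for n
        using backward_average_far_ball[OF w z1(1) z z1(2)] by simp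
      then have "L = c" using L(1) c LIMSEQ_unique by auto
      then show "?q z \<longlonglongrightarrow> c" using L(2) by simp
    qed
  qed
  have "AE p in ext_measure. fst p \<in> hexagon \<longrightarrow> ?q (fst p) \<longlonglongrightarrow> c"
    using AE_fst[OF lim] by (simp add: AE_ext_measure) (auto elim!: eventually_mono)
  then have "AE p in ext_measure. (\<lambda>n. ereal (birkhoff_sum ext_map log_snd n p / real n)) \<longlonglongrightarrow> c"
    using AE_log_q_denom_limit AE_in_nat_ext
  proof eventually_elim
    case (elim p)
    then have "fst p \<in> hexagon" by (auto simp: nat_ext_def)
    then show ?case using elim LIMSEQ_unique by blast
  qed
  then have "c = ereal ((\<integral>p. log_snd p \<partial>ext_measure) / measure ext_measure (space ext_measure))"
    by (rule birkhoff_constant_limit[OF finite_ext_measure ext_map_preserving integrable_log_ext_measure measure_ext_measure_pos])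
  with lim show ?thesis by simp
qed

lemma integral_log_ext_measure_pos: "0 < (\<integral>p. log_snd p \<partial>ext_measure)"
proof -
  have pos: "AE p in ext_measure. 0 < log_snd p"
    using AE_in_nat_ext by eventually_elim (use nat_ext_cmod(2) in \<open>force simp: ln_gt_zero\<close>)
  have nonneg: "AE p in ext_measure. 0 \<le> log_snd p" using pos by eventually_elim simp
  have "(\<integral>p. log_snd p \<partial>ext_measure) \<noteq> 0"
  proof
    assume "(\<integral>p. log_snd p \<partial>ext_measure) = 0"
    then have "AE p in ext_measure. log_snd p = 0"
      using integral_nonneg_eq_0_iff_AE[OF integrable_log_ext_measure nonneg] by blast
    with pos have "AE p in ext_measure. False" by eventually_elim simp
    then show False using ext_measure_nontrivial by blast
  qed
  moreover have "0 \<le> (\<integral>p. log_snd p \<partial>ext_measure)" by (rule integral_nonneg_AE[OF nonneg])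
  ultimately show ?thesis by simp
qed

section \<open>The normalized measure\<close>

lemma U_measurable [measurable]: "U \<in> sets borel"
proof -
  have seg: "{of_real t * a + of_real (1 - t) * b | t. 0 < t \<and> t < 1} \<in> sets borel" if "a \<noteq> b" for a b :: complex
  proof -
    have "{of_real t * a + of_real (1 - t) * b | t. 0 < t \<and> t < 1} = open_segment b a"
      using that by (auto simp: in_segment scaleR_conv_of_real add.commute)
    then show ?thesis by (simp add: open_segment_def)
  qed
  have "zeta \<noteq> - cnj zeta" "- zeta \<noteq> - 1" "1 \<noteq> cnj zeta" by (auto simp: zeta_eq complex_eq_iff)
  from seg[OF this(1)] seg[OF this(2)] seg[OF this(3)] show ?thesis
    unfolding U_def by (intro sets.Un) (auto simp: borel_open)
qed

lemma V_measurable [measurable]: "V k l \<in> sets borel" "V_dual k l \<in> sets borel"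
proof -
  have ifs: "(if c then A else B) \<in> sets borel" if "A \<in> sets borel" "B \<in> sets borel" for c and A B :: "complex set"
    using that by simp
  have Uc: "{z \<in> U. P z} \<in> sets borel" if "{z. P z} \<in> sets borel" for P
    using sets.Int[OF U_measurable that] by (simp add: Int_def)
  have V1: "V1 k \<in> sets borel" for k
    unfolding V1_def by (intro ifs Uc; measurable)
  have V1_dual: "V1_dual k \<in> sets borel" for k
    unfolding V1_dual_def by (intro ifs; measurable)
  have rot: "(\<lambda>z. zeta ^ n * z) ` A \<in> sets borel" if "A \<in> sets borel" for n A
  proof -
    have "(\<lambda>z. zeta ^ n * z) ` A = (\<lambda>z. z / zeta ^ n) -` A"
      by (auto simp: image_iff) (metis nonzero_mult_div_cancel_left times_divide_eq_right zeta_nonzero power_not_zero)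
    moreover have "(\<lambda>z. z / zeta ^ n) \<in> borel_measurable borel" by measurable
    ultimately show ?thesis using measurable_sets[of "\<lambda>z. z / zeta ^ n" borel borel A] that by simp
  qed
  show "V k l \<in> sets borel" "V_dual k l \<in> sets borel"
    unfolding V_def V_dual_def by (intro rot V1 V1_dual)+
qed

lemma U_hat_measurable [measurable]: "U_hat \<in> sets (lborel \<Otimes>\<^sub>M lborel)"
  unfolding U_hat_def by (intro sets.finite_UN) auto

lemma cl_hexagon_generic: "z \<in> cl_hexagon \<Longrightarrow> generic z \<Longrightarrow> z \<in> hexagon"
  by (force simp: hexagon_def cl_hexagon_def generic_def less_le)

text \<open>First coordinates of \<open>U_hat\<close> lie in rotated copies of \<open>U\<close>,
  hence in the closed hexagon; generic ones lie in the open hexagon, where the pieces have been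
  matched.\<close>

lemma AE_U_hat: "AE p in lborel \<Otimes>\<^sub>M lborel. p \<in> U_hat \<longleftrightarrow> p \<in> nat_ext"
  using AE_fst[OF AE_generic]
proof eventually_elim
  case (elim p)
  obtain z w where p: "p = (z, w)" by (cases p)
  have gen: "generic z" using elim by (simp add: p)
  show ?case
  proof (cases "z \<in> hexagon")
    case True
    then show ?thesis using U_hat_iff_nat_ext gen p by blast
  next
    case False
    have "p \<notin> U_hat"
    proof
      assume "p \<in> U_hat"
      then obtain k l z0 where z0: "z0 \<in> V1 k" "z = zeta ^ (l - 1) * z0"
        by (auto simp: U_hat_def V_def p)
      have "z0 \<in> U" using z0(1) by (auto simp: V1_def split: if_splits)
      then have "z0 \<in> cl_hexagon" using U_subset_cl_hexagon by blast
      moreover have "generic z0" using gen z0(2) generic_rotate by simp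
      ultimately have "z0 \<in> hexagon" by (rule cl_hexagon_generic)
      with False show False by (simp add: z0(2) hexagon_rotate)
    qed
    then show ?thesis using False by (auto simp: p nat_ext_def)
  qed
qed

lemma mu_hat_integral:
  shows "integrable mu_hat (\<lambda>p. ln (cmod (snd p)))"
    and "(\<integral>p. ln (cmod (snd p)) \<partial>mu_hat) = (\<integral>p. log_snd p \<partial>ext_measure) / measure ext_measure (space ext_measure)"
proof -
  interpret finite_measure ext_measure by (rule finite_ext_measure)
  define m where "m = measure ext_measure (space ext_measure)"
  have m: "0 < m" unfolding m_def by (rule measure_ext_measure_pos)
  define k where "k p = 1 / cmod (fst p - snd p) ^ 4" for p :: "complex \<times> complex"
  have kh: "kernel_hat p = ennreal (k p)" for p by (simp add: kernel_hat_def k_def split_beta)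
  have k0: "0 \<le> k p" for p by (simp add: k_def)
  let ?L = "lborel \<Otimes>\<^sub>M (lborel :: complex measure)"
  have km [measurable]: "k \<in> borel_measurable ?L" unfolding k_def by measurable
  have fm [measurable]: "log_snd \<in> borel_measurable ?L" by measurable
  have "(\<integral>\<^sup>+p\<in>U_hat. kernel_hat p \<partial>?L) = (\<integral>\<^sup>+p. indicator nat_ext p * kernel_hat p \<partial>?L)"
    by (rule nn_integral_cong_AE) (use AE_U_hat in \<open>eventually_elim, auto simp: indicator_def\<close>)
  also have "\<dots> = (\<integral>\<^sup>+p. 1 \<partial>ext_measure)"
    by (subst nn_integral_ext_measure) auto
  also have "\<dots> = ennreal m" by (simp add: m_def emeasure_eq_measure)
  \<comment> \<open>\<open>m\<close> is positive and finite, so the extended division is the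
    ordinary one and \<open>C0\<close> really normalizes.\<close>
  finally have "C0 = ennreal (1 / m)"
    unfolding C0_def using m by (simp add: divide_ennreal[symmetric])
  then have "C0 * kernel_hat p = ennreal (k p / m)" for p
    using m k0[of p] ennreal_mult[of "1 / m" "k p"] by (simp add: kh)
  then have mu: "mu_hat = density (restrict_space ?L U_hat) (\<lambda>p. ennreal (k p / m))"
    by (simp add: mu_hat_def)
  have ext: "ext_measure = density ?L (\<lambda>p. ennreal (indicator nat_ext p * k p))"
    unfolding ext_measure_def
    by (intro arg_cong2[where f = density] refl ext) (simp add: kh indicator_def)
  have U: "U_hat \<inter> space ?L \<in> sets ?L" using U_hat_measurable by auto
  have meas: "log_snd \<in> borel_measurable (restrict_space ?L U_hat)" "(\<lambda>p. k p / m) \<in> borel_measurable (restrict_space ?L U_hat)"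
    by (intro measurable_restrict_space1; measurable)+
  have nn: "AE p in restrict_space ?L U_hat. 0 \<le> k p / m" using k0 m by simp
  have nn': "AE p in ?L. 0 \<le> indicator nat_ext p * k p" using k0 by simp
  have aeq: "AE p in ?L. indicator U_hat p *\<^sub>R ((k p / m) *\<^sub>R log_snd p) = ((indicator nat_ext p * k p) *\<^sub>R log_snd p) / m"
    using AE_U_hat by eventually_elim (auto simp: indicator_def)
  have "integrable ?L (\<lambda>p. (indicator nat_ext p * k p) *\<^sub>R log_snd p)"
    using integrable_log_ext_measure unfolding ext by (subst (asm) integrable_density[OF _ _ nn']) auto
  then have "integrable ?L (\<lambda>p. ((indicator nat_ext p * k p) *\<^sub>R log_snd p) / m)" by simp
  then have "integrable ?L (\<lambda>p. indicator U_hat p *\<^sub>R ((k p / m) *\<^sub>R log_snd p))"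
    by (subst integrable_cong_AE[OF _ _ aeq]) auto
  then show "integrable mu_hat (\<lambda>p. ln (cmod (snd p)))"
    unfolding mu integrable_density[OF meas nn] integrable_restrict_space[OF U] .
  have "(\<integral>p. log_snd p \<partial>mu_hat) = (\<integral>p. indicator U_hat p *\<^sub>R ((k p / m) *\<^sub>R log_snd p) \<partial>?L)"
    unfolding mu integral_density[OF meas nn] integral_restrict_space[OF U] ..
  also have "\<dots> = (\<integral>p. ((indicator nat_ext p * k p) *\<^sub>R log_snd p) / m \<partial>?L)"
    by (rule integral_cong_AE[OF _ _ aeq]) auto
  also have "\<dots> = (\<integral>p. (indicator nat_ext p * k p) *\<^sub>R log_snd p \<partial>?L) / m" by simp
  also have "(\<integral>p. (indicator nat_ext p * k p) *\<^sub>R log_snd p \<partial>?L) = (\<integral>p. log_snd p \<partial>ext_measure)"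
    unfolding ext by (rule integral_density[symmetric, OF _ _ nn']) auto
  finally show "(\<integral>p. ln (cmod (snd p)) \<partial>mu_hat) = (\<integral>p. log_snd p \<partial>ext_measure) / measure ext_measure (space ext_measure)"
    unfolding m_def .
qed

theorem corollary2:
  shows "(AE z in lebesgue. z \<in> U \<longrightarrow>
            (\<lambda>n. ln (cmod (q_denom n z)) / real n) \<longlonglongrightarrow> (\<integral>p. ln (cmod (snd p)) \<partial>mu_hat))
       \<and> integrable mu_hat (\<lambda>p. ln (cmod (snd p)))
       \<and> (\<integral>p. ln (cmod (snd p)) \<partial>mu_hat) > 0"
proof (intro conjI)
  have "AE z in lborel. z \<in> U \<longrightarrow> (\<lambda>n. ln (cmod (q_denom n z)) / real n) \<longlonglongrightarrow> (\<integral>p. ln (cmod (snd p)) \<partial>mu_hat)"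
    using AE_log_q_denom_tendsto AE_generic
  proof eventually_elim
    case (elim z)
    then show ?case using U_subset_cl_hexagon cl_hexagon_generic unfolding mu_hat_integral(2) by blast
  qed
  then show "AE z in lebesgue. z \<in> U \<longrightarrow> (\<lambda>n. ln (cmod (q_denom n z)) / real n) \<longlonglongrightarrow> (\<integral>p. ln (cmod (snd p)) \<partial>mu_hat)"
    by (rule AE_completion)
  show "integrable mu_hat (\<lambda>p. ln (cmod (snd p)))" by (rule mu_hat_integral)
  show "(\<integral>p. ln (cmod (snd p)) \<partial>mu_hat) > 0"
    unfolding mu_hat_integral(2) using integral_log_ext_measure_pos measure_ext_measure_pos by (rule divide_pos_pos)
qed

end
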